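(* Let $\mathcal G=(V,E)$ be a nonempty finite simple $d$-regular arc-transitive graph with $d\ge3$, independence number $\alpha(\mathcal G)$, and least adjacency eigenvalue $\lambda_{\min}$. Then $$\frac{\alpha(\mathcal G)}{|V|}\ \ge\ q_d(\lambda_{\min}).$$
   Context: A graph is arc-transitive if its automorphism group acts transitively on ordered pairs of adjacent vertices. For an integer $d\ge3$ and $-d\le\lambda\le d$ put $\varrho_\lambda=\frac{d-2-\lambda}{2(d-1)}$ and $\Omega_\lambda=(1-\varrho_\lambda)I+\varrho_\lambda J\in\mathbb R^{d\times d}$ ($J$ the all-ones matrix), which is a correlation matrix (positive semidefinite with unit diagonal), and define $q_d(\lambda)=\mathbb P\{X_i>0\text{ for every }i\}$ for a centered Gaussian vector $X\sim\mathcal N(0,\Omega_\lambda)$ in $\mathbb R^d$. (Every adjacency eigenvalue of a $d$-regular graph lies in $[-d,d]$.) *)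

theory Defs
  imports "HOL-Probability.Probability"
begin

definition simple_graph :: "'a set \<Rightarrow> 'a set set \<Rightarrow> bool" where
  "simple_graph V E \<longleftrightarrow> finite V \<and> E \<subseteq> {e. e \<subseteq> V \<and> card e = 2}"

definition regular_graph :: "'a set \<Rightarrow> 'a set set \<Rightarrow> nat \<Rightarrow> bool" where
  "regular_graph V E d \<longleftrightarrow> (\<forall>v\<in>V. card {u\<in>V. {v, u} \<in> E} = d)"

definition graph_automorphism :: "'a set \<Rightarrow> 'a set set \<Rightarrow> ('a \<Rightarrow> 'a) \<Rightarrow> bool" where
  "graph_automorphism V E f \<longleftrightarrow>
     bij_betw f V V \<and> (\<forall>u\<in>V. \<forall>v\<in>V. {f u, f v} \<in> E \<longleftrightarrow> {u, v} \<in> E)"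

definition arc_transitive :: "'a set \<Rightarrow> 'a set set \<Rightarrow> bool" where
  "arc_transitive V E \<longleftrightarrow>
     (\<forall>u\<in>V. \<forall>v\<in>V. \<forall>u'\<in>V. \<forall>v'\<in>V. {u, v} \<in> E \<longrightarrow> {u', v'} \<in> E \<longrightarrow>
        (\<exists>f. graph_automorphism V E f \<and> f u = u' \<and> f v = v'))"

definition independent_set :: "'a set \<Rightarrow> 'a set set \<Rightarrow> 'a set \<Rightarrow> bool" where
  "independent_set V E S \<longleftrightarrow> S \<subseteq> V \<and> (\<forall>u\<in>S. \<forall>v\<in>S. {u, v} \<notin> E)"

definition independence_number :: "'a set \<Rightarrow> 'a set set \<Rightarrow> nat" where
  "independence_number V E = Max (card ` {S. independent_set V E S})"

definition adjacency :: "'a set set \<Rightarrow> 'a \<Rightarrow> 'a \<Rightarrow> real" where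
  "adjacency E u v = (if {u, v} \<in> E then 1 else 0)"

definition adjacency_eigenvalue :: "'a set \<Rightarrow> 'a set set \<Rightarrow> real \<Rightarrow> bool" where
  "adjacency_eigenvalue V E l \<longleftrightarrow>
     (\<exists>x :: 'a \<Rightarrow> real. (\<exists>v\<in>V. x v \<noteq> 0) \<and>
        (\<forall>v\<in>V. (\<Sum>u\<in>V. adjacency E v u * x u) = l * x v))"

definition least_eigenvalue :: "'a set \<Rightarrow> 'a set set \<Rightarrow> real" where
  "least_eigenvalue V E = Min {l. adjacency_eigenvalue V E l}"

(* Vectors in R^d and d x d matrices are functions of indices below d. *)

definition std_gaussian :: "nat \<Rightarrow> (nat \<Rightarrow> real) measure" where
  "std_gaussian d = (\<Pi>\<^sub>M i\<in>{..<d}. std_normal_distribution)"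

definition matrix_root :: "nat \<Rightarrow> (nat \<Rightarrow> nat \<Rightarrow> real) \<Rightarrow> (nat \<Rightarrow> nat \<Rightarrow> real) \<Rightarrow> bool" where
  "matrix_root d S A \<longleftrightarrow> (\<forall>i<d. \<forall>j<d. (\<Sum>k<d. A i k * A j k) = S i j)"

definition linear_image :: "nat \<Rightarrow> (nat \<Rightarrow> nat \<Rightarrow> real) \<Rightarrow> (nat \<Rightarrow> real) \<Rightarrow> nat \<Rightarrow> real" where
  "linear_image d A z = (\<lambda>i\<in>{..<d}. \<Sum>k<d. A i k * z k)"

(* N(0,S), for S positive semidefinite and possibly singular, as the law of A Z where
   A A^T = S and Z has independent standard normal entries. The law does not depend on the
   choice of A: by char_linear_functional below, the characteristic function of
   <a, A Z> is t |-> exp (- t^2 <a, S a> / 2) for every such A and every vector a. *)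
definition gaussian_law :: "nat \<Rightarrow> (nat \<Rightarrow> nat \<Rightarrow> real) \<Rightarrow> (nat \<Rightarrow> real) measure" where
  "gaussian_law d S =
     distr (std_gaussian d) (\<Pi>\<^sub>M i\<in>{..<d}. borel) (linear_image d (SOME A. matrix_root d S A))"

definition rho :: "nat \<Rightarrow> real \<Rightarrow> real" where
  "rho d l = (real d - 2 - l) / (2 * (real d - 1))"

definition Omega :: "nat \<Rightarrow> real \<Rightarrow> nat \<Rightarrow> nat \<Rightarrow> real" where
  "Omega d l i j = (1 - rho d l) * (if i = j then 1 else 0) + rho d l"

definition orthant_probability :: "nat \<Rightarrow> real \<Rightarrow> real" where
  "orthant_probability d l = measure (gaussian_law d (Omega d l))
     {x \<in> space (gaussian_law d (Omega d l)). \<forall>i<d. x i > 0}"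

lemma matrix_root_Omega:
  assumes d: "d \<ge> 3" and l: "- real d \<le> l" "l \<le> real d"
  shows "\<exists>A. matrix_root d (Omega d l) A"
proof -
  define r where "r = rho d l"
  have d1: "real d - 1 > 0" using d by simp
  have r1: "r \<le> 1" using l d1 unfolding r_def rho_def by (simp add: field_simps)
  have "(real d - 1) * r = (real d - 2 - l) / 2"
    using d1 unfolding r_def rho_def by (simp add: divide_simps)
  then have r2: "1 + (real d - 1) * r \<ge> 0" using l by simp
  define a where "a = sqrt (1 - r)"
  define s where "s = sqrt (1 + (real d - 1) * r)"
  define b where "b = (s - a) / real d"
  have aa: "a * a = 1 - r" and ss: "s * s = 1 + (real d - 1) * r"
    using r1 r2 by (simp_all add: a_def s_def)
  have db: "real d * b = s - a" using d by (simp add: b_def)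
  have "real d * (2 * a * b + real d * b * b) = (real d * b) * (2 * a + real d * b)"
    by (simp add: algebra_simps)
  also have "\<dots> = s * s - a * a" unfolding db by (simp add: algebra_simps)
  also have "\<dots> = real d * r" unfolding aa ss by (simp add: algebra_simps)
  finally have rr: "2 * a * b + real d * b * b = r" using d by simp
  define A where "A = (\<lambda>i j :: nat. (if i = j then a else 0) + b)"
  have "(\<Sum>k<d. A i k * A j k) = Omega d l i j" if "i < d" "j < d" for i j
  proof -
    have "(\<Sum>k<d. A i k * A j k) =
        (\<Sum>k<d. (if i = k then a * (if j = k then a else 0) else 0) + (if i = k then a * b else 0)
             + (if j = k then a * b else 0) + b * b)"
      by (rule sum.cong) (auto simp: A_def algebra_simps)
    also have "\<dots> = (if i = j then a * a else 0) + (2 * a * b + real d * b * b)"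
      using that by (simp add: sum.distrib)
    finally show ?thesis unfolding rr by (simp add: aa Omega_def r_def)
  qed
  then show ?thesis unfolding matrix_root_def by blast
qed

lemma measurable_linear_image [measurable]:
  "linear_image d A \<in> std_gaussian d \<rightarrow>\<^sub>M (\<Pi>\<^sub>M i\<in>{..<d}. borel)"
  unfolding linear_image_def std_gaussian_def by (rule measurable_restrict) measurable

lemma char_linear_functional:
  assumes "matrix_root d S A"
  shows "char (distr (std_gaussian d) borel (\<lambda>z. \<Sum>i<d. a i * linear_image d A z i)) t =
           exp (- (t\<^sup>2 * (\<Sum>i<d. \<Sum>j<d. a i * S i j * a j)) / 2)"
proof -
  define c where "c k = (\<Sum>i<d. a i * A i k)" for k
  have S: "(\<Sum>i<d. \<Sum>j<d. a i * S i j * a j) = (\<Sum>k<d. (c k)\<^sup>2)"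
  proof -
    have "(\<Sum>k<d. (c k)\<^sup>2) = (\<Sum>k<d. \<Sum>i<d. \<Sum>j<d. a i * A i k * (a j * A j k))"
      unfolding c_def power2_eq_square sum_product ..
    also have "\<dots> = (\<Sum>i<d. \<Sum>j<d. \<Sum>k<d. a i * A i k * (a j * A j k))"
      by (subst sum.swap, rule sum.cong[OF refl], rule sum.swap)
    also have "\<dots> = (\<Sum>i<d. \<Sum>j<d. a i * S i j * a j)"
    proof (intro sum.cong refl)
      fix i j assume "i \<in> {..<d}" "j \<in> {..<d}"
      then have "S i j = (\<Sum>k<d. A i k * A j k)" using assms by (simp add: matrix_root_def)
      then show "(\<Sum>k<d. a i * A i k * (a j * A j k)) = a i * S i j * a j"
        by (simp add: sum_distrib_left sum_distrib_right mult_ac)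
    qed
    finally show ?thesis ..
  qed
  have lin: "(\<Sum>i<d. a i * linear_image d A z i) = (\<Sum>k<d. c k * z k)" for z
  proof -
    have "(\<Sum>i<d. a i * linear_image d A z i) = (\<Sum>i<d. \<Sum>k<d. a i * (A i k * z k))"
      by (simp add: linear_image_def sum_distrib_left)
    also have "\<dots> = (\<Sum>k<d. \<Sum>i<d. a i * (A i k * z k))" by (rule sum.swap)
    finally show ?thesis by (simp add: c_def sum_distrib_left sum_distrib_right mult_ac)
  qed
  interpret N: prob_space std_normal_distribution
    by (rule real_distribution.axioms(1)[OF real_dist_normal_dist])
  interpret product_prob_space "\<lambda>_::nat. std_normal_distribution" "{..<d}" by unfold_locales
  interpret fin: finite_product_prob_space "\<lambda>_::nat. std_normal_distribution" "{..<d}"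
    by unfold_locales simp
  have "char (distr (std_gaussian d) borel (\<lambda>z. \<Sum>i<d. a i * linear_image d A z i)) t
      = (\<integral>z. iexp (t * (\<Sum>k<d. c k * z k)) \<partial>std_gaussian d)"
    unfolding char_def lin by (subst integral_distr) (auto simp: std_gaussian_def)
  also have "\<dots> = (\<integral>z. (\<Prod>k<d. iexp (t * c k * z k)) \<partial>std_gaussian d)"
    by (simp add: exp_sum[symmetric] sum_distrib_left mult_ac)
  also have "\<dots> = (\<Prod>k<d. \<integral>y. iexp (t * c k * y) \<partial>std_normal_distribution)"
    unfolding std_gaussian_def
    by (rule product_integral_prod) (auto intro!: N.integrable_const_bound[where B=1])
  also have "\<dots> = (\<Prod>k<d. complex_of_real (exp (- ((t * c k)\<^sup>2) / 2)))"
    by (intro prod.cong refl)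
      (use char_std_normal_distribution in \<open>simp only: char_def fun_eq_iff\<close>)
  also have "\<dots> = complex_of_real (exp (\<Sum>k<d. - ((t * c k)\<^sup>2) / 2))"
    by (simp add: exp_sum)
  also have "(\<Sum>k<d. - ((t * c k)\<^sup>2) / 2) = - (t\<^sup>2 * (\<Sum>k<d. (c k)\<^sup>2)) / 2"
    by (simp add: power_mult_distrib sum_distrib_left sum_negf sum_divide_distrib)
  finally show ?thesis unfolding S by simp
qed

end

theory Submission
  imports Defs
begin

text \<open>
  Let \<open>x\<close> be an eigenvector for the least eigenvalue \<open>\<lambda>\<close>, and let
  \<open>X v = (\<Sum>f\<in>Aut. z f * x (f v))\<close> with independent standard Gaussian coefficients \<open>z f\<close>. The
  vertices at which \<open>X\<close> exceeds all its neighbours form an independent set, so \<open>\<alpha> / card V\<close> is at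
  least the probability that the normalized differences \<open>Y\<^sub>i = X v - X u\<^sub>i\<close> along the edges at a vertex
  \<open>v\<close> are all positive. By arc-transitivity all rows of the correlation matrix of \<open>Y\<close> have the same sum
  as those of \<open>\<Omega>\<^sub>\<lambda>\<close>, but its off-diagonal entries may differ, so one has to show that making them
  equal can only decrease the orthant probability.

  Since \<open>\<rho> \<ge> 0\<close>, one can write \<open>Y\<^sub>i = sqrt \<rho> G + sqrt (1 - \<rho>) \<xi>\<^sub>i\<close> with \<open>G\<close> independent of a Gaussian vector
  \<open>\<xi>\<close> with unit variances and row sums \<open>1\<close>. Conditioning on \<open>G\<close>, it suffices that
  \<open>E (\<Prod>i. f (\<xi>\<^sub>i)) \<ge> (E f (Z))\<^sup>d\<close> for increasing log-concave \<open>f\<close> and a standard normal \<open>Z\<close>. Rotating two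
  independent copies of \<open>\<xi>\<close> by 45 degrees replaces \<open>f\<close> by
  \<open>Tf y = E f ((y - Z) / sqrt 2) f ((y + Z) / sqrt 2)\<close>; the integrand is even and log-concave in \<open>Z\<close>, so
  Sidak's inequality gives \<open>(E (\<Prod>i. f (\<xi>\<^sub>i)))\<^sup>2 \<ge> E (\<Prod>i. Tf (\<xi>\<^sub>i))\<close>, whereas
  \<open>E Tf (Z) = (E f (Z))\<^sup>2\<close>. After \<open>k\<close> steps, with \<open>N = 2 ^ k\<close>, the weight \<open>T\<^sup>k f\<close> concentrates around
  \<open>m sqrt N\<close> with bounded variance. Because the row sums are \<open>1\<close>, moving \<open>\<xi>\<close> to \<open>m sqrt N\<close> in all
  coordinates costs as much as for independent coordinates up to a factor \<open>exp (O (sqrt N))\<close>, which is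
  negligible after taking \<open>N\<close>-th roots.
\<close>

section \<open>Uniqueness of the joint law from characteristic functions\<close>

text \<open>Divided by their common total mass, which is the hypothesis at \<open>s = 0\<close>, the
  weights become probability densities, and Levy's uniqueness theorem compares the resulting laws of
  \<open>X\<close> and \<open>Y\<close>. The weights make it possible to recover a joint law one
  coordinate at a time.\<close>

lemma weighted_char_unique:
  fixes X :: "'b \<Rightarrow> real" and Y :: "'c \<Rightarrow> real"
  assumes M: "prob_space M" and N: "prob_space N"
    and [measurable]: "X \<in> borel_measurable M" "Y \<in> borel_measurable N"
      "w \<in> borel_measurable M" "w' \<in> borel_measurable N"
    and w: "\<And>x. 0 \<le> w x" "\<And>x. w x \<le> B" and w': "\<And>x. 0 \<le> w' x" "\<And>x. w' x \<le> B"
    and char: "\<And>s. (\<integral>x. complex_of_real (w x) * iexp (s * X x) \<partial>M) =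
      (\<integral>x. complex_of_real (w' x) * iexp (s * Y x) \<partial>N)"
    and A [measurable]: "A \<in> sets borel"
  shows "(\<integral>x. w x * indicator A (X x) \<partial>M) = (\<integral>x. w' x * indicator A (Y x) \<partial>N)"
proof -
  interpret M: prob_space M by fact
  interpret N: prob_space N by fact
  have iw: "integrable M w" by (rule M.integrable_const_bound[where B=B]) (use w in auto)
  have iw': "integrable N w'" by (rule N.integrable_const_bound[where B=B]) (use w' in auto)
  define m where "m = (\<integral>x. w x \<partial>M)"
  have m': "m = (\<integral>x. w' x \<partial>N)"
    using char[of 0] by (simp add: m_def)
  show ?thesis
  proof (cases "m = 0")
    case True
    have "AE x in M. w x = 0"
      using integral_nonneg_eq_0_iff_AE[OF iw] w True by (simp add: m_def)
    then have 1: "(\<integral>x. w x * indicator A (X x) \<partial>M) = (\<integral>x. 0 \<partial>M)"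
      by (intro integral_cong_AE) auto
    have "AE x in N. w' x = 0"
      using integral_nonneg_eq_0_iff_AE[OF iw'] w' True m' by simp
    then have 2: "(\<integral>x. w' x * indicator A (Y x) \<partial>N) = (\<integral>x. 0 \<partial>N)"
      by (intro integral_cong_AE) auto
    show ?thesis unfolding 1 2 by simp
  next
    case False
    have m: "m > 0"
      using False integral_nonneg_AE[of w M] w by (simp add: m_def less_le)
    define P where "P = distr (density M (\<lambda>x. ennreal (w x / m))) borel X"
    define Q where "Q = distr (density N (\<lambda>x. ennreal (w' x / m))) borel Y"
    have "(\<integral>\<^sup>+x. ennreal (w x / m) \<partial>M) = ennreal (\<integral>x. w x / m \<partial>M)"
      by (rule nn_integral_eq_integral) (use iw w m in auto)
    then have "prob_space (density M (\<lambda>x. ennreal (w x / m)))"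
      by (intro prob_spaceI) (use m in \<open>simp add: emeasure_density m_def[symmetric] cong: nn_integral_cong\<close>)
    then have P: "real_distribution P"
      unfolding P_def by (auto simp: real_distribution_def real_distribution_axioms_def intro!: prob_space.prob_space_distr)
    have "(\<integral>\<^sup>+x. ennreal (w' x / m) \<partial>N) = ennreal (\<integral>x. w' x / m \<partial>N)"
      by (rule nn_integral_eq_integral) (use iw' w' m in auto)
    then have "prob_space (density N (\<lambda>x. ennreal (w' x / m)))"
      by (intro prob_spaceI) (use m in \<open>simp add: emeasure_density m'[symmetric] cong: nn_integral_cong\<close>)
    then have Q: "real_distribution Q"
      unfolding Q_def by (auto simp: real_distribution_def real_distribution_axioms_def intro!: prob_space.prob_space_distr)
    have "char P s = char Q s" for s
    proof -
      have "char P s = (\<integral>x. (w x / m) *\<^sub>R iexp (s * X x) \<partial>M)"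
        unfolding char_def P_def using w m by (simp add: integral_distr integral_density)
      also have "\<dots> = (\<integral>x. complex_of_real (w x) * iexp (s * X x) \<partial>M) / m"
        by (simp add: scaleR_conv_of_real)
      also have "\<dots> = (\<integral>x. (w' x / m) *\<^sub>R iexp (s * Y x) \<partial>N)"
        unfolding char by (simp add: scaleR_conv_of_real)
      also have "\<dots> = char Q s"
        unfolding char_def Q_def using w' m by (simp add: integral_distr integral_density)
      finally show ?thesis .
    qed
    then have "P = Q" using Levy_uniqueness[OF P Q] by blast
    then have "(\<integral>x. (indicator A x :: real) \<partial>P) = (\<integral>x. indicator A x \<partial>Q)" by simp
    then show ?thesis
      unfolding P_def Q_def using w w' m
      by (simp add: integral_distr integral_density del: Bochner_Integration.integral_indicator)
  qed
qed

text \<open>Euler's formula splits the cosine, leaving \<open>a\<close> with the frequencies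
  \<open>0\<close>, \<open>1\<close> and \<open>-1\<close> only, which are values of
  \<open>r\<close> in the assumption \<open>char\<close> of \<open>joint_char_step\<close>.\<close>

lemma iexp_cos: "complex_of_real (p * (1 + cos (a + c))) * iexp b =
   complex_of_real p * iexp (0 * a + b) + iexp c / 2 * (complex_of_real p * iexp (1 * a + b))
     + iexp (-c) / 2 * (complex_of_real p * iexp ((-1) * a + b))"
proof -
  have c: "complex_of_real (cos (a + c)) = (iexp c * iexp a + iexp (-c) * iexp (-a)) / 2"
    by (simp add: cos_exp_eq cos_of_real[symmetric] exp_add[symmetric] algebra_simps)
  have e: "iexp (0 * a + b) = iexp b" "iexp (1 * a + b) = iexp a * iexp b" "iexp ((-1) * a + b) = iexp (-a) * iexp b"
    by (simp_all add: exp_add[symmetric] algebra_simps)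
  have "complex_of_real (p * (1 + cos (a + c))) = complex_of_real p * (1 + (iexp c * iexp a + iexp (-c) * iexp (-a)) / 2)"
    by (simp only: of_real_mult of_real_add of_real_1 c)
  then show ?thesis unfolding e by (simp only:) (simp add: algebra_simps del: of_real_minus)
qed

text \<open>Levy's theorem needs positive measures; \<open>1 + cos (T + c)\<close> is a nonnegative weight from whose
  integrals those of \<open>iexp T\<close> are recovered.\<close>

lemma joint_char_step:
  fixes X T p :: "'b \<Rightarrow> real" and Y S q :: "'c \<Rightarrow> real"
  assumes M: "prob_space M" and N: "prob_space N"
    and [measurable]: "X \<in> borel_measurable M" "Y \<in> borel_measurable N"
      "T \<in> borel_measurable M" "S \<in> borel_measurable N"
      "p \<in> borel_measurable M" "q \<in> borel_measurable N"
    and p: "\<And>x. 0 \<le> p x" "\<And>x. p x \<le> 1" and q: "\<And>x. 0 \<le> q x" "\<And>x. q x \<le> 1"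
    and char: "\<And>r s. (\<integral>x. complex_of_real (p x) * iexp (r * T x + s * X x) \<partial>M) =
      (\<integral>x. complex_of_real (q x) * iexp (r * S x + s * Y x) \<partial>N)"
    and A [measurable]: "A \<in> sets borel"
  shows "(\<integral>x. complex_of_real (p x * indicator A (X x)) * iexp (T x) \<partial>M) =
    (\<integral>x. complex_of_real (q x * indicator A (Y x)) * iexp (S x) \<partial>N)"
proof -
  interpret M: prob_space M by fact
  interpret N: prob_space N by fact
  have iM: "integrable M (\<lambda>x. complex_of_real (p x) * iexp (r * T x + s * X x))" for r s
    by (rule M.integrable_const_bound[where B=1]) (use p in \<open>auto simp: norm_mult\<close>)
  have iN: "integrable N (\<lambda>x. complex_of_real (q x) * iexp (r * S x + s * Y x))" for r s
    by (rule N.integrable_const_bound[where B=1]) (use q in \<open>auto simp: norm_mult\<close>)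
  have bd: "0 \<le> 1 + cos y" "1 + cos y \<le> 2" for y :: real
    using cos_ge_minus_one[of y] cos_le_one[of y] by linarith+
  have cosc: "(\<integral>x. (p x * (1 + cos (T x + c))) * indicator A (X x) \<partial>M)
     = (\<integral>x. (q x * (1 + cos (S x + c))) * indicator A (Y x) \<partial>N)" for c
  proof (rule weighted_char_unique[OF M N, where B=2])
    fix s
    show "(\<integral>x. complex_of_real (p x * (1 + cos (T x + c))) * iexp (s * X x) \<partial>M) =
      (\<integral>x. complex_of_real (q x * (1 + cos (S x + c))) * iexp (s * Y x) \<partial>N)"
      unfolding iexp_cos
      by (simp only: Bochner_Integration.integral_add Bochner_Integration.integrable_add
        integrable_mult_right iM iN integral_mult_right_zero char)
    show "p x * (1 + cos (T x + c)) \<le> 2" "q y * (1 + cos (S y + c)) \<le> 2" for x y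
      using mult_mono[OF p(2)[of x] bd(2) _ bd(1)] mult_mono[OF q(2)[of y] bd(2) _ bd(1)] by auto
    show "0 \<le> p x * (1 + cos (T x + c))" "0 \<le> q y * (1 + cos (S y + c))" for x y
      using p(1) q(1) bd(1) by (auto intro: mult_nonneg_nonneg)
  qed auto
  have one: "(\<integral>x. p x * indicator A (X x) \<partial>M) = (\<integral>x. q x * indicator A (Y x) \<partial>N)"
    by (rule weighted_char_unique[OF M N, where B=1]) (use p q char[of 0] in auto)
  have i1: "integrable M (\<lambda>x. p x * indicator A (X x))"
    by (rule M.integrable_const_bound[where B=1]) (use p in \<open>auto simp: indicator_def\<close>)
  have i1': "integrable N (\<lambda>x. q x * indicator A (Y x))"
    by (rule N.integrable_const_bound[where B=1]) (use q in \<open>auto simp: indicator_def\<close>)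
  have i2: "integrable M (\<lambda>x. p x * indicator A (X x) * cos (T x + c))" for c
    by (rule M.integrable_const_bound[where B=1])
      (use p in \<open>auto simp: indicator_def abs_mult mult_le_one\<close>)
  have i2': "integrable N (\<lambda>x. q x * indicator A (Y x) * cos (S x + c))" for c
    by (rule N.integrable_const_bound[where B=1])
      (use q in \<open>auto simp: indicator_def abs_mult mult_le_one\<close>)
  have co: "(\<integral>x. p x * indicator A (X x) * cos (T x + c) \<partial>M) = (\<integral>x. q x * indicator A (Y x) * cos (S x + c) \<partial>N)" for c
  proof -
    have "(\<integral>x. p x * indicator A (X x) + p x * indicator A (X x) * cos (T x + c) \<partial>M)
      = (\<integral>x. q x * indicator A (Y x) + q x * indicator A (Y x) * cos (S x + c) \<partial>N)"
      using cosc[of c] by (simp add: algebra_simps)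
    then show ?thesis using one by (simp add: i1 i2 i1' i2')
  qed
  \<comment> \<open>The shift \<open>- (pi/2)\<close> turns the cosine into a sine, so
    \<open>co\<close> at the shifts \<open>0\<close> and \<open>- (pi/2)\<close> yields the real and
    imaginary parts.\<close>
  have E: "complex_of_real a * iexp b = complex_of_real (a * cos (b + 0)) + \<i> * complex_of_real (a * cos (b + - (pi/2)))" for a b
    by (simp only: cis_conv_exp[symmetric]) (simp add: complex_eq_iff cos_diff)
  show ?thesis unfolding E
    by (simp only: Bochner_Integration.integral_add integrable_of_real integrable_mult_right
        integral_mult_right_zero integral_complex_of_real i2 i2' co)
qed

text \<open>Induction moves coordinates one at a time from the exponential into an indicator. When
  all have been moved, the two laws agree on boxes, which determine a measure on a finite
  product.\<close>

lemma joint_char_unique: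
  fixes X :: "'i \<Rightarrow> 'b \<Rightarrow> real" and Y :: "'i \<Rightarrow> 'c \<Rightarrow> real"
  assumes M: "prob_space M" and N: "prob_space N" and I: "finite I"
    and X [measurable]: "\<And>i. i \<in> I \<Longrightarrow> X i \<in> borel_measurable M"
    and Y [measurable]: "\<And>i. i \<in> I \<Longrightarrow> Y i \<in> borel_measurable N"
    and char: "\<And>t. (\<integral>x. iexp (\<Sum>i\<in>I. t i * X i x) \<partial>M) = (\<integral>x. iexp (\<Sum>i\<in>I. t i * Y i x) \<partial>N)"
  shows "distr M (\<Pi>\<^sub>M i\<in>I. borel) (\<lambda>x. \<lambda>i\<in>I. X i x) = distr N (\<Pi>\<^sub>M i\<in>I. borel) (\<lambda>x. \<lambda>i\<in>I. Y i x)"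
proof -
  interpret M: prob_space M by fact
  interpret N: prob_space N by fact
  \<comment> \<open>\<open>J\<close> holds the coordinates already tested against Borel sets; the
    frequencies \<open>t\<close> of the others stay arbitrary for the induction.\<close>
  have main: "(\<integral>x. complex_of_real (\<Prod>j\<in>J. indicator (B j) (X j x)) * iexp (\<Sum>i\<in>I - J. t i * X i x) \<partial>M)
      = (\<integral>x. complex_of_real (\<Prod>j\<in>J. indicator (B j) (Y j x)) * iexp (\<Sum>i\<in>I - J. t i * Y i x) \<partial>N)"
    if "J \<subseteq> I" and "\<And>j. j \<in> J \<Longrightarrow> B j \<in> sets borel" for J B t
    using finite_subset[OF that(1) I] that
  proof (induction J arbitrary: t rule: finite_induct)
    case empty
    show ?case using char by simp
  next
    case (insert k J)
    have k: "k \<in> I" "k \<notin> J" and J: "J \<subseteq> I" using insert by auto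
    have [measurable]: "B k \<in> sets borel" "\<And>j. j \<in> J \<Longrightarrow> B j \<in> sets borel" using insert by auto
    have [measurable]: "\<And>j. j \<in> J \<Longrightarrow> X j \<in> borel_measurable M" "\<And>j. j \<in> J \<Longrightarrow> Y j \<in> borel_measurable N"
      "X k \<in> borel_measurable M" "Y k \<in> borel_measurable N" using J k by auto
    have split: "(\<Sum>i\<in>I - J. u i * Z i) = u k * Z k + (\<Sum>i\<in>I - insert k J. u i * Z i)" for u Z :: "'i \<Rightarrow> real"
    proof -
      have *: "I - J = insert k (I - insert k J)" using k by auto
      have "finite (I - insert k J)" "k \<notin> I - insert k J" using I by auto
      then show ?thesis unfolding * by (rule sum.insert)
    qed
    have "(\<integral>x. complex_of_real ((\<Prod>j\<in>J. indicator (B j) (X j x)) * indicator (B k) (X k x)) * iexp (\<Sum>i\<in>I - insert k J. t i * X i x) \<partial>M)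
      = (\<integral>x. complex_of_real ((\<Prod>j\<in>J. indicator (B j) (Y j x)) * indicator (B k) (Y k x)) * iexp (\<Sum>i\<in>I - insert k J. t i * Y i x) \<partial>N)"
    proof (rule joint_char_step[OF M N])
      fix r s :: real
      \<comment> \<open>The induction hypothesis at these frequencies is the joint characteristic
        function of coordinate \<open>k\<close> and the remaining linear form.\<close>
      define u where "u = (\<lambda>i. r * t i)(k := s)"
      have S: "(\<Sum>i\<in>I - J. u i * Z i) = r * (\<Sum>i\<in>I - insert k J. t i * Z i) + s * Z k" for Z :: "'i \<Rightarrow> real"
        unfolding split by (simp add: u_def sum_distrib_left mult_ac)
      show "(\<integral>x. complex_of_real (\<Prod>j\<in>J. indicator (B j) (X j x)) * iexp (r * (\<Sum>i\<in>I - insert k J. t i * X i x) + s * X k x) \<partial>M)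
       = (\<integral>x. complex_of_real (\<Prod>j\<in>J. indicator (B j) (Y j x)) * iexp (r * (\<Sum>i\<in>I - insert k J. t i * Y i x) + s * Y k x) \<partial>N)"
        using insert.IH[of u] insert.prems unfolding S by auto
    qed (auto intro!: prod_nonneg prod_le_1 simp: indicator_def)
    then show ?case using insert.hyps by (simp add: mult.commute)
  qed
  have box: "(\<integral>x. (\<Prod>j\<in>I. indicator (B j) (X j x)) \<partial>M) = (\<integral>x. (\<Prod>j\<in>I. indicator (B j) (Y j x)) \<partial>N :: real)"
    if "\<And>j. j \<in> I \<Longrightarrow> B j \<in> sets borel" for B
    using main[of I B "\<lambda>_. 0"] that
    by (simp del: of_real_prod)
  have mX: "(\<lambda>x. \<lambda>i\<in>I. X i x) \<in> M \<rightarrow>\<^sub>M (\<Pi>\<^sub>M i\<in>I. borel)" by (rule measurable_restrict) auto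
  have mY: "(\<lambda>x. \<lambda>i\<in>I. Y i x) \<in> N \<rightarrow>\<^sub>M (\<Pi>\<^sub>M i\<in>I. borel)" by (rule measurable_restrict) auto
  interpret PX: prob_space "distr M (\<Pi>\<^sub>M i\<in>I. borel) (\<lambda>x. \<lambda>i\<in>I. X i x)" by (rule M.prob_space_distr[OF mX])
  interpret PY: prob_space "distr N (\<Pi>\<^sub>M i\<in>I. borel) (\<lambda>x. \<lambda>i\<in>I. Y i x)" by (rule N.prob_space_distr[OF mY])
  have em: "emeasure (distr L (\<Pi>\<^sub>M i\<in>I. borel) (\<lambda>x. \<lambda>i\<in>I. Z i x)) (Pi\<^sub>E I B)
      = ennreal (\<integral>x. (\<Prod>j\<in>I. indicator (B j) (Z j x)) \<partial>L)"
    if L: "prob_space L" and Z: "\<And>i. i \<in> I \<Longrightarrow> Z i \<in> borel_measurable L" 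
      and B: "\<And>j. j \<in> I \<Longrightarrow> B j \<in> sets borel" for L :: "'d measure" and Z and B :: "'i \<Rightarrow> real set"
  proof -
    interpret L: prob_space L by fact
    have m: "(\<lambda>x. \<lambda>i\<in>I. Z i x) \<in> L \<rightarrow>\<^sub>M (\<Pi>\<^sub>M i\<in>I. borel)" by (rule measurable_restrict) (use Z in auto)
    have PB: "Pi\<^sub>E I B \<in> sets (\<Pi>\<^sub>M i\<in>I. borel)" by (rule sets_PiM_I_finite) (use I B in auto)
    have "(\<integral>x. (\<Prod>j\<in>I. indicator (B j) (Z j x)) \<partial>L) = (\<integral>x. indicator ((\<lambda>x. \<lambda>i\<in>I. Z i x) -` Pi\<^sub>E I B \<inter> space L) x \<partial>L :: real)"
    proof (rule Bochner_Integration.integral_cong[OF refl])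
      fix x assume "x \<in> space L"
      then show "(\<Prod>j\<in>I. indicator (B j) (Z j x)) = (indicator ((\<lambda>x. \<lambda>i\<in>I. Z i x) -` Pi\<^sub>E I B \<inter> space L) x :: real)"
        using I by (auto simp: indicator_def PiE_iff)
    qed
    then show ?thesis using m PB
      by (simp add: emeasure_distr L.emeasure_eq_measure measurable_sets)
  qed
  show ?thesis
  proof (rule measure_eqI_PiM_finite[OF I])
    show "range (\<lambda>_::nat. \<Pi>\<^sub>E i\<in>I. UNIV) \<subseteq> prod_algebra I (\<lambda>_. borel :: real measure)"
      using I by (auto intro!: prod_algebraI_finite)
    show "(\<Union>i::nat. \<Pi>\<^sub>E i\<in>I. UNIV) = space (\<Pi>\<^sub>M i\<in>I. borel :: real measure)"
      by (simp add: space_PiM)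
    show "emeasure (distr M (\<Pi>\<^sub>M i\<in>I. borel) (\<lambda>x. \<lambda>i\<in>I. X i x)) (Pi\<^sub>E I B)
      = emeasure (distr N (\<Pi>\<^sub>M i\<in>I. borel) (\<lambda>x. \<lambda>i\<in>I. Y i x)) (Pi\<^sub>E I B)"
      if "\<And>i. i \<in> I \<Longrightarrow> B i \<in> sets borel" for B
      using em[OF M X that] em[OF N Y that] box[OF that] by simp
  qed simp_all
qed

section \<open>Jointly Gaussian families\<close>

abbreviation gauss :: "real measure" where "gauss \<equiv> std_normal_distribution"

abbreviation gauss_vec :: "'k set \<Rightarrow> ('k \<Rightarrow> real) measure" where
  "gauss_vec K \<equiv> \<Pi>\<^sub>M k\<in>K. gauss"

text \<open>Centered Gaussian families are described by the characteristic functions of their linear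
  combinations, so that \<open>C\<close> may be singular and the underlying space \<open>M\<close>
  is left free.\<close>

definition jointly_gaussian ::
  "'b measure \<Rightarrow> 'i set \<Rightarrow> ('i \<Rightarrow> 'b \<Rightarrow> real) \<Rightarrow> ('i \<Rightarrow> 'i \<Rightarrow> real) \<Rightarrow> bool" where
  "jointly_gaussian M I X C \<longleftrightarrow> prob_space M \<and> finite I \<and> (\<forall>i\<in>I. X i \<in> borel_measurable M) \<and>
     (\<forall>t. (\<integral>x. iexp (\<Sum>i\<in>I. t i * X i x) \<partial>M) =
       complex_of_real (exp (- (\<Sum>i\<in>I. \<Sum>j\<in>I. t i * t j * C i j) / 2)))"

lemma prob_space_gauss: "prob_space gauss"
  by (rule real_distribution.axioms(1)[OF real_dist_normal_dist])

lemma prob_space_gauss_vec: "prob_space (gauss_vec K)"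
  by (rule prob_space_PiM) (rule prob_space_gauss)

lemma jointly_gaussian_cong:
  assumes "jointly_gaussian M I X C" and CD: "\<And>i j. i \<in> I \<Longrightarrow> j \<in> I \<Longrightarrow> C i j = D i j"
  shows "jointly_gaussian M I X D"
proof -
  have "(\<Sum>i\<in>I. \<Sum>j\<in>I. t i * t j * C i j) = (\<Sum>i\<in>I. \<Sum>j\<in>I. t i * t j * D i j)" for t
    using CD by (intro sum.cong) auto
  then show ?thesis using assms(1) by (simp add: jointly_gaussian_def)
qed

lemma jointly_gaussian_law:
  assumes X: "jointly_gaussian M I X C" and Y: "jointly_gaussian N I Y D"
    and CD: "\<And>i j. i \<in> I \<Longrightarrow> j \<in> I \<Longrightarrow> C i j = D i j"
  shows "distr M (\<Pi>\<^sub>M i\<in>I. borel) (\<lambda>x. \<lambda>i\<in>I. X i x) = distr N (\<Pi>\<^sub>M i\<in>I. borel) (\<lambda>x. \<lambda>i\<in>I. Y i x)"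
proof (rule joint_char_unique)
  show "(\<integral>x. iexp (\<Sum>i\<in>I. t i * X i x) \<partial>M) = (\<integral>x. iexp (\<Sum>i\<in>I. t i * Y i x) \<partial>N)" for t
  proof -
    have "(\<Sum>i\<in>I. \<Sum>j\<in>I. t i * t j * C i j) = (\<Sum>i\<in>I. \<Sum>j\<in>I. t i * t j * D i j)"
      using CD by (intro sum.cong) auto
    then show ?thesis using X Y by (simp add: jointly_gaussian_def)
  qed
qed (use X Y in \<open>auto simp: jointly_gaussian_def\<close>)

lemma jointly_gaussian_expectation:
  fixes g :: "('i \<Rightarrow> real) \<Rightarrow> real"
  assumes X: "jointly_gaussian M I X C" and Y: "jointly_gaussian N I Y D"
    and CD: "\<And>i j. i \<in> I \<Longrightarrow> j \<in> I \<Longrightarrow> C i j = D i j"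
    and g: "g \<in> borel_measurable (\<Pi>\<^sub>M i\<in>I. borel)"
  shows "(\<integral>x. g (\<lambda>i\<in>I. X i x) \<partial>M) = (\<integral>x. g (\<lambda>i\<in>I. Y i x) \<partial>N)"
proof -
  have "(\<lambda>x. \<lambda>i\<in>I. X i x) \<in> M \<rightarrow>\<^sub>M (\<Pi>\<^sub>M i\<in>I. borel)"
    by (rule measurable_restrict) (use X in \<open>auto simp: jointly_gaussian_def\<close>)
  then have 1: "(\<integral>x. g (\<lambda>i\<in>I. X i x) \<partial>M) = (\<integral>z. g z \<partial>distr M (\<Pi>\<^sub>M i\<in>I. borel) (\<lambda>x. \<lambda>i\<in>I. X i x))"
    by (subst integral_distr) (use g in auto)
  have "(\<lambda>x. \<lambda>i\<in>I. Y i x) \<in> N \<rightarrow>\<^sub>M (\<Pi>\<^sub>M i\<in>I. borel)"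
    by (rule measurable_restrict) (use Y in \<open>auto simp: jointly_gaussian_def\<close>)
  then have 2: "(\<integral>x. g (\<lambda>i\<in>I. Y i x) \<partial>N) = (\<integral>z. g z \<partial>distr N (\<Pi>\<^sub>M i\<in>I. borel) (\<lambda>x. \<lambda>i\<in>I. Y i x))"
    by (subst integral_distr) (use g in auto)
  have "distr M (\<Pi>\<^sub>M i\<in>I. borel) (\<lambda>x. \<lambda>i\<in>I. X i x) = distr N (\<Pi>\<^sub>M i\<in>I. borel) (\<lambda>x. \<lambda>i\<in>I. Y i x)"
    by (rule jointly_gaussian_law[OF X Y]) (rule CD)
  then show ?thesis unfolding 1 2 by simp
qed

text \<open>Used to exchange one representation of a Gaussian vector for another, possibly on a
  different probability space, once the covariances agree.\<close>

lemma jointly_gaussian_prod: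
  fixes f :: "'i \<Rightarrow> real \<Rightarrow> real"
  assumes X: "jointly_gaussian M I X C" and Y: "jointly_gaussian N I Y D"
    and CD: "\<And>i j. i \<in> I \<Longrightarrow> j \<in> I \<Longrightarrow> C i j = D i j"
    and f [measurable]: "\<And>i. i \<in> I \<Longrightarrow> f i \<in> borel_measurable borel"
  shows "(\<integral>x. (\<Prod>i\<in>I. f i (X i x)) \<partial>M) = (\<integral>x. (\<Prod>i\<in>I. f i (Y i x)) \<partial>N)"
  using jointly_gaussian_expectation[OF X Y CD, where g="\<lambda>z. \<Prod>i\<in>I. f i (z i)"] by simp

lemma iexp_sum: "iexp (\<Sum>i\<in>I. f i) = (\<Prod>i\<in>I. iexp (f i))" if "finite I"
  using that by (simp add: exp_sum[symmetric] sum_distrib_left)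

lemma integral_iexp_gauss: "(\<integral>y. iexp (t * y) \<partial>gauss) = complex_of_real (exp (- (t\<^sup>2) / 2))"
  using char_std_normal_distribution by (simp only: char_def fun_eq_iff)

lemma jointly_gaussian_linear:
  fixes K :: "'k set"
  assumes K: "finite K" and I: "finite I"
  shows "jointly_gaussian (gauss_vec K) I (\<lambda>i z. \<Sum>k\<in>K. a i k * z k) (\<lambda>i j. \<Sum>k\<in>K. a i k * a j k)"
  unfolding jointly_gaussian_def
proof (intro conjI ballI allI)
  show "prob_space (gauss_vec K)" by (rule prob_space_gauss_vec)
  show "(\<lambda>z. \<Sum>k\<in>K. a i k * z k) \<in> borel_measurable (gauss_vec K)" for i by measurable
  fix t
  define c where "c k = (\<Sum>i\<in>I. t i * a i k)" for k
  have S: "(\<Sum>i\<in>I. \<Sum>j\<in>I. t i * t j * (\<Sum>k\<in>K. a i k * a j k)) = (\<Sum>k\<in>K. (c k)\<^sup>2)"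
  proof -
    have "(\<Sum>k\<in>K. (c k)\<^sup>2) = (\<Sum>k\<in>K. \<Sum>i\<in>I. \<Sum>j\<in>I. t i * a i k * (t j * a j k))"
      unfolding c_def power2_eq_square sum_product ..
    also have "\<dots> = (\<Sum>i\<in>I. \<Sum>j\<in>I. \<Sum>k\<in>K. t i * a i k * (t j * a j k))"
      by (subst sum.swap, rule sum.cong[OF refl], rule sum.swap)
    finally show ?thesis by (simp add: sum_distrib_left mult_ac)
  qed
  have lin: "(\<Sum>i\<in>I. t i * (\<Sum>k\<in>K. a i k * z k)) = (\<Sum>k\<in>K. c k * z k)" for z :: "'k \<Rightarrow> real"
    unfolding c_def sum_distrib_left sum_distrib_right by (subst sum.swap) (simp add: mult_ac)
  interpret N: prob_space gauss by (rule prob_space_gauss)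
  interpret product_prob_space "\<lambda>_::'k. gauss" K by unfold_locales
  have "(\<integral>z. iexp (\<Sum>k\<in>K. c k * z k) \<partial>gauss_vec K) = (\<integral>z. (\<Prod>k\<in>K. iexp (c k * z k)) \<partial>gauss_vec K)"
    using K by (simp only: iexp_sum)
  also have "\<dots> = (\<Prod>k\<in>K. \<integral>y. iexp (c k * y) \<partial>gauss)"
    by (rule product_integral_prod) (use K in \<open>auto intro!: N.integrable_const_bound[where B=1]\<close>)
  also have "\<dots> = (\<Prod>k\<in>K. complex_of_real (exp (- ((c k)\<^sup>2) / 2)))"
    unfolding integral_iexp_gauss ..
  also have "\<dots> = complex_of_real (exp (\<Sum>k\<in>K. - ((c k)\<^sup>2) / 2))"
    using K by (simp add: exp_sum)
  also have "(\<Sum>k\<in>K. - ((c k)\<^sup>2) / 2) = - (\<Sum>k\<in>K. (c k)\<^sup>2) / 2"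
    by (simp add: sum_negf sum_divide_distrib)
  finally show "(\<integral>z. iexp (\<Sum>i\<in>I. t i * (\<Sum>k\<in>K. a i k * z k)) \<partial>gauss_vec K) =
    complex_of_real (exp (- (\<Sum>i\<in>I. \<Sum>j\<in>I. t i * t j * (\<Sum>k\<in>K. a i k * a j k)) / 2))"
    unfolding S lin .
qed (use I in auto)

lemma integral_pair_mult:
  fixes f :: "'b \<Rightarrow> 'd::{real_normed_field,banach,second_countable_topology}"
  assumes M: "prob_space M" and N: "prob_space N"
    and [measurable]: "f \<in> borel_measurable M" "h \<in> borel_measurable N"
    and f: "\<And>x. norm (f x) \<le> 1" and h: "\<And>y. norm (h y) \<le> 1"
  shows "(\<integral>z. f (fst z) * h (snd z) \<partial>(M \<Otimes>\<^sub>M N)) = (\<integral>x. f x \<partial>M) * (\<integral>y. h y \<partial>N)"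
proof -
  interpret M: prob_space M by fact
  interpret N: prob_space N by fact
  interpret pair_prob_space M N ..
  have "(\<integral>z. f (fst z) * h (snd z) \<partial>(M \<Otimes>\<^sub>M N)) = (\<integral>x. (\<integral>y. f x * h y \<partial>N) \<partial>M)"
    by (subst integral_fst'[symmetric])
      (use mult_le_one[OF f norm_ge_zero h] in \<open>auto intro!: integrable_const_bound[where B=1] simp: norm_mult\<close>)
  then show ?thesis by simp
qed

text \<open>A common independent Gaussian adds a rank-one term to the covariance. Read backwards,
  this is how a vector is conditioned on one Gaussian variable.\<close>

lemma jointly_gaussian_common:
  assumes Z: "jointly_gaussian M I Z D"
  shows "jointly_gaussian (gauss \<Otimes>\<^sub>M M) I (\<lambda>i z. \<alpha> i * fst z + Z i (snd z)) (\<lambda>i j. \<alpha> i * \<alpha> j + D i j)"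
  unfolding jointly_gaussian_def
proof (intro conjI ballI allI)
  have I: "finite I" and M: "prob_space M" and [measurable]: "\<And>i. i \<in> I \<Longrightarrow> Z i \<in> borel_measurable M"
    using Z by (auto simp: jointly_gaussian_def)
  show "finite I" by fact
  interpret M: prob_space M by fact
  interpret N: prob_space gauss by (rule prob_space_gauss)
  interpret pair_prob_space gauss M ..
  show "prob_space (gauss \<Otimes>\<^sub>M M)" by unfold_locales
  show "(\<lambda>z. \<alpha> i * fst z + Z i (snd z)) \<in> borel_measurable (gauss \<Otimes>\<^sub>M M)" if [simp]: "i \<in> I" for i
    by measurable
  fix t
  define s where "s = (\<Sum>i\<in>I. t i * \<alpha> i)"
  have "(\<integral>z. iexp (\<Sum>i\<in>I. t i * (\<alpha> i * fst z + Z i (snd z))) \<partial>(gauss \<Otimes>\<^sub>M M))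
     = (\<integral>z. iexp (s * fst z) * iexp (\<Sum>i\<in>I. t i * Z i (snd z)) \<partial>(gauss \<Otimes>\<^sub>M M))"
    by (simp add: exp_add[symmetric] s_def sum.distrib sum_distrib_left sum_distrib_right algebra_simps)
  also have "\<dots> = (\<integral>y. iexp (s * y) \<partial>gauss) * (\<integral>x. iexp (\<Sum>i\<in>I. t i * Z i x) \<partial>M)"
    by (rule integral_pair_mult[OF prob_space_gauss M]) auto
  also have "\<dots> = complex_of_real (exp (- (s\<^sup>2) / 2) * exp (- (\<Sum>i\<in>I. \<Sum>j\<in>I. t i * t j * D i j) / 2))"
    using Z unfolding integral_iexp_gauss by (simp add: jointly_gaussian_def)
  also have "exp (- (s\<^sup>2) / 2) * exp (- (\<Sum>i\<in>I. \<Sum>j\<in>I. t i * t j * D i j) / 2)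
      = exp (- (\<Sum>i\<in>I. \<Sum>j\<in>I. t i * t j * (\<alpha> i * \<alpha> j + D i j)) / 2)"
  proof -
    have "s\<^sup>2 = (\<Sum>i\<in>I. \<Sum>j\<in>I. t i * t j * (\<alpha> i * \<alpha> j))"
      unfolding s_def power2_eq_square sum_product by (simp add: mult_ac)
    then show ?thesis by (simp add: exp_add[symmetric] sum.distrib algebra_simps add_divide_distrib)
  qed
  finally show "(\<integral>z. iexp (\<Sum>i\<in>I. t i * (\<alpha> i * fst z + Z i (snd z))) \<partial>(gauss \<Otimes>\<^sub>M M)) =
    complex_of_real (exp (- (\<Sum>i\<in>I. \<Sum>j\<in>I. t i * t j * (\<alpha> i * \<alpha> j + D i j)) / 2))" .
qed

text \<open>Rotation invariance of two independent copies: the mixed covariances cancel and the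
  others carry the factor \<open>c\<^sup>2 + s\<^sup>2 = 1\<close>. The tags \<open>True\<close> and
  \<open>False\<close> name the two rotated copies.\<close>

lemma jointly_gaussian_two_copies:
  assumes X: "jointly_gaussian M I X C" and cs: "c\<^sup>2 + s\<^sup>2 = (1::real)"
  shows "jointly_gaussian (M \<Otimes>\<^sub>M M) (I \<times> UNIV)
    (\<lambda>(i, b) z. if b then c * X i (fst z) + s * X i (snd z) else c * X i (snd z) - s * X i (fst z))
    (\<lambda>(i, b) (j, b'). if b = b' then C i j else 0)"
  unfolding jointly_gaussian_def
proof (intro conjI ballI allI)
  have I: "finite I" and M: "prob_space M" and [measurable]: "\<And>i. i \<in> I \<Longrightarrow> X i \<in> borel_measurable M"
    using X by (auto simp: jointly_gaussian_def)
  interpret M: prob_space M by fact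
  interpret pair_prob_space M M ..
  show "prob_space (M \<Otimes>\<^sub>M M)" by unfold_locales
  show "finite (I \<times> (UNIV::bool set))" using I by simp
  show "(case i of (i, b) \<Rightarrow> \<lambda>z. if b then c * X i (fst z) + s * X i (snd z) else c * X i (snd z) - s * X i (fst z))
     \<in> borel_measurable (M \<Otimes>\<^sub>M M)" if "i \<in> I \<times> UNIV" for i
  proof -
    have [simp]: "fst i \<in> I" using that by auto
    show ?thesis unfolding case_prod_beta by measurable
  qed
  fix t :: "'b \<times> bool \<Rightarrow> real"
  define p where "p i = t (i, True)" for i
  define q where "q i = t (i, False)" for i
  have sum2: "(\<Sum>x\<in>I \<times> UNIV. g x) = (\<Sum>i\<in>I. g (i, True) + g (i, False))" for g :: "'b \<times> bool \<Rightarrow> real"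
    by (simp add: sum.cartesian_product[symmetric, of _ UNIV I, simplified] UNIV_bool add.commute
        sum.cartesian_product' )
  let ?Z = "\<lambda>(i, b) z. if b then c * X i (fst z) + s * X i (snd z) else c * X i (snd z) - s * X i (fst z)"
  have "(\<integral>z. iexp (\<Sum>x\<in>I \<times> UNIV. t x * ?Z x z) \<partial>(M \<Otimes>\<^sub>M M))
     = (\<integral>z. iexp (\<Sum>i\<in>I. (c * p i - s * q i) * X i (fst z)) * iexp (\<Sum>i\<in>I. (s * p i + c * q i) * X i (snd z)) \<partial>(M \<Otimes>\<^sub>M M))"
  proof -
    have "(\<Sum>x\<in>I \<times> UNIV. t x * ?Z x z)
      = (\<Sum>i\<in>I. (c * p i - s * q i) * X i (fst z)) + (\<Sum>i\<in>I. (s * p i + c * q i) * X i (snd z))" for z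
      unfolding sum2 sum.distrib[symmetric] p_def q_def by (rule sum.cong) (auto simp: algebra_simps)
    then show ?thesis by (simp add: exp_add[symmetric] distrib_left)
  qed
  also have "\<dots> = (\<integral>x. iexp (\<Sum>i\<in>I. (c * p i - s * q i) * X i x) \<partial>M) * (\<integral>x. iexp (\<Sum>i\<in>I. (s * p i + c * q i) * X i x) \<partial>M)"
    by (rule integral_pair_mult[OF M M]) auto
  also have "\<dots> = complex_of_real (exp (- (\<Sum>i\<in>I. \<Sum>j\<in>I. (c * p i - s * q i) * (c * p j - s * q j) * C i j) / 2)
     * exp (- (\<Sum>i\<in>I. \<Sum>j\<in>I. (s * p i + c * q i) * (s * p j + c * q j) * C i j) / 2))"
    using X unfolding jointly_gaussian_def by (simp only: of_real_mult)
  also have "\<dots> = complex_of_real (exp (- (\<Sum>i\<in>I. \<Sum>j\<in>I. (p i * p j + q i * q j) * C i j) / 2))"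
  proof -
    have "(c * p i - s * q i) * (c * p j - s * q j) * C i j + (s * p i + c * q i) * (s * p j + c * q j) * C i j
       = (c\<^sup>2 + s\<^sup>2) * (p i * p j + q i * q j) * C i j" for i j
      by (simp add: algebra_simps power2_eq_square)
    then have "(\<Sum>i\<in>I. \<Sum>j\<in>I. (c * p i - s * q i) * (c * p j - s * q j) * C i j)
       + (\<Sum>i\<in>I. \<Sum>j\<in>I. (s * p i + c * q i) * (s * p j + c * q j) * C i j)
       = (\<Sum>i\<in>I. \<Sum>j\<in>I. (p i * p j + q i * q j) * C i j)"
      unfolding sum.distrib[symmetric] cs by simp
    then have "- (\<Sum>i\<in>I. \<Sum>j\<in>I. (c * p i - s * q i) * (c * p j - s * q j) * C i j) / 2
       + - (\<Sum>i\<in>I. \<Sum>j\<in>I. (s * p i + c * q i) * (s * p j + c * q j) * C i j) / 2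
       = - (\<Sum>i\<in>I. \<Sum>j\<in>I. (p i * p j + q i * q j) * C i j) / 2" by linarith
    then show ?thesis by (simp only: exp_add[symmetric])
  qed
  also have "(\<Sum>i\<in>I. \<Sum>j\<in>I. (p i * p j + q i * q j) * C i j) =
    (\<Sum>x\<in>I \<times> UNIV. \<Sum>y\<in>I \<times> UNIV. t x * t y * (case x of (i, b) \<Rightarrow> \<lambda>(j, b'). if b = b' then C i j else 0) y)"
    unfolding sum2 by (simp add: p_def q_def sum.distrib algebra_simps)
  finally show "(\<integral>z. iexp (\<Sum>x\<in>I \<times> UNIV. t x * ?Z x z) \<partial>(M \<Otimes>\<^sub>M M)) =
    complex_of_real (exp (- (\<Sum>x\<in>I \<times> UNIV. \<Sum>y\<in>I \<times> UNIV. t x * t y * (case x of (i, b) \<Rightarrow> \<lambda>(j, b'). if b = b' then C i j else 0) y) / 2))" .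
qed

section \<open>The Prekopa-Leindler inequality on the line\<close>

lemma weighted_am_gm:
  fixes a b u :: real
  assumes "0 \<le> a" "0 \<le> b" "0 < u" "u < 1"
  shows "a powr (1 - u) * b powr u \<le> (1 - u) * a + u * b"
proof (cases "a = 0 \<or> b = 0")
  case True
  then show ?thesis using assms by auto
next
  case False
  then have ab: "a > 0" "b > 0" using assms by auto
  have "exp ((1 - u) *\<^sub>R ln a + u *\<^sub>R ln b) \<le> (1 - u) * exp (ln a) + u * exp (ln b)"
    by (rule convex_onD[OF exp_convex]) (use assms in auto)
  then show ?thesis using ab by (simp add: powr_def exp_add)
qed

text \<open>Brunn-Minkowski on the line: bounded convex sets are intervals, so their measures are at
  most the differences of their end points, and \<open>C\<close> contains the open interval between
  the weighted end points.\<close>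

lemma emeasure_weighted_sum_intervals:
  fixes A B C :: "real set"
  assumes A: "convex A" "bounded A" "A \<noteq> {}" and B: "convex B" "bounded B" "B \<noteq> {}"
    and m: "A \<in> sets borel" "B \<in> sets borel" "C \<in> sets borel" and u: "0 < u" "u < 1"
    and C: "\<And>x y. x \<in> A \<Longrightarrow> y \<in> B \<Longrightarrow> (1 - u) * x + u * y \<in> C"
  shows "ennreal (1 - u) * emeasure lborel A + ennreal u * emeasure lborel B \<le> emeasure lborel C"
proof -
  have bA: "bdd_above A" "bdd_below A" and bB: "bdd_above B" "bdd_below B"
    using A B by (auto simp: bounded_imp_bdd_above bounded_imp_bdd_below)
  have lA: "Inf A \<le> Sup A" and lB: "Inf B \<le> Sup B"
    using A B bA bB by (auto intro!: cInf_le_cSup)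
  let ?l = "(1 - u) * Inf A + u * Inf B" and ?r = "(1 - u) * Sup A + u * Sup B"
  have "emeasure lborel A \<le> emeasure lborel {Inf A .. Sup A}"
    using bA by (intro emeasure_mono) (auto intro: cInf_lower cSup_upper)
  then have eA: "emeasure lborel A \<le> ennreal (Sup A - Inf A)" using lA by simp
  have "emeasure lborel B \<le> emeasure lborel {Inf B .. Sup B}"
    using bB by (intro emeasure_mono) (auto intro: cInf_lower cSup_upper)
  then have eB: "emeasure lborel B \<le> ennreal (Sup B - Inf B)" using lB by simp
  have lr: "?l \<le> ?r" using u lA lB by (intro add_mono mult_left_mono) auto
  have "{?l <..< ?r} \<subseteq> C"
  proof
    fix z assume z: "z \<in> {?l <..< ?r}"
    \<comment> \<open>Points of \<open>A\<close> and \<open>B\<close> close to their lower ends, and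
      others close to their upper ends, give weighted sums on either side of \<open>z\<close>; by
      convexity the values between these are weighted sums as well.\<close>
    obtain a where a: "a \<in> A" "a < Inf A + (z - ?l)"
      using cInf_lessD[OF A(3), of "Inf A + (z - ?l)"] z by auto
    obtain b where b: "b \<in> B" "b < Inf B + (z - ?l)"
      using cInf_lessD[OF B(3), of "Inf B + (z - ?l)"] z by auto
    obtain a' where a': "a' \<in> A" "Sup A - (?r - z) < a'"
      using less_cSupD[OF A(3), of "Sup A - (?r - z)"] z by auto
    obtain b' where b': "b' \<in> B" "Sup B - (?r - z) < b'"
      using less_cSupD[OF B(3), of "Sup B - (?r - z)"] z by auto
    have "(1 - u) * a < (1 - u) * (Inf A + (z - ?l))" "u * b < u * (Inf B + (z - ?l))"
      using a b u by auto
    then have 1: "(1 - u) * a + u * b < z" by (simp add: algebra_simps)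
    have "(1 - u) * (Sup A - (?r - z)) < (1 - u) * a'" "u * (Sup B - (?r - z)) < u * b'"
      using a' b' u by auto
    then have 2: "z < (1 - u) * a' + u * b'" by (simp add: algebra_simps)
    define s1 s2 where "s1 = (1 - u) * a + u * b" and "s2 = (1 - u) * a' + u * b'"
    define v where "v = (z - s1) / (s2 - s1)"
    have s: "s1 < z" "z < s2" using 1 2 by (auto simp: s1_def s2_def)
    have v: "0 \<le> v" "v \<le> 1" using s by (auto simp: v_def)
    have "v * (s2 - s1) = z - s1" using s by (simp add: v_def)
    then have "z = (1 - v) * s1 + v * s2" by (simp add: algebra_simps)
    also have "\<dots> = (1 - u) * ((1 - v) * a + v * a') + u * ((1 - v) * b + v * b')"
      by (simp add: s1_def s2_def algebra_simps)
    also have "\<dots> \<in> C"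
      using A(1) B(1) a(1) a'(1) b(1) b'(1) v unfolding convex_alt by (intro C) auto
    finally show "z \<in> C" .
  qed
  then have "emeasure lborel {?l <..< ?r} \<le> emeasure lborel C"
    using m by (intro emeasure_mono) auto
  then have eC: "ennreal (?r - ?l) \<le> emeasure lborel C" using lr by simp
  have "ennreal (1 - u) * emeasure lborel A + ennreal u * emeasure lborel B
     \<le> ennreal (1 - u) * ennreal (Sup A - Inf A) + ennreal u * ennreal (Sup B - Inf B)"
    using eA eB by (intro add_mono mult_left_mono) auto
  also have "\<dots> = ennreal (?r - ?l)"
  proof -
    have "ennreal (1 - u) * ennreal p + ennreal u * ennreal q = ennreal ((1 - u) * p + u * q)" if "0 \<le> p" "0 \<le> q" for p q
      using u that by (simp add: ennreal_mult)
    from this[of "Sup A - Inf A" "Sup B - Inf B"] show ?thesis using lA lB by (simp add: algebra_simps)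
  qed
  finally show ?thesis using eC by simp
qed

text \<open>Fubini on the region below the graph. Cutting off at level \<open>1\<close> lets
  \<open>h\<close> exceed \<open>1\<close> in the next lemma.\<close>

lemma nn_integral_layer_cake:
  fixes f :: "real \<Rightarrow> real"
  assumes [measurable]: "f \<in> borel_measurable borel" and f: "\<And>x. 0 \<le> f x"
  shows "(\<integral>\<^sup>+t. emeasure lborel {x. t < f x} * indicator {0<..<1} t \<partial>lborel) = (\<integral>\<^sup>+x. ennreal (min 1 (f x)) \<partial>lborel)"
proof -
  have "(\<integral>\<^sup>+t. emeasure lborel {x. t < f x} * indicator {0<..<1} t \<partial>lborel)
      = (\<integral>\<^sup>+t. (\<integral>\<^sup>+x. indicator {(t, x). t < f x \<and> 0 < t \<and> t < 1} (t, x) \<partial>lborel) \<partial>lborel)"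
  proof (rule nn_integral_cong)
    fix t :: real
    have "(\<integral>\<^sup>+x. indicator {(t, x). t < f x \<and> 0 < t \<and> t < 1} (t, x) \<partial>lborel)
       = (\<integral>\<^sup>+x. indicator {x. t < f x} x * indicator {0<..<1} t \<partial>lborel)"
      by (rule nn_integral_cong) (auto simp: indicator_def)
    then show "emeasure lborel {x. t < f x} * indicator {0<..<1} t = (\<integral>\<^sup>+x. indicator {(t, x). t < f x \<and> 0 < t \<and> t < 1} (t, x) \<partial>lborel)"
      by (simp add: nn_integral_multc)
  qed
  also have "\<dots> = (\<integral>\<^sup>+x. (\<integral>\<^sup>+t. indicator {(t, x). t < f x \<and> 0 < t \<and> t < 1} (t, x) \<partial>lborel) \<partial>lborel)"
    by (rule lborel_pair.Fubini') measurable
  also have "\<dots> = (\<integral>\<^sup>+x. ennreal (min 1 (f x)) \<partial>lborel)"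
  proof (rule nn_integral_cong)
    fix x :: real
    have "(\<integral>\<^sup>+t. indicator {(t, x). t < f x \<and> 0 < t \<and> t < 1} (t, x) \<partial>lborel)
      = (\<integral>\<^sup>+t. indicator {0 <..< min 1 (f x)} t \<partial>lborel)"
      by (rule nn_integral_cong) (auto simp: indicator_def)
    then show "(\<integral>\<^sup>+t. indicator {(t, x). t < f x \<and> 0 < t \<and> t < 1} (t, x) \<partial>lborel) = ennreal (min 1 (f x))"
      using f[of x] by simp
  qed
  finally show ?thesis .
qed

text \<open>Every level between \<open>0\<close> and \<open>1\<close> is exceeded by both
  \<open>f\<close> and \<open>g\<close>, and the weighted sum of their superlevel sets lies in that
  of \<open>h\<close>. Brunn-Minkowski at each level is then integrated over the levels; it gives
  the arithmetic mean, which is stronger than the geometric one.\<close>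

lemma prekopa_leindler_normalized:
  fixes f g h :: "real \<Rightarrow> real"
  assumes [measurable]: "f \<in> borel_measurable borel" "g \<in> borel_measurable borel" "h \<in> borel_measurable borel"
    and f: "\<And>x. 0 \<le> f x" "\<And>x. f x \<le> 1" and g: "\<And>x. 0 \<le> g x" "\<And>x. g x \<le> 1" and h: "\<And>x. 0 \<le> h x"
    and cf: "\<And>t. 0 < t \<Longrightarrow> convex {x. t < f x} \<and> bounded {x. t < f x}"
    and cg: "\<And>t. 0 < t \<Longrightarrow> convex {x. t < g x} \<and> bounded {x. t < g x}"
    and sf: "\<And>t. t < 1 \<Longrightarrow> \<exists>x. t < f x" and sg: "\<And>t. t < 1 \<Longrightarrow> \<exists>x. t < g x"
    and u: "0 < u" "u < 1"
    and fgh: "\<And>x y. f x powr (1 - u) * g y powr u \<le> h ((1 - u) * x + u * y)"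
  shows "ennreal (1 - u) * (\<integral>\<^sup>+x. ennreal (f x) \<partial>lborel) + ennreal u * (\<integral>\<^sup>+x. ennreal (g x) \<partial>lborel) \<le> (\<integral>\<^sup>+x. ennreal (h x) \<partial>lborel)"
proof -
  have I: "(\<integral>\<^sup>+x. ennreal (k x) \<partial>lborel) = (\<integral>\<^sup>+t. emeasure lborel {x. t < k x} * indicator {0<..<1} t \<partial>lborel)"
    if "\<And>x. 0 \<le> k x" "\<And>x. k x \<le> 1" "k \<in> borel_measurable borel" for k :: "real \<Rightarrow> real"
    using that by (simp add: nn_integral_layer_cake min_absorb2)
  have [measurable]: "(\<lambda>t. emeasure lborel {x. t < k x}) \<in> borel_measurable borel" if [measurable]: "k \<in> borel_measurable borel" for k :: "real \<Rightarrow> real"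
  proof -
    have "(\<lambda>t. emeasure lborel (Pair t -` {z. fst z < k (snd z)})) \<in> borel_measurable lborel"
    proof (rule lborel.measurable_emeasure_Pair)
      have "{z \<in> space (lborel \<Otimes>\<^sub>M lborel). fst z < k (snd z)} \<in> sets (lborel \<Otimes>\<^sub>M lborel)"
        by measurable
      then show "{z. fst z < k (snd z)} \<in> sets (lborel \<Otimes>\<^sub>M lborel)"
        by (simp add: space_pair_measure)
    qed
    then show ?thesis by (simp add: vimage_def)
  qed
  have "ennreal (1 - u) * (\<integral>\<^sup>+x. ennreal (f x) \<partial>lborel) + ennreal u * (\<integral>\<^sup>+x. ennreal (g x) \<partial>lborel)
     = (\<integral>\<^sup>+t. (ennreal (1 - u) * emeasure lborel {x. t < f x} + ennreal u * emeasure lborel {x. t < g x}) * indicator {0<..<1} t \<partial>lborel)"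
    using f g by (simp add: I nn_integral_add nn_integral_cmult[symmetric] distrib_right mult.assoc)
  also have "\<dots> \<le> (\<integral>\<^sup>+t. emeasure lborel {x. t < h x} * indicator {0<..<1} t \<partial>lborel)"
  proof (rule nn_integral_mono)
    fix t :: real
    show "(ennreal (1 - u) * emeasure lborel {x. t < f x} + ennreal u * emeasure lborel {x. t < g x}) * indicator {0<..<1} t
      \<le> emeasure lborel {x. t < h x} * indicator {0<..<1} t"
    proof (cases "0 < t \<and> t < 1")
      case True
      have "ennreal (1 - u) * emeasure lborel {x. t < f x} + ennreal u * emeasure lborel {x. t < g x} \<le> emeasure lborel {x. t < h x}"
      proof (rule emeasure_weighted_sum_intervals)
        fix x y assume "x \<in> {x. t < f x}" "y \<in> {x. t < g x}"
        then have "t powr (1 - u) < f x powr (1 - u)" "t powr u < g y powr u"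
          using u True by (auto intro!: powr_less_mono2)
        then have "t powr (1 - u) * t powr u < f x powr (1 - u) * g y powr u"
          by (intro mult_strict_mono) auto
        then have "t < f x powr (1 - u) * g y powr u"
          using True by (simp add: powr_add[symmetric])
        then show "(1 - u) * x + u * y \<in> {x. t < h x}" using fgh[of x y] by auto
      qed (use cf[of t] cg[of t] sf[of t] sg[of t] u True in auto)
      then show ?thesis using True by (simp add: indicator_def)
    qed (auto simp: indicator_def)
  qed
  also have "\<dots> \<le> (\<integral>\<^sup>+x. ennreal (h x) \<partial>lborel)"
    using h by (auto simp: nn_integral_layer_cake intro!: nn_integral_mono ennreal_leI)
  finally show ?thesis .
qed

text \<open>Scaling \<open>f\<close> and \<open>g\<close> to supremum \<open>1\<close>, and
  \<open>h\<close> by the matching geometric mean \<open>c\<close>, reduces to the normalized case;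
  the inequality of arithmetic and geometric means follows, and \<open>c\<close> cancels.\<close>

lemma prekopa_leindler:
  fixes f g h :: "real \<Rightarrow> real"
  assumes [measurable]: "f \<in> borel_measurable borel" "g \<in> borel_measurable borel" "h \<in> borel_measurable borel"
    and f: "\<And>x. 0 \<le> f x" "\<And>x. f x \<le> 1" and g: "\<And>x. 0 \<le> g x" "\<And>x. g x \<le> 1" and h: "\<And>x. 0 \<le> h x"
    and cf: "\<And>t. 0 < t \<Longrightarrow> convex {x. t < f x} \<and> bounded {x. t < f x}"
    and cg: "\<And>t. 0 < t \<Longrightarrow> convex {x. t < g x} \<and> bounded {x. t < g x}"
    and int: "integrable lborel f" "integrable lborel g" "integrable lborel h"
    and u: "0 < u" "u < 1"
    and fgh: "\<And>x y. f x powr (1 - u) * g y powr u \<le> h ((1 - u) * x + u * y)"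
  shows "(\<integral>x. f x \<partial>lborel) powr (1 - u) * (\<integral>x. g x \<partial>lborel) powr u \<le> (\<integral>x. h x \<partial>lborel)"
proof -
  define a b where "a = Sup (range f)" and "b = Sup (range g)"
  have bdd: "bdd_above (range f)" "bdd_above (range g)" using f g by (auto intro!: bdd_aboveI2)
  have fa: "f x \<le> a" and gb: "g x \<le> b" for x
    unfolding a_def b_def using bdd by (auto intro: cSup_upper)
  show ?thesis
  proof (cases "a > 0 \<and> b > 0")
    case False
    then have "(\<forall>x. f x = 0) \<or> (\<forall>x. g x = 0)"
      using fa gb f(1) g(1) by (meson dual_order.trans eq_iff linorder_not_less)
    then show ?thesis using h by (auto intro!: integral_nonneg)
  next
    case True
    define c where "c = a powr (1 - u) * b powr u"
    have c: "c > 0" using True by (simp add: c_def)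
    have div: "{x. t < k x / e} = {x. t * e < k x}" if "0 < e" for t e and k :: "real \<Rightarrow> real"
      using that by (auto simp: field_simps)
    have sup: "\<exists>x. t < f x / a" "\<exists>x. t < g x / b" if "t < 1" for t
    proof -
      have "t * a < a" "t * b < b" using True that by auto
      then show "\<exists>x. t < f x / a" "\<exists>x. t < g x / b"
        using True less_cSupD[of "range f" "t * a"] less_cSupD[of "range g" "t * b"]
        by (auto simp: a_def[symmetric] b_def[symmetric] field_simps)
    qed
    have "ennreal (1 - u) * (\<integral>\<^sup>+x. ennreal (f x / a) \<partial>lborel) + ennreal u * (\<integral>\<^sup>+x. ennreal (g x / b) \<partial>lborel) \<le> (\<integral>\<^sup>+x. ennreal (h x / c) \<partial>lborel)"
    proof (rule prekopa_leindler_normalized)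
      fix x y
      have "(f x / a) powr (1 - u) * (g y / b) powr u = f x powr (1 - u) * g y powr u / c"
        using True f g by (simp add: powr_divide c_def)
      then show "(f x / a) powr (1 - u) * (g y / b) powr u \<le> h ((1 - u) * x + u * y) / c"
        using c fgh[of x y] by (simp add: divide_right_mono)
    qed (use True c f g h fa gb cf cg sup u in \<open>auto simp: div\<close>)
    note PL = this
    have R: "(\<integral>\<^sup>+x. ennreal (k x / e) \<partial>lborel) = ennreal ((\<integral>x. k x \<partial>lborel) / e)"
      if "integrable lborel k" "\<And>x. 0 \<le> k x" "0 < e" for k e
      using that nn_integral_eq_integral[of lborel "\<lambda>x. k x / e"] by simp
    have "ennreal (1 - u) * ennreal ((\<integral>x. f x \<partial>lborel) / a) + ennreal u * ennreal ((\<integral>x. g x \<partial>lborel) / b) \<le> ennreal ((\<integral>x. h x \<partial>lborel) / c)"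
      using PL R[OF int(1) f(1)] R[OF int(2) g(1)] R[OF int(3) h] True c by simp
    note PL' = this
    have nn: "0 \<le> (\<integral>x. f x \<partial>lborel) / a" "0 \<le> (\<integral>x. g x \<partial>lborel) / b" "0 \<le> (\<integral>x. h x \<partial>lborel) / c"
      using f g h True c by auto
    have "(1 - u) * ((\<integral>x. f x \<partial>lborel) / a) + u * ((\<integral>x. g x \<partial>lborel) / b) \<le> (\<integral>x. h x \<partial>lborel) / c"
    proof -
      have *: "(1 - u) * p + u * q \<le> r" if "ennreal (1 - u) * ennreal p + ennreal u * ennreal q \<le> ennreal r"
        "0 \<le> p" "0 \<le> q" "0 \<le> r" for p q r
      proof -
        have "ennreal (1 - u) * ennreal p + ennreal u * ennreal q = ennreal ((1 - u) * p + u * q)"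
          using u that by (simp add: ennreal_mult)
        then show ?thesis using that(1,4) by (metis ennreal_le_iff)
      qed
      show ?thesis by (rule *[OF PL' nn])
    qed
    then have "((\<integral>x. f x \<partial>lborel) / a) powr (1 - u) * ((\<integral>x. g x \<partial>lborel) / b) powr u \<le> (\<integral>x. h x \<partial>lborel) / c"
      using weighted_am_gm[OF nn(1,2) u] by linarith
    also have "((\<integral>x. f x \<partial>lborel) / a) powr (1 - u) * ((\<integral>x. g x \<partial>lborel) / b) powr u = (\<integral>x. f x \<partial>lborel) powr (1 - u) * (\<integral>x. g x \<partial>lborel) powr u / c"
      using True f g by (simp add: powr_divide c_def)
    finally show ?thesis using c by (simp add: divide_le_cancel)
  qed
qed

text \<open>Powers instead of logarithms admit functions with zeros, such as the indicators of
  half-lines to which everything is applied in the end; \<open>0 powr u = 0\<close>.\<close>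

definition log_concave :: "(real \<Rightarrow> real) \<Rightarrow> bool" where
  "log_concave f \<longleftrightarrow> (\<forall>x y u. 0 < u \<longrightarrow> u < 1 \<longrightarrow> f x powr (1 - u) * f y powr u \<le> f ((1 - u) * x + u * y))"

lemma std_normal_density_powr_le:
  assumes u: "0 < u" "u < 1"
  shows "std_normal_density x powr (1 - u) * std_normal_density y powr u \<le> std_normal_density ((1 - u) * x + u * y)"
proof -
  let ?c = "1 / sqrt (2 * pi)"
  have "?c powr (1 - u) * ?c powr u = ?c" by (simp add: powr_add[symmetric])
  moreover have "std_normal_density x powr (1 - u) * std_normal_density y powr u
      = (?c powr (1 - u) * ?c powr u) * exp ((1 - u) * (- x\<^sup>2 / 2) + u * (- y\<^sup>2 / 2))"
    unfolding std_normal_density_def powr_mult exp_powr_real exp_add by (simp add: mult_ac)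
  moreover have "(1 - u) * (- x\<^sup>2 / 2) + u * (- y\<^sup>2 / 2) \<le> - ((1 - u) * x + u * y)\<^sup>2 / 2"
  proof -
    have "(1 - u) * x\<^sup>2 + u * y\<^sup>2 - ((1 - u) * x + u * y)\<^sup>2 = u * (1 - u) * (x - y)\<^sup>2"
      by (simp add: power2_eq_square algebra_simps)
    moreover have "0 \<le> u * (1 - u) * (x - y)\<^sup>2" using u by simp
    ultimately show ?thesis by (simp add: field_simps)
  qed
  ultimately show ?thesis unfolding std_normal_density_def[of "(1 - u) * x + u * y"]
    by (simp add: divide_right_mono)
qed

lemma std_normal_density_le_exp: "std_normal_density x \<le> exp (- x\<^sup>2 / 2)"
proof -
  have "1 / sqrt (2 * pi) \<le> 1" using pi_gt3 by (simp add: real_le_rsqrt)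
  then have "1 / sqrt (2 * pi) * exp (- x\<^sup>2 / 2) \<le> 1 * exp (- x\<^sup>2 / 2)" by (intro mult_right_mono) auto
  then show ?thesis unfolding std_normal_density_def by simp
qed

lemma powr_products_mono:
  fixes a b c d :: real
  assumes "a powr (1 - u) * b powr u \<le> p" "c powr (1 - u) * d powr u \<le> q"
  shows "(a * c) powr (1 - u) * (b * d) powr u \<le> p * q"
proof -
  have "(a powr (1 - u) * b powr u) * (c powr (1 - u) * d powr u) \<le> p * q"
    using assms by (intro mult_mono) (auto intro: order_trans[rotated])
  then show ?thesis by (simp add: powr_mult mult_ac)
qed

text \<open>Provides the level-set hypotheses of \<open>prekopa_leindler\<close>: log-concavity
  gives intervals, and Gaussian decay bounds them even where \<open>f\<close> does not
  decay.\<close>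

lemma superlevel_log_concave_gauss:
  fixes f :: "real \<Rightarrow> real"
  assumes f: "log_concave f" "\<And>x. 0 \<le> f x" "\<And>x. f x \<le> 1" and t: "0 < t"
  shows "convex {x. t < f x * std_normal_density x} \<and> bounded {x. t < f x * std_normal_density x}"
proof
  let ?g = "\<lambda>x. f x * std_normal_density x"
  show "convex {x. t < ?g x}"
    unfolding convex_alt
  proof (intro ballI allI impI)
    fix x y u :: real assume *: "x \<in> {x. t < ?g x}" "y \<in> {x. t < ?g x}" "0 \<le> u \<and> u \<le> 1"
    show "(1 - u) *\<^sub>R x + u *\<^sub>R y \<in> {x. t < ?g x}"
    proof (cases "u = 0 \<or> u = 1")
      case False
      then have u: "0 < u" "u < 1" using * by auto
      have "t powr (1 - u) < ?g x powr (1 - u)" "t powr u < ?g y powr u"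
        using * u t by (auto intro!: powr_less_mono2)
      then have "t powr (1 - u) * t powr u < ?g x powr (1 - u) * ?g y powr u"
        by (intro mult_strict_mono) auto
      then have "t < ?g x powr (1 - u) * ?g y powr u"
        using t by (simp add: powr_add[symmetric])
      also have "\<dots> \<le> ?g ((1 - u) * x + u * y)"
        using f(1) u by (intro powr_products_mono std_normal_density_powr_le) (auto simp: log_concave_def)
      finally show ?thesis by simp
    qed (use * in auto)
  qed
  show "bounded {x. t < ?g x}"
  proof (rule boundedI)
    fix x assume "x \<in> {x. t < ?g x}"
    then have "t < f x * std_normal_density x" by simp
    also have "\<dots> \<le> 1 * std_normal_density x" using f by (intro mult_right_mono) auto
    also have "\<dots> \<le> exp (- x\<^sup>2 / 2)" using std_normal_density_le_exp[of x] by simp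
    also have "\<dots> = 1 / exp (x\<^sup>2 / 2)" by (simp add: exp_minus field_simps)
    also have "\<dots> \<le> 1 / (1 + x\<^sup>2 / 2)"
      using exp_ge_add_one_self[of "x\<^sup>2 / 2"] by (intro divide_left_mono mult_pos_pos) (auto intro: add_pos_nonneg)
    finally have "t * (1 + x\<^sup>2 / 2) < 1"
      by (simp add: pos_less_divide_eq add_pos_nonneg)
    then have "t * x\<^sup>2 < 2" using t by (simp add: algebra_simps)
    then have "x\<^sup>2 \<le> 2 / t" using t by (simp add: field_simps)
    then show "norm x \<le> sqrt (2 / t)" by (simp add: real_le_rsqrt)
  qed
qed

text \<open>As the density is itself log-concave, it can be absorbed into all three functions, which
  reduces the Gaussian case to Lebesgue measure.\<close>

lemma prekopa_leindler_gauss: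
  fixes f g h :: "real \<Rightarrow> real"
  assumes [measurable]: "f \<in> borel_measurable borel" "g \<in> borel_measurable borel" "h \<in> borel_measurable borel"
    and f: "\<And>x. 0 \<le> f x" "\<And>x. f x \<le> 1" and g: "\<And>x. 0 \<le> g x" "\<And>x. g x \<le> 1"
    and h: "\<And>x. 0 \<le> h x" "\<And>x. h x \<le> 1"
    and lc: "log_concave f" "log_concave g"
    and u: "0 < u" "u < 1"
    and fgh: "\<And>x y. f x powr (1 - u) * g y powr u \<le> h ((1 - u) * x + u * y)"
  shows "(\<integral>x. f x \<partial>gauss) powr (1 - u) * (\<integral>x. g x \<partial>gauss) powr u \<le> (\<integral>x. h x \<partial>gauss)"
proof -
  let ?d = "std_normal_density"
  interpret N: prob_space gauss by (rule prob_space_gauss)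
  have d1: "?d x \<le> 1" for x
    using std_normal_density_le_exp[of x] by (rule order_trans) simp
  have I: "(\<integral>x. k x \<partial>gauss) = (\<integral>x. k x * ?d x \<partial>lborel)" if "k \<in> borel_measurable borel" for k :: "real \<Rightarrow> real"
    using that by (subst integral_density) (auto simp: mult.commute)
  have J: "integrable lborel (\<lambda>x. k x * ?d x)"
    if [measurable]: "k \<in> borel_measurable borel" and "\<And>x. 0 \<le> k x" "\<And>x. k x \<le> 1" for k :: "real \<Rightarrow> real"
  proof -
    have "integrable gauss k" by (rule N.integrable_const_bound[where B=1]) (use that in auto)
    then show ?thesis by (subst (asm) integrable_density) (auto simp: mult.commute)
  qed
  show ?thesis unfolding I[OF assms(1)] I[OF assms(2)] I[OF assms(3)]
  proof (rule prekopa_leindler)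
    show "(f x * ?d x) powr (1 - u) * (g y * ?d y) powr u \<le> h ((1 - u) * x + u * y) * ?d ((1 - u) * x + u * y)" for x y
      by (intro powr_products_mono std_normal_density_powr_le fgh u)
    show "f x * ?d x \<le> 1" "g x * ?d x \<le> 1" for x
      using f g d1 by (auto intro: mult_le_one)
  qed (use f g h u lc superlevel_log_concave_gauss J in auto)
qed

section \<open>Sidak's inequality for even log-concave functions\<close>

text \<open>Prekopa's theorem that marginals preserve log-concavity, here in the shift
  \<open>w\<close>. One Gaussian coordinate is integrated out at a time, its contribution
  \<open>b i k * t\<close> being treated as part of the shift.\<close>

lemma log_concave_gauss_vec_marginal:
  fixes F :: "'i \<Rightarrow> real \<Rightarrow> real" and b :: "'i \<Rightarrow> 'k \<Rightarrow> real"
  assumes K: "finite K" and I: "finite I"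
    and F [measurable]: "\<And>i. i \<in> I \<Longrightarrow> F i \<in> borel_measurable borel"
    and F01: "\<And>i x. i \<in> I \<Longrightarrow> 0 \<le> F i x" "\<And>i x. i \<in> I \<Longrightarrow> F i x \<le> 1"
    and lc: "\<And>i. i \<in> I \<Longrightarrow> log_concave (F i)"
    and u: "0 < u" "u < 1"
  shows "(\<integral>z. (\<Prod>i\<in>I. F i (w i + (\<Sum>k\<in>K. b i k * z k))) \<partial>gauss_vec K) powr (1 - u)
    * (\<integral>z. (\<Prod>i\<in>I. F i (w' i + (\<Sum>k\<in>K. b i k * z k))) \<partial>gauss_vec K) powr u
    \<le> (\<integral>z. (\<Prod>i\<in>I. F i ((1 - u) * w i + u * w' i + (\<Sum>k\<in>K. b i k * z k))) \<partial>gauss_vec K)"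
  using K u
proof (induction K arbitrary: w w' u rule: finite_induct)
  case empty
  have "(\<Prod>i\<in>I. F i (w i)) powr (1 - u) * (\<Prod>i\<in>I. F i (w' i)) powr u
      = (\<Prod>i\<in>I. F i (w i) powr (1 - u) * F i (w' i) powr u)"
    by (simp add: prod_powr_distrib prod.distrib)
  also have "\<dots> \<le> (\<Prod>i\<in>I. F i ((1 - u) * w i + u * w' i))"
    using lc empty by (intro prod_mono) (auto simp: log_concave_def)
  finally show ?case
    by (simp add: prob_space.prob_space[OF prob_space_gauss_vec])
next
  case (insert k K)
  define \<psi> where "\<psi> w = (\<integral>z. (\<Prod>i\<in>I. F i (w i + (\<Sum>k\<in>K. b i k * z k))) \<partial>gauss_vec K)" for w
  interpret N: prob_space gauss by (rule prob_space_gauss)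
  interpret G: prob_space "gauss_vec K" by (rule prob_space_gauss_vec)
  interpret G': prob_space "gauss_vec (insert k K)" by (rule prob_space_gauss_vec)
  interpret P: pair_prob_space "gauss_vec K" gauss ..
  interpret product_prob_space "\<lambda>_::'k. gauss" K by unfold_locales
  have [measurable]: "(\<lambda>t. \<psi> (\<lambda>i. w i + b i k * t)) \<in> borel_measurable borel" for w
  proof -
    have "(\<lambda>t. \<psi> (\<lambda>i. w i + b i k * t)) \<in> borel_measurable gauss"
      unfolding \<psi>_def by measurable
    then show ?thesis by simp
  qed
  have \<psi>: "0 \<le> \<psi> w" "\<psi> w \<le> 1" for w
  proof -
    show "0 \<le> \<psi> w" unfolding \<psi>_def using F01 by (auto intro!: Bochner_Integration.integral_nonneg prod_nonneg)
    have "\<psi> w \<le> (\<integral>z. 1 \<partial>gauss_vec K)" unfolding \<psi>_def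
      by (intro integral_mono G.integrable_const_bound[where B=1])
        (use F01 in \<open>auto intro!: prod_le_1 simp: abs_prod\<close>)
    then show "\<psi> w \<le> 1" by (simp add: G.prob_space)
  qed
  have split: "(\<integral>z. (\<Prod>i\<in>I. F i (w i + (\<Sum>k\<in>insert k K. b i k * z k))) \<partial>gauss_vec (insert k K))
     = (\<integral>t. \<psi> (\<lambda>i. w i + b i k * t) \<partial>gauss)" for w
  proof -
    have "(\<integral>z. (\<Prod>i\<in>I. F i (w i + (\<Sum>k\<in>insert k K. b i k * z k))) \<partial>gauss_vec (insert k K))
      = (\<integral>z. (\<integral>t. (\<Prod>i\<in>I. F i (w i + (\<Sum>j\<in>insert k K. b i j * (z(k := t)) j))) \<partial>gauss) \<partial>gauss_vec K)"
      by (rule product_integral_insert[OF insert.hyps], rule G'.integrable_const_bound[where B=1])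
        (use F01 in \<open>auto intro!: prod_le_1 simp: abs_prod\<close>)
    also have "\<dots> = (\<integral>z. (\<integral>t. (\<Prod>i\<in>I. F i (w i + b i k * t + (\<Sum>j\<in>K. b i j * z j))) \<partial>gauss) \<partial>gauss_vec K)"
    proof -
      have "(\<Sum>j\<in>insert k K. b i j * (z(k := t)) j) = b i k * t + (\<Sum>j\<in>K. b i j * z j)" for i z t
        using insert.hyps by (simp add: sum.insert) (auto intro!: sum.cong)
      then show ?thesis by (simp add: add.assoc)
    qed
    also have "\<dots> = (\<integral>t. (\<integral>z. (\<Prod>i\<in>I. F i (w i + b i k * t + (\<Sum>j\<in>K. b i j * z j))) \<partial>gauss_vec K) \<partial>gauss)"
      by (rule P.Fubini_integral[symmetric], rule P.integrable_const_bound[where B=1])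
        (use F01 in \<open>auto intro!: prod_le_1 simp: abs_prod case_prod_beta\<close>)
    finally show ?thesis unfolding \<psi>_def .
  qed
  have lc\<psi>: "\<psi> v powr (1 - u) * \<psi> v' powr u \<le> \<psi> (\<lambda>i. (1 - u) * v i + u * v' i)" if "0 < u" "u < 1" for v v' u
    using insert.IH[OF that, of v v'] by (simp add: \<psi>_def)
  \<comment> \<open>\<open>prekopa_leindler_gauss\<close> asks for log-concavity of both functions
    at every weight, not only at the given \<open>u\<close>; hence the induction leaves
    \<open>u\<close> arbitrary.\<close>
  have lcl: "log_concave (\<lambda>t. \<psi> (\<lambda>i. w i + b i k * t))" for w
    unfolding log_concave_def
  proof (intro allI impI)
    fix x y u :: real assume "0 < u" "u < 1"
    from lc\<psi>[OF this, of "\<lambda>i. w i + b i k * x" "\<lambda>i. w i + b i k * y"]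
    show "\<psi> (\<lambda>i. w i + b i k * x) powr (1 - u) * \<psi> (\<lambda>i. w i + b i k * y) powr u
       \<le> \<psi> (\<lambda>i. w i + b i k * ((1 - u) * x + u * y))" by (simp add: algebra_simps)
  qed
  show ?case unfolding split
  proof (rule prekopa_leindler_gauss)
    fix x y
    from lc\<psi>[OF insert.prems, of "\<lambda>i. w i + b i k * x" "\<lambda>i. w' i + b i k * y"]
    show "\<psi> (\<lambda>i. w i + b i k * x) powr (1 - u) * \<psi> (\<lambda>i. w' i + b i k * y) powr u
       \<le> \<psi> (\<lambda>i. (1 - u) * w i + u * w' i + b i k * ((1 - u) * x + u * y))" by (simp add: algebra_simps)
  qed (use \<psi> insert.prems lcl in auto)
qed

text \<open>\<open>x\<close> lies between \<open>- y\<close> and \<open>y\<close>, where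
  \<open>f\<close> takes equal values, so the geometric mean of those values is
  \<open>f y\<close>.\<close>

lemma log_concave_even_antimono:
  assumes f: "log_concave f" "\<And>x. f (- x) = f x" "\<And>x. 0 \<le> f x" and xy: "\<bar>x\<bar> \<le> \<bar>y\<bar>"
  shows "f y \<le> f x"
proof (cases "\<bar>x\<bar> = \<bar>y\<bar>")
  case True
  then have "x = y \<or> x = - y" by linarith
  then show ?thesis using f(2) by auto
next
  case False
  then have y: "y \<noteq> 0" using xy by auto
  define u where "u = (x + y) / (2 * y)"
  have "\<bar>x\<bar> / \<bar>y\<bar> < 1" using False xy y by simp
  then have "\<bar>x / y\<bar> < 1" by (simp only: abs_divide)
  moreover have "u = (x / y + 1) / 2" using y by (simp add: u_def field_simps)
  ultimately have u: "0 < u" "u < 1" unfolding abs_less_iff by auto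
  have "u * y = (x + y) / 2" using y by (simp add: u_def)
  then have *: "(1 - u) * (- y) + u * y = x" by (simp add: algebra_simps)
  have "f y = f (- y) powr (1 - u) * f y powr u"
    using f(2,3) by (simp add: powr_add[symmetric])
  also have "\<dots> \<le> f ((1 - u) * (- y) + u * y)"
    using f(1) u unfolding log_concave_def by blast
  finally show ?thesis unfolding * .
qed

text \<open>Both functions order points by absolute value in the same way, so
  \<open>(f x - f y) * (g x - g y)\<close> is never negative; integrating it over two independent
  copies gives twice the covariance.\<close>

lemma chebyshev_association:
  fixes f g :: "real \<Rightarrow> real"
  assumes N: "prob_space N" and [measurable]: "f \<in> borel_measurable N" "g \<in> borel_measurable N"
    and f: "\<And>x. 0 \<le> f x" "\<And>x. f x \<le> 1" and g: "\<And>x. 0 \<le> g x" "\<And>x. g x \<le> 1"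
    and mono: "\<And>x y. \<bar>x\<bar> \<le> \<bar>y\<bar> \<Longrightarrow> f y \<le> f x" "\<And>x y. \<bar>x\<bar> \<le> \<bar>y\<bar> \<Longrightarrow> g y \<le> g x"
  shows "(\<integral>x. f x \<partial>N) * (\<integral>x. g x \<partial>N) \<le> (\<integral>x. f x * g x \<partial>N)"
proof -
  interpret N: prob_space N by fact
  have "f x * g x \<le> 1" for x using f g by (simp add: mult_le_one)
  then have i: "integrable N f" "integrable N g" "integrable N (\<lambda>x. f x * g x)"
    using f g by (auto intro!: N.integrable_const_bound[where B=1])
  have "0 \<le> (\<integral>x. (\<integral>y. (f x - f y) * (g x - g y) \<partial>N) \<partial>N)"
  proof (intro Bochner_Integration.integral_nonneg)
    fix x y
    show "0 \<le> (f x - f y) * (g x - g y)"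
      using mono(1)[of x y] mono(2)[of x y] mono(1)[of y x] mono(2)[of y x]
      by (cases "\<bar>x\<bar> \<le> \<bar>y\<bar>") (auto intro: mult_nonneg_nonneg mult_nonpos_nonpos)
  qed
  also have "\<dots> = (\<integral>x. f x * g x - f x * (\<integral>y. g y \<partial>N) - g x * (\<integral>y. f y \<partial>N) + (\<integral>y. f y * g y \<partial>N) \<partial>N)"
  proof (rule Bochner_Integration.integral_cong[OF refl])
    fix x
    have "(\<integral>y. (f x - f y) * (g x - g y) \<partial>N) = (\<integral>y. f x * g x - f x * g y - g x * f y + f y * g y \<partial>N)"
      by (simp add: algebra_simps)
    then show "(\<integral>y. (f x - f y) * (g x - g y) \<partial>N) = f x * g x - f x * (\<integral>y. g y \<partial>N) - g x * (\<integral>y. f y \<partial>N) + (\<integral>y. f y * g y \<partial>N)"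
      using i by (simp add: N.prob_space)
  qed
  also have "\<dots> = 2 * ((\<integral>x. f x * g x \<partial>N) - (\<integral>x. f x \<partial>N) * (\<integral>x. g x \<partial>N))"
    using i by (simp add: N.prob_space)
  finally show ?thesis by simp
qed

text \<open>Coordinate \<open>j\<close> is split off by regression. Given its value
  \<open>t\<close>, the conditional expectation \<open>\<psi> t\<close> of the other factors is even
  and log-concave, so \<open>\<psi>\<close> and \<open>F j\<close> are both nonincreasing in the
  absolute value of \<open>t\<close> and hence positively correlated.\<close>

lemma sidak_log_concave:
  fixes F :: "'i \<Rightarrow> real \<Rightarrow> real" and a :: "'i \<Rightarrow> 'k \<Rightarrow> real"
  assumes K: "finite K" and I: "finite I"
    and unit: "\<And>i. i \<in> I \<Longrightarrow> (\<Sum>k\<in>K. a i k * a i k) = 1"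
    and F: "\<And>i. i \<in> I \<Longrightarrow> F i \<in> borel_measurable borel"
    and F01: "\<And>i x. i \<in> I \<Longrightarrow> 0 \<le> F i x" "\<And>i x. i \<in> I \<Longrightarrow> F i x \<le> 1"
    and even: "\<And>i x. i \<in> I \<Longrightarrow> F i (- x) = F i x"
    and lc: "\<And>i. i \<in> I \<Longrightarrow> log_concave (F i)"
  shows "(\<Prod>i\<in>I. \<integral>x. F i x \<partial>gauss) \<le> (\<integral>z. (\<Prod>i\<in>I. F i (\<Sum>k\<in>K. a i k * z k)) \<partial>gauss_vec K)"
  using I unit F F01 even lc
proof (induction I rule: finite_induct)
  case empty
  show ?case by (simp add: prob_space.prob_space[OF prob_space_gauss_vec])
next
  case (insert j I)
  note [measurable] = insert.prems(2)
  have [measurable]: "F j \<in> borel_measurable borel" "\<And>i. i \<in> I \<Longrightarrow> F i \<in> borel_measurable borel" by auto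
  \<comment> \<open>\<open>r i\<close> is the regression coefficient on the unit-variance coordinate
    \<open>j\<close>, and \<open>b i\<close> gives the residual, which is uncorrelated with that
    coordinate.\<close>
  define r where "r i = (\<Sum>k\<in>K. a i k * a j k)" for i
  define b where "b i k = a i k - r i * a j k" for i k
  define \<psi> where "\<psi> t = (\<integral>z. (\<Prod>i\<in>I. F i (r i * t + (\<Sum>k\<in>K. b i k * z k))) \<partial>gauss_vec K)" for t
  interpret N: prob_space gauss by (rule prob_space_gauss)
  interpret G: prob_space "gauss_vec K" by (rule prob_space_gauss_vec)
  interpret P: pair_prob_space gauss "gauss_vec K" ..
  have aj: "(\<Sum>k\<in>K. a j k * a j k) = 1" using insert.prems(1) by auto
  have rj: "r j = 1" by (simp add: r_def aj)
  have bj: "b j k = 0" for k by (simp add: b_def rj)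
  have cov: "(\<Sum>k\<in>K. a i k * a i' k) = r i * r i' + (\<Sum>k\<in>K. b i k * b i' k)" for i i'
  proof -
    have "(\<Sum>k\<in>K. b i k * b i' k) = (\<Sum>k\<in>K. a i k * a i' k - r i' * (a i k * a j k) - r i * (a i' k * a j k) + r i * r i' * (a j k * a j k))"
      by (rule sum.cong) (auto simp: b_def algebra_simps)
    also have "\<dots> = (\<Sum>k\<in>K. a i k * a i' k) - r i * r i'"
      unfolding sum.distrib sum_subtractf sum_distrib_left[symmetric] by (simp add: aj r_def[symmetric])
    finally show ?thesis by simp
  qed
  have [measurable]: "\<psi> \<in> borel_measurable borel"
  proof -
    have "\<psi> \<in> borel_measurable gauss" unfolding \<psi>_def by measurable
    then show ?thesis by simp
  qed
  have \<psi>: "0 \<le> \<psi> w" "\<psi> w \<le> 1" for w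
  proof -
    show "0 \<le> \<psi> w" unfolding \<psi>_def using insert.prems by (auto intro!: Bochner_Integration.integral_nonneg prod_nonneg)
    have "\<psi> w \<le> (\<integral>z. 1 \<partial>gauss_vec K)" unfolding \<psi>_def
      by (intro integral_mono G.integrable_const_bound[where B=1])
        (use insert.prems in \<open>auto intro!: prod_le_1 simp: abs_prod\<close>)
    then show "\<psi> w \<le> 1" by (simp add: G.prob_space)
  qed
  have joint: "(\<integral>z. (\<Prod>i\<in>J. f i (\<Sum>k\<in>K. a i k * z k)) \<partial>gauss_vec K)
      = (\<integral>t. (\<integral>z. (\<Prod>i\<in>J. f i (r i * t + (\<Sum>k\<in>K. b i k * z k))) \<partial>gauss_vec K) \<partial>gauss)"
    if "finite J" and [measurable]: "\<And>i. i \<in> J \<Longrightarrow> f i \<in> borel_measurable borel" and f: "\<And>i x. i \<in> J \<Longrightarrow> 0 \<le> f i x \<and> f i x \<le> 1" for J and f :: "'i \<Rightarrow> real \<Rightarrow> real"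
  proof -
    have "(\<integral>z. (\<Prod>i\<in>J. f i (\<Sum>k\<in>K. a i k * z k)) \<partial>gauss_vec K)
      = (\<integral>z. (\<Prod>i\<in>J. f i (r i * fst z + (\<Sum>k\<in>K. b i k * snd z k))) \<partial>(gauss \<Otimes>\<^sub>M gauss_vec K))"
      by (rule jointly_gaussian_prod[OF jointly_gaussian_linear[OF K \<open>finite J\<close>, of a]
          jointly_gaussian_common[OF jointly_gaussian_linear[OF K \<open>finite J\<close>, of b], of r], where f=f])
        (use cov in auto)
    also have "\<dots> = (\<integral>t. (\<integral>z. (\<Prod>i\<in>J. f i (r i * t + (\<Sum>k\<in>K. b i k * z k))) \<partial>gauss_vec K) \<partial>gauss)"
      by (subst P.integral_fst'[symmetric], rule P.integrable_const_bound[where B=1])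
        (use f in \<open>auto intro!: prod_le_1 simp: abs_prod\<close>)
    finally show ?thesis .
  qed
  \<comment> \<open>Negating all residuals leaves their covariances unchanged, so the sign of
    \<open>t\<close> can be moved through the even factors.\<close>
  have ev: "\<psi> (- t) = \<psi> t" for t
  proof -
    have "\<psi> (- t) = (\<integral>z. (\<Prod>i\<in>I. F i (- (r i * t + (\<Sum>k\<in>K. - b i k * z k)))) \<partial>gauss_vec K)"
      unfolding \<psi>_def by (simp add: sum_negf)
    also have "\<dots> = (\<integral>z. (\<Prod>i\<in>I. F i (r i * t + (\<Sum>k\<in>K. - b i k * z k))) \<partial>gauss_vec K)"
      by (intro Bochner_Integration.integral_cong prod.cong refl insert.prems(5)) auto
    also have "\<dots> = \<psi> t" unfolding \<psi>_def
      by (rule jointly_gaussian_prod[OF jointly_gaussian_linear[OF K insert.hyps(1), of "\<lambda>i k. - b i k"]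
          jointly_gaussian_linear[OF K insert.hyps(1), of b], where f="\<lambda>i x. F i (r i * t + x)"]) auto
    finally show ?thesis .
  qed
  have lc\<psi>: "log_concave \<psi>"
    unfolding log_concave_def
  proof (intro allI impI)
    fix x y u :: real assume u: "0 < u" "u < 1"
    have "\<psi> x powr (1 - u) * \<psi> y powr u
       \<le> (\<integral>z. (\<Prod>i\<in>I. F i ((1 - u) * (r i * x) + u * (r i * y) + (\<Sum>k\<in>K. b i k * z k))) \<partial>gauss_vec K)"
      unfolding \<psi>_def by (rule log_concave_gauss_vec_marginal) (use K insert u in auto)
    also have "\<dots> = \<psi> ((1 - u) * x + u * y)" unfolding \<psi>_def by (simp add: algebra_simps)
    finally show "\<psi> x powr (1 - u) * \<psi> y powr u \<le> \<psi> ((1 - u) * x + u * y)" .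
  qed
  have "(\<Prod>i\<in>insert j I. \<integral>x. F i x \<partial>gauss) = (\<integral>x. F j x \<partial>gauss) * (\<Prod>i\<in>I. \<integral>x. F i x \<partial>gauss)"
    using insert.hyps by simp
  also have "\<dots> \<le> (\<integral>x. F j x \<partial>gauss) * (\<integral>z. (\<Prod>i\<in>I. F i (\<Sum>k\<in>K. a i k * z k)) \<partial>gauss_vec K)"
    using insert.prems by (intro mult_left_mono insert.IH) (auto intro!: Bochner_Integration.integral_nonneg)
  also have "(\<integral>z. (\<Prod>i\<in>I. F i (\<Sum>k\<in>K. a i k * z k)) \<partial>gauss_vec K) = (\<integral>t. \<psi> t \<partial>gauss)"
    unfolding \<psi>_def by (rule joint) (use insert in auto)
  also have "(\<integral>x. F j x \<partial>gauss) * (\<integral>t. \<psi> t \<partial>gauss) \<le> (\<integral>t. F j t * \<psi> t \<partial>gauss)"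
  proof (rule chebyshev_association[OF prob_space_gauss])
    show "F j y \<le> F j x" if "\<bar>x\<bar> \<le> \<bar>y\<bar>" for x y
      by (rule log_concave_even_antimono[OF _ _ _ that]) (use insert.prems in auto)
    show "\<psi> y \<le> \<psi> x" if "\<bar>x\<bar> \<le> \<bar>y\<bar>" for x y
      by (rule log_concave_even_antimono[OF lc\<psi> ev \<psi>(1) that])
  qed (use \<psi> insert.prems in auto)
  also have "\<dots> = (\<integral>t. (\<integral>z. (\<Prod>i\<in>insert j I. F i (r i * t + (\<Sum>k\<in>K. b i k * z k))) \<partial>gauss_vec K) \<partial>gauss)"
    using insert.hyps by (simp add: \<psi>_def rj bj)
  also have "\<dots> = (\<integral>z. (\<Prod>i\<in>insert j I. F i (\<Sum>k\<in>K. a i k * z k)) \<partial>gauss_vec K)"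
    by (rule joint[symmetric]) (use insert in auto)
  finally show ?case .
qed

section \<open>Doubling\<close>

text \<open>For independent standard normal \<open>A\<close> and \<open>B\<close>, this is the
  conditional expectation of \<open>f A * f B\<close> given
  \<open>(A + B) / sqrt 2 = y\<close>.\<close>

definition gauss_double :: "(real \<Rightarrow> real) \<Rightarrow> real \<Rightarrow> real" where
  "gauss_double f y = (\<integral>x. f ((y - x) / sqrt 2) * f ((y + x) / sqrt 2) \<partial>gauss)"

definition mono_log_concave :: "(real \<Rightarrow> real) \<Rightarrow> bool" where
  "mono_log_concave f \<longleftrightarrow> f \<in> borel_measurable borel \<and> (\<forall>x. 0 \<le> f x \<and> f x \<le> 1) \<and> log_concave f \<and> mono f"

lemma log_concave_pair_product:
  assumes "log_concave f" "0 < u" "u < 1"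
  shows "(f ((y - x) / c) * f ((y + x) / c)) powr (1 - u) * (f ((y' - x') / c) * f ((y' + x') / c)) powr u
    \<le> f (((1 - u) * y + u * y' - ((1 - u) * x + u * x')) / c) * f (((1 - u) * y + u * y' + ((1 - u) * x + u * x')) / c)"
proof (rule powr_products_mono)
  have *: "f a powr (1 - u) * f b powr u \<le> f ((1 - u) * a + u * b)" for a b
    using assms by (auto simp: log_concave_def)
  show "f ((y - x) / c) powr (1 - u) * f ((y' - x') / c) powr u \<le> f (((1 - u) * y + u * y' - ((1 - u) * x + u * x')) / c)"
    using *[of "(y - x) / c" "(y' - x') / c"] by (simp add: algebra_simps add_divide_distrib diff_divide_distrib)
  show "f ((y + x) / c) powr (1 - u) * f ((y' + x') / c) powr u \<le> f (((1 - u) * y + u * y' + ((1 - u) * x + u * x')) / c)"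
    using *[of "(y + x) / c" "(y' + x') / c"] by (simp add: algebra_simps add_divide_distrib diff_divide_distrib)
qed

text \<open>The integrand is log-concave in \<open>y\<close> and \<open>x\<close> jointly, since
  both arguments of \<open>f\<close> are affine in them; Prekopa-Leindler integrates
  \<open>x\<close> out. Monotonicity and the bounds pass under the integral.\<close>

lemma mono_log_concave_double:
  assumes f: "mono_log_concave f"
  shows "mono_log_concave (gauss_double f)"
proof -
  have [measurable]: "f \<in> borel_measurable borel" and f0: "\<And>x. 0 \<le> f x" and f1: "\<And>x. f x \<le> 1"
    and lc: "log_concave f" and mono: "mono f"
    using f by (auto simp: mono_log_concave_def)
  interpret N: prob_space gauss by (rule prob_space_gauss)
  have F: "0 \<le> f a * f b" "f a * f b \<le> 1" for a b
    using f0 f1 by (auto intro: mult_le_one)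
  have i: "integrable gauss (\<lambda>x. f ((y - x) / sqrt 2) * f ((y + x) / sqrt 2))" for y
    by (rule N.integrable_const_bound[where B=1]) (use F in auto)
  have m: "gauss_double f \<in> borel_measurable borel"
  proof -
    have "gauss_double f \<in> borel_measurable gauss" unfolding gauss_double_def by measurable
    then show ?thesis by simp
  qed
  have nn: "0 \<le> gauss_double f y" for y
    unfolding gauss_double_def using F by (auto intro!: Bochner_Integration.integral_nonneg)
  have "gauss_double f y \<le> (\<integral>x. 1 \<partial>gauss)" for y
    unfolding gauss_double_def using F by (intro integral_mono i) auto
  then have le1: "gauss_double f y \<le> 1" for y using N.prob_space by simp
  have "mono (gauss_double f)"
    unfolding gauss_double_def
  proof (intro monoI integral_mono i mult_mono)
    fix y y' x :: real assume "y \<le> y'"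
    then show "f ((y - x) / sqrt 2) \<le> f ((y' - x) / sqrt 2)" "f ((y + x) / sqrt 2) \<le> f ((y' + x) / sqrt 2)"
      by (auto intro!: monoD[OF mono] divide_right_mono)
  qed (use f0 in auto)
  moreover have "log_concave (gauss_double f)"
    unfolding log_concave_def gauss_double_def
  proof (intro allI impI)
    fix y y' u :: real assume u: "0 < u" "u < 1"
    have l: "log_concave (\<lambda>x. f ((y - x) / sqrt 2) * f ((y + x) / sqrt 2))" for y
      unfolding log_concave_def
    proof (intro allI impI)
      fix x x' u :: real assume "0 < u" "u < 1"
      moreover have "(1 - u) * y + u * y = y" by (simp add: algebra_simps)
      ultimately show "(f ((y - x) / sqrt 2) * f ((y + x) / sqrt 2)) powr (1 - u) * (f ((y - x') / sqrt 2) * f ((y + x') / sqrt 2)) powr u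
        \<le> f ((y - ((1 - u) * x + u * x')) / sqrt 2) * f ((y + ((1 - u) * x + u * x')) / sqrt 2)"
        using log_concave_pair_product[OF lc, of u y x "sqrt 2" y x'] by simp
    qed
    show "(\<integral>x. f ((y - x) / sqrt 2) * f ((y + x) / sqrt 2) \<partial>gauss) powr (1 - u) * (\<integral>x. f ((y' - x) / sqrt 2) * f ((y' + x) / sqrt 2) \<partial>gauss) powr u
      \<le> (\<integral>x. f (((1 - u) * y + u * y' - x) / sqrt 2) * f (((1 - u) * y + u * y' + x) / sqrt 2) \<partial>gauss)"
      by (rule prekopa_leindler_gauss) (use F l u log_concave_pair_product[OF lc u] in auto)
  qed
  ultimately show ?thesis using m nn le1 by (simp add: mono_log_concave_def)
qed

lemma prod_times_bool:
  "(\<Prod>x\<in>I \<times> (UNIV :: bool set). g x) = (\<Prod>i\<in>I. g (i, False) * g (i, True))"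
  by (simp add: prod.cartesian_product[symmetric, of _ UNIV I, simplified] UNIV_bool prod.cartesian_product')

lemma double_rotation_prod:
  fixes f :: "'i \<Rightarrow> real \<Rightarrow> real"
  assumes X: "jointly_gaussian M I X C" and [measurable]: "\<And>i. i \<in> I \<Longrightarrow> f i \<in> borel_measurable borel"
  shows "(\<integral>z. (\<Prod>i\<in>I. f i (X i (fst z)) * f i (X i (snd z))) \<partial>(M \<Otimes>\<^sub>M M))
    = (\<integral>z. (\<Prod>i\<in>I. f i ((X i (fst z) - X i (snd z)) / sqrt 2) * f i ((X i (fst z) + X i (snd z)) / sqrt 2)) \<partial>(M \<Otimes>\<^sub>M M))"
proof -
  have c: "(1 / sqrt 2)\<^sup>2 + (- 1 / sqrt 2)\<^sup>2 = (1::real)" by (simp add: power_divide)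
  \<comment> \<open>The parameters \<open>1\<close>, \<open>0\<close> describe the unrotated copies,
    \<open>1 / sqrt 2\<close> and \<open>- 1 / sqrt 2\<close> the rotation by 45 degrees.\<close>
  have "(\<integral>z. (\<Prod>x\<in>I \<times> UNIV. (\<lambda>(i, b). f i) x ((\<lambda>(i, b) z. if b then 1 * X i (fst z) + 0 * X i (snd z) else 1 * X i (snd z) - 0 * X i (fst z)) x z)) \<partial>(M \<Otimes>\<^sub>M M))
    = (\<integral>z. (\<Prod>x\<in>I \<times> UNIV. (\<lambda>(i, b). f i) x ((\<lambda>(i, b) z. if b then (1 / sqrt 2) * X i (fst z) + (- 1 / sqrt 2) * X i (snd z) else (1 / sqrt 2) * X i (snd z) - (- 1 / sqrt 2) * X i (fst z)) x z)) \<partial>(M \<Otimes>\<^sub>M M))"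
    by (rule jointly_gaussian_prod[OF jointly_gaussian_two_copies[OF X, of 1 0] jointly_gaussian_two_copies[OF X c], where f="\<lambda>(i, b). f i"]) auto
  then show ?thesis unfolding prod_times_bool
    by (simp add: mult.commute add_divide_distrib diff_divide_distrib add.commute)
qed

text \<open>The square on the right is an integral over two independent copies, which may be
  rotated. With the first rotated copy fixed, each factor is even and log-concave in the second, and
  Sidak's inequality bounds the inner integral from below.\<close>

lemma gauss_double_correlation:
  fixes a :: "'i \<Rightarrow> 'k \<Rightarrow> real"
  assumes f: "mono_log_concave f" and K: "finite K" and I: "finite I"
    and unit: "\<And>i. i \<in> I \<Longrightarrow> (\<Sum>k\<in>K. a i k * a i k) = 1"
  shows "(\<integral>z. (\<Prod>i\<in>I. gauss_double f (\<Sum>k\<in>K. a i k * z k)) \<partial>gauss_vec K)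
    \<le> (\<integral>z. (\<Prod>i\<in>I. f (\<Sum>k\<in>K. a i k * z k)) \<partial>gauss_vec K)\<^sup>2"
proof -
  have [measurable]: "f \<in> borel_measurable borel" and f0: "\<And>x. 0 \<le> f x" and f1: "\<And>x. f x \<le> 1"
    and lc: "log_concave f"
    using f by (auto simp: mono_log_concave_def)
  have [measurable]: "gauss_double f \<in> borel_measurable borel" and d0: "\<And>x. 0 \<le> gauss_double f x" and d1: "\<And>x. gauss_double f x \<le> 1"
    using mono_log_concave_double[OF f] by (auto simp: mono_log_concave_def)
  let ?X = "\<lambda>i z. \<Sum>k\<in>K. a i k * z k"
  let ?M = "gauss_vec K"
  interpret G: prob_space ?M by (rule prob_space_gauss_vec)
  interpret P: pair_prob_space ?M ?M ..
  have F: "0 \<le> f a * f b" "f a * f b \<le> 1" for a b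
    using f0 f1 by (auto intro: mult_le_one)
  have Pf: "\<bar>\<Prod>i\<in>I. f (h i) * f (h' i)\<bar> \<le> 1" for h h'
    using F by (auto simp: abs_prod intro!: prod_le_1)
  have ii: "integrable (?M \<Otimes>\<^sub>M ?M) (\<lambda>z. \<Prod>i\<in>I. f ((?X i (fst z) - ?X i (snd z)) / sqrt 2) * f ((?X i (fst z) + ?X i (snd z)) / sqrt 2))"
    by (rule P.integrable_const_bound[where B=1]) (use Pf in auto)
  have "(\<integral>z. (\<Prod>i\<in>I. gauss_double f (?X i z)) \<partial>?M)
    \<le> (\<integral>y. (\<integral>x. (\<Prod>i\<in>I. f ((?X i y - ?X i x) / sqrt 2) * f ((?X i y + ?X i x) / sqrt 2)) \<partial>?M) \<partial>?M)"
  proof (rule integral_mono)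
    show "integrable ?M (\<lambda>z. \<Prod>i\<in>I. gauss_double f (?X i z))"
      by (rule G.integrable_const_bound[where B=1]) (use d0 d1 in \<open>auto simp: abs_prod intro!: prod_le_1\<close>)
    show "integrable ?M (\<lambda>y. \<integral>x. (\<Prod>i\<in>I. f ((?X i y - ?X i x) / sqrt 2) * f ((?X i y + ?X i x) / sqrt 2)) \<partial>?M)"
      using P.integrable_fst'[OF ii] by simp
    fix y
    show "(\<Prod>i\<in>I. gauss_double f (?X i y)) \<le> (\<integral>x. (\<Prod>i\<in>I. f ((?X i y - ?X i x) / sqrt 2) * f ((?X i y + ?X i x) / sqrt 2)) \<partial>?M)"
      unfolding gauss_double_def
    proof (rule sidak_log_concave[OF K I unit, where F="\<lambda>i x. f ((?X i y - x) / sqrt 2) * f ((?X i y + x) / sqrt 2)"])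
      fix i
      show "log_concave (\<lambda>x. f ((?X i y - x) / sqrt 2) * f ((?X i y + x) / sqrt 2))"
        unfolding log_concave_def
      proof (intro allI impI)
        fix x x' u :: real assume u: "0 < u" "u < 1"
        have "(1 - u) * ?X i y + u * ?X i y = ?X i y" by (simp add: algebra_simps)
        then show "(f ((?X i y - x) / sqrt 2) * f ((?X i y + x) / sqrt 2)) powr (1 - u) * (f ((?X i y - x') / sqrt 2) * f ((?X i y + x') / sqrt 2)) powr u
          \<le> f ((?X i y - ((1 - u) * x + u * x')) / sqrt 2) * f ((?X i y + ((1 - u) * x + u * x')) / sqrt 2)"
          using log_concave_pair_product[OF lc u, of "?X i y" x "sqrt 2" "?X i y" x'] by simp
      qed
    qed (use F in \<open>auto simp: mult.commute\<close>)
  qed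
  also have "\<dots> = (\<integral>z. (\<Prod>i\<in>I. f ((?X i (fst z) - ?X i (snd z)) / sqrt 2) * f ((?X i (fst z) + ?X i (snd z)) / sqrt 2)) \<partial>(?M \<Otimes>\<^sub>M ?M))"
    using P.integral_fst'[OF ii] by simp
  also have "\<dots> = (\<integral>z. (\<Prod>i\<in>I. f (?X i (fst z)) * f (?X i (snd z))) \<partial>(?M \<Otimes>\<^sub>M ?M))"
    by (rule double_rotation_prod[OF jointly_gaussian_linear[OF K I], where f="\<lambda>_. f", symmetric]) auto
  also have "\<dots> = (\<integral>z. (\<Prod>i\<in>I. f (?X i (fst z))) * (\<Prod>i\<in>I. f (?X i (snd z))) \<partial>(?M \<Otimes>\<^sub>M ?M))"
    by (simp add: prod.distrib)
  also have "\<dots> = (\<integral>z. (\<Prod>i\<in>I. f (?X i z)) \<partial>?M) * (\<integral>z. (\<Prod>i\<in>I. f (?X i z)) \<partial>?M)"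
    by (rule integral_pair_mult[OF prob_space_gauss_vec prob_space_gauss_vec, where f="\<lambda>z. \<Prod>i\<in>I. f (?X i z)" and h="\<lambda>z. \<Prod>i\<in>I. f (?X i z)"])
      (use f0 f1 in \<open>auto simp: abs_prod intro!: prod_le_1\<close>)
  finally show ?thesis by (simp add: power2_eq_square)
qed

section \<open>Moments of the doubled weight\<close>

lemma integral_pair_mult_integrable:
  fixes f :: "'b \<Rightarrow> real" and h :: "'c \<Rightarrow> real"
  assumes M: "prob_space M" and N: "prob_space N" and f: "integrable M f" and h: "integrable N h"
  shows "integrable (M \<Otimes>\<^sub>M N) (\<lambda>z. f (fst z) * h (snd z))"
    and "(\<integral>z. f (fst z) * h (snd z) \<partial>(M \<Otimes>\<^sub>M N)) = (\<integral>x. f x \<partial>M) * (\<integral>y. h y \<partial>N)"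
proof -
  interpret M: prob_space M by fact
  interpret N: prob_space N by fact
  interpret pair_prob_space M N ..
  have [measurable]: "f \<in> borel_measurable M" "h \<in> borel_measurable N" using f h by auto
  show i: "integrable (M \<Otimes>\<^sub>M N) (\<lambda>z. f (fst z) * h (snd z))"
    by (rule Fubini_integrable) (use f h in \<open>auto simp: abs_mult\<close>)
  show "(\<integral>z. f (fst z) * h (snd z) \<partial>(M \<Otimes>\<^sub>M N)) = (\<integral>x. f x \<partial>M) * (\<integral>y. h y \<partial>N)"
    using integral_fst'[OF i] by simp
qed

lemma jointly_gaussian_id: "jointly_gaussian gauss {()} (\<lambda>_ x. x) (\<lambda>_ _. 1)"
  unfolding jointly_gaussian_def using prob_space_gauss integral_iexp_gauss
  by (simp add: power2_eq_square)

text \<open>Rotation carries \<open>(fst z + snd z) / sqrt 2\<close> to a coordinate, and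
  integrating out the other coordinate produces \<open>gauss_double f\<close>. Thus doubling
  describes the normalized sum of two independent variables, each weighted by
  \<open>f\<close>.\<close>

lemma gauss_double_moment:
  fixes \<phi> :: "real \<Rightarrow> real"
  assumes f: "mono_log_concave f" and \<phi>: "integrable gauss \<phi>"
  shows "(\<integral>y. gauss_double f y * \<phi> y \<partial>gauss) =
    (\<integral>z. f (fst z) * f (snd z) * \<phi> ((fst z + snd z) / sqrt 2) \<partial>(gauss \<Otimes>\<^sub>M gauss))"
proof -
  have [measurable]: "f \<in> borel_measurable borel" and f0: "\<And>x. 0 \<le> f x" and f1: "\<And>x. f x \<le> 1"
    using f by (auto simp: mono_log_concave_def)
  have "\<phi> \<in> borel_measurable gauss" using \<phi> by auto
  then have [measurable]: "\<phi> \<in> borel_measurable borel" by simp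
  interpret N: prob_space gauss by (rule prob_space_gauss)
  interpret P: pair_prob_space gauss gauss ..
  have F: "0 \<le> f a * f b" "f a * f b \<le> 1" for a b
    using f0 f1 by (auto intro: mult_le_one)
  have c: "(1 / sqrt 2)\<^sup>2 + (- 1 / sqrt 2)\<^sup>2 = (1::real)" by (simp add: power_divide)
  \<comment> \<open>The factor \<open>\<phi>\<close> mixes the two coordinates, so the comparison is
    made for a function of the whole family rather than for a product.\<close>
  define g :: "(unit \<times> bool \<Rightarrow> real) \<Rightarrow> real" where
    "g z = f (z ((), True)) * f (z ((), False)) * \<phi> ((z ((), True) + z ((), False)) / sqrt 2)" for z
  have [measurable]: "g \<in> borel_measurable (\<Pi>\<^sub>M i\<in>{()} \<times> UNIV. borel)"
    unfolding g_def by measurable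
  have "(\<integral>z. g (\<lambda>x\<in>{()} \<times> UNIV. (\<lambda>(i, b) z. if b then 1 * fst z + 0 * snd z else 1 * snd z - 0 * fst z) x z) \<partial>(gauss \<Otimes>\<^sub>M gauss))
    = (\<integral>z. g (\<lambda>x\<in>{()} \<times> UNIV. (\<lambda>(i, b) z. if b then (1 / sqrt 2) * fst z + (- 1 / sqrt 2) * snd z else (1 / sqrt 2) * snd z - (- 1 / sqrt 2) * fst z) x z) \<partial>(gauss \<Otimes>\<^sub>M gauss))"
    by (rule jointly_gaussian_expectation[OF jointly_gaussian_two_copies[OF jointly_gaussian_id, of 1 0] jointly_gaussian_two_copies[OF jointly_gaussian_id c], where g=g]) auto
  also have "\<dots> = (\<integral>z. f ((fst z - snd z) / sqrt 2) * f ((fst z + snd z) / sqrt 2) * \<phi> (fst z) \<partial>(gauss \<Otimes>\<^sub>M gauss))"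
  proof (rule Bochner_Integration.integral_cong[OF refl])
    fix z :: "real \<times> real"
    have "((fst z - snd z) / sqrt 2 + (fst z + snd z) / sqrt 2) / sqrt 2 = fst z"
      by (simp add: field_simps)
    moreover have "1 / sqrt 2 * fst z + (- 1 / sqrt 2) * snd z = (fst z - snd z) / sqrt 2"
      "1 / sqrt 2 * snd z - (- 1 / sqrt 2) * fst z = (fst z + snd z) / sqrt 2"
      by (simp_all add: field_simps)
    ultimately show "g (\<lambda>x\<in>{()} \<times> UNIV. (\<lambda>(i, b) z. if b then (1 / sqrt 2) * fst z + (- 1 / sqrt 2) * snd z else (1 / sqrt 2) * snd z - (- 1 / sqrt 2) * fst z) x z)
      = f ((fst z - snd z) / sqrt 2) * f ((fst z + snd z) / sqrt 2) * \<phi> (fst z)"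
      by (simp add: g_def)
  qed
  also have "\<dots> = (\<integral>y. (\<integral>x. f ((y - x) / sqrt 2) * f ((y + x) / sqrt 2) * \<phi> y \<partial>gauss) \<partial>gauss)"
  proof -
    have "integrable (gauss \<Otimes>\<^sub>M gauss) (\<lambda>z. \<phi> (fst z))"
      using integral_pair_mult_integrable(1)[OF prob_space_gauss prob_space_gauss \<phi>, of "\<lambda>_. 1"] by simp
    then have "integrable (gauss \<Otimes>\<^sub>M gauss) (\<lambda>z. f ((fst z - snd z) / sqrt 2) * f ((fst z + snd z) / sqrt 2) * \<phi> (fst z))"
    proof (rule Bochner_Integration.integrable_bound)
      show "AE z in gauss \<Otimes>\<^sub>M gauss. norm (f ((fst z - snd z) / sqrt 2) * f ((fst z + snd z) / sqrt 2) * \<phi> (fst z)) \<le> norm (\<phi> (fst z))"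
        using F by (auto simp: abs_mult[of "_ * _"] intro!: mult_left_le_one_le)
    qed measurable
    from P.integral_fst'[OF this] show ?thesis by simp
  qed
  also have "\<dots> = (\<integral>y. gauss_double f y * \<phi> y \<partial>gauss)"
    by (simp add: gauss_double_def)
  finally show ?thesis by (simp add: g_def)
qed

lemma integrable_gauss_moments:
  "integrable gauss (\<lambda>x. x)" "integrable gauss (\<lambda>x. x\<^sup>2)" "integrable gauss (\<lambda>x. c)"
  using integrable_std_normal_distribution_moment[of 1] integrable_std_normal_distribution_moment[of 2]
    finite_measure.integrable_const[OF prob_space.finite_measure[OF prob_space_gauss]]
  by auto

lemma integrable_bounded_mult:
  fixes f g :: "'b \<Rightarrow> real"
  assumes [measurable]: "f \<in> borel_measurable M" and f: "\<And>x. 0 \<le> f x" "\<And>x. f x \<le> 1" and g: "integrable M g"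
  shows "integrable M (\<lambda>x. f x * g x)"
  using g
proof (rule Bochner_Integration.integrable_bound)
  show "AE x in M. norm (f x * g x) \<le> norm (g x)"
    using f by (auto simp: abs_mult intro!: mult_left_le_one_le)
qed (use g in measurable)

lemma gauss_double_moments:
  assumes f: "mono_log_concave f"
  shows "(\<integral>y. gauss_double f y \<partial>gauss) = (\<integral>x. f x \<partial>gauss)\<^sup>2"
    and "(\<integral>y. gauss_double f y * y \<partial>gauss) = sqrt 2 * (\<integral>x. f x * x \<partial>gauss) * (\<integral>x. f x \<partial>gauss)"
    and "(\<integral>y. gauss_double f y * y\<^sup>2 \<partial>gauss) = (\<integral>x. f x * x\<^sup>2 \<partial>gauss) * (\<integral>x. f x \<partial>gauss) + (\<integral>x. f x * x \<partial>gauss)\<^sup>2"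
proof -
  have [measurable]: "f \<in> borel_measurable borel" and f0: "\<And>x. 0 \<le> f x" and f1: "\<And>x. f x \<le> 1"
    using f by (auto simp: mono_log_concave_def)
  have i: "integrable gauss (\<lambda>x. f x * x)" "integrable gauss (\<lambda>x. f x * x\<^sup>2)" "integrable gauss f"
    using integrable_bounded_mult[of f gauss, OF _ f0 f1 integrable_gauss_moments(1)]
      integrable_bounded_mult[of f gauss, OF _ f0 f1 integrable_gauss_moments(2)]
      integrable_bounded_mult[of f gauss, OF _ f0 f1 integrable_gauss_moments(3)[of 1]] by auto
  note P = integral_pair_mult_integrable[OF prob_space_gauss prob_space_gauss]
  show "(\<integral>y. gauss_double f y \<partial>gauss) = (\<integral>x. f x \<partial>gauss)\<^sup>2"
    using gauss_double_moment[OF f integrable_gauss_moments(3)[of 1]] P(2)[OF i(3) i(3)]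
    by (simp add: power2_eq_square)
  have "(\<integral>y. gauss_double f y * y \<partial>gauss)
     = (\<integral>z. (1 / sqrt 2) * ((f (fst z) * fst z) * f (snd z) + f (fst z) * (f (snd z) * snd z)) \<partial>(gauss \<Otimes>\<^sub>M gauss))"
    unfolding gauss_double_moment[OF f integrable_gauss_moments(1)]
    by (rule Bochner_Integration.integral_cong) (auto simp: field_simps)
  also have "\<dots> = (1 / sqrt 2) * (2 * ((\<integral>x. f x * x \<partial>gauss) * (\<integral>x. f x \<partial>gauss)))"
    using P[OF i(1) i(3)] P[OF i(3) i(1)] by simp
  also have "\<dots> = sqrt 2 * (\<integral>x. f x * x \<partial>gauss) * (\<integral>x. f x \<partial>gauss)"
    using real_sqrt_mult_self[of 2] by (simp add: field_simps)
  finally show "(\<integral>y. gauss_double f y * y \<partial>gauss) = sqrt 2 * (\<integral>x. f x * x \<partial>gauss) * (\<integral>x. f x \<partial>gauss)" .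
  have "(\<integral>y. gauss_double f y * y\<^sup>2 \<partial>gauss)
     = (\<integral>z. (1 / 2) * ((f (fst z) * (fst z)\<^sup>2) * f (snd z) + f (fst z) * (f (snd z) * (snd z)\<^sup>2))
        + (f (fst z) * fst z) * (f (snd z) * snd z) \<partial>(gauss \<Otimes>\<^sub>M gauss))"
    unfolding gauss_double_moment[OF f integrable_gauss_moments(2)]
    by (rule Bochner_Integration.integral_cong) (auto simp: power_divide power2_eq_square field_simps)
  also have "\<dots> = (\<integral>x. f x * x\<^sup>2 \<partial>gauss) * (\<integral>x. f x \<partial>gauss) + (\<integral>x. f x * x \<partial>gauss)\<^sup>2"
    using P[OF i(2) i(3)] P[OF i(3) i(2)] P[OF i(1) i(1)] by (simp add: power2_eq_square)
  finally show "(\<integral>y. gauss_double f y * y\<^sup>2 \<partial>gauss) = (\<integral>x. f x * x\<^sup>2 \<partial>gauss) * (\<integral>x. f x \<partial>gauss) + (\<integral>x. f x * x \<partial>gauss)\<^sup>2" .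
qed

text \<open>For positive \<open>p\<close>, \<open>m\<close> and \<open>s\<close> are the first two
  moments of the normalized weight. A step passes to the normalized sum of two independent copies:
  the mean grows by the factor \<open>sqrt 2\<close>, while the variance stays
  \<open>s - m\<^sup>2\<close>, since
  \<open>s + (N - 1) * m\<^sup>2 = N * m\<^sup>2 + (s - m\<^sup>2)\<close>.\<close>

lemma gauss_double_iterate:
  assumes f: "mono_log_concave f"
    and p: "p = (\<integral>x. f x \<partial>gauss)" and m: "(\<integral>x. f x * x \<partial>gauss) = m * p" and s: "(\<integral>x. f x * x\<^sup>2 \<partial>gauss) = s * p"
  defines "N \<equiv> \<lambda>k::nat. (2::nat) ^ k"
  shows "mono_log_concave ((gauss_double ^^ k) f)"
    and "(\<integral>x. (gauss_double ^^ k) f x \<partial>gauss) = p ^ N k"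
    and "(\<integral>x. (gauss_double ^^ k) f x * x \<partial>gauss) = sqrt (N k) * m * p ^ N k"
    and "(\<integral>x. (gauss_double ^^ k) f x * x\<^sup>2 \<partial>gauss) = (s + (real (N k) - 1) * m\<^sup>2) * p ^ N k"
proof -
  have "mono_log_concave ((gauss_double ^^ k) f) \<and>
    (\<integral>x. (gauss_double ^^ k) f x \<partial>gauss) = p ^ N k \<and>
    (\<integral>x. (gauss_double ^^ k) f x * x \<partial>gauss) = sqrt (N k) * m * p ^ N k \<and>
    (\<integral>x. (gauss_double ^^ k) f x * x\<^sup>2 \<partial>gauss) = (s + (real (N k) - 1) * m\<^sup>2) * p ^ N k"
  proof (induction k)
    case 0
    then show ?case using f p m s by (simp add: N_def)
  next
    case (Suc k)
    define g where "g = (gauss_double ^^ k) f"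
    have g: "mono_log_concave g" "(\<integral>x. g x \<partial>gauss) = p ^ N k"
      "(\<integral>x. g x * x \<partial>gauss) = sqrt (N k) * m * p ^ N k" "(\<integral>x. g x * x\<^sup>2 \<partial>gauss) = (s + (real (N k) - 1) * m\<^sup>2) * p ^ N k"
      using Suc by (auto simp: g_def)
    have G: "(gauss_double ^^ Suc k) f = gauss_double g" by (simp add: g_def)
    have NS: "N (Suc k) = 2 * N k" by (simp add: N_def)
    have pp: "p ^ N (Suc k) = p ^ N k * p ^ N k" by (simp add: NS mult_2 power_add)
    show ?case unfolding G gauss_double_moments[OF g(1)] g(2-4)
    proof (intro conjI)
      show "mono_log_concave (gauss_double g)" by (rule mono_log_concave_double[OF g(1)])
      show "(p ^ N k)\<^sup>2 = p ^ N (Suc k)" by (simp add: pp power2_eq_square)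
      show "sqrt 2 * (sqrt (real (N k)) * m * p ^ N k) * p ^ N k = sqrt (real (N (Suc k))) * m * p ^ N (Suc k)"
        unfolding pp by (simp add: NS real_sqrt_mult)
      show "(s + (real (N k) - 1) * m\<^sup>2) * p ^ N k * p ^ N k + (sqrt (real (N k)) * m * p ^ N k)\<^sup>2
        = (s + (real (N (Suc k)) - 1) * m\<^sup>2) * p ^ N (Suc k)"
        unfolding pp power_mult_distrib by (simp add: NS power2_eq_square algebra_simps)
    qed
  qed
  then show "mono_log_concave ((gauss_double ^^ k) f)"
    "(\<integral>x. (gauss_double ^^ k) f x \<partial>gauss) = p ^ N k"
    "(\<integral>x. (gauss_double ^^ k) f x * x \<partial>gauss) = sqrt (N k) * m * p ^ N k"
    "(\<integral>x. (gauss_double ^^ k) f x * x\<^sup>2 \<partial>gauss) = (s + (real (N k) - 1) * m\<^sup>2) * p ^ N k" by blast+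
qed


section \<open>Gaussian estimates for intervals and orthants\<close>

lemma integral_indicator_gauss:
  assumes [measurable]: "A \<in> sets borel"
  shows "(\<integral>x. indicator A x \<partial>gauss) = (\<integral>x. indicator A x * std_normal_density x \<partial>lborel)"
  by (subst integral_density) (auto simp: mult.commute)

lemma gauss_Ioo_le:
  assumes c: "0 < c"
  shows "(\<integral>x. indicator {M - c<..<M + c} x \<partial>gauss) \<le> 2 * c * exp (- M\<^sup>2 / 2 + \<bar>M\<bar> * c)"
proof -
  have "(\<integral>x. indicator {M - c<..<M + c} x \<partial>gauss)
    \<le> (\<integral>x. indicator {M - c<..<M + c} x * exp (- M\<^sup>2 / 2 + \<bar>M\<bar> * c) \<partial>lborel)"
    unfolding integral_indicator_gauss[OF borel_open[OF open_greaterThanLessThan]]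
  proof (rule integral_mono)
    show "integrable lborel (\<lambda>x. indicator {M - c<..<M + c} x * std_normal_density x)"
      using integrable_real_mult_indicator[of "{M - c<..<M + c}" lborel std_normal_density]
        integrable_std_normal_moment[of 0] by (simp add: mult.commute)
    show "integrable lborel (\<lambda>x. indicator {M - c<..<M + c} x * exp (- M\<^sup>2 / 2 + \<bar>M\<bar> * c))"
      using c by (intro integrable_mult_left integrable_real_indicator) auto
    fix x :: real
    show "indicator {M - c<..<M + c} x * std_normal_density x \<le> indicator {M - c<..<M + c} x * exp (- M\<^sup>2 / 2 + \<bar>M\<bar> * c)"
    proof (cases "x \<in> {M - c<..<M + c}")
      case True
      then have "\<bar>M - x\<bar> \<le> c" by auto
      then have "\<bar>M\<bar> * \<bar>M - x\<bar> \<le> \<bar>M\<bar> * c" by (rule mult_left_mono) auto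
      then have "M * (M - x) \<le> \<bar>M\<bar> * c" by (metis abs_ge_self abs_mult order_trans)
      moreover have "x\<^sup>2 - M\<^sup>2 + 2 * (M * (M - x)) = (x - M)\<^sup>2" by (simp add: power2_eq_square algebra_simps)
      ultimately have "- x\<^sup>2 / 2 \<le> - M\<^sup>2 / 2 + \<bar>M\<bar> * c" using zero_le_power2[of "x - M"] by linarith
      then have "std_normal_density x \<le> exp (- M\<^sup>2 / 2 + \<bar>M\<bar> * c)"
        using std_normal_density_le_exp[of x] by (meson exp_le_cancel_iff order_trans)
      then show ?thesis using True by simp
    qed simp
  qed
  also have "\<dots> = 2 * c * exp (- M\<^sup>2 / 2 + \<bar>M\<bar> * c)" using c by simp
  finally show ?thesis .
qed

text \<open>Only the unit interval to the right of \<open>t\<close> is kept, where the density is at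
  least its value at \<open>|t| + 1\<close>.\<close>

lemma gauss_Ici_ge: "(1 / sqrt (2 * pi)) * exp (- (\<bar>t\<bar> + 1)\<^sup>2 / 2) \<le> (\<integral>x. indicator {t..} x \<partial>gauss)"
proof -
  have "(1 / sqrt (2 * pi)) * exp (- (\<bar>t\<bar> + 1)\<^sup>2 / 2) = (\<integral>x. indicator {t..t+1} x * ((1 / sqrt (2 * pi)) * exp (- (\<bar>t\<bar> + 1)\<^sup>2 / 2)) \<partial>lborel)"
    by simp
  also have "\<dots> \<le> (\<integral>x. indicator {t..} x * std_normal_density x \<partial>lborel)"
  proof (rule integral_mono)
    show "integrable lborel (\<lambda>x. indicator {t..} x * std_normal_density x)"
      using integrable_real_mult_indicator[of "{t..}" lborel std_normal_density]
        integrable_std_normal_moment[of 0] by (simp add: mult.commute)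
    show "integrable lborel (\<lambda>x. indicator {t..t+1} x * ((1 / sqrt (2 * pi)) * exp (- (\<bar>t\<bar> + 1)\<^sup>2 / 2)))"
      by (intro integrable_mult_left integrable_real_indicator) auto
    fix x :: real
    show "indicator {t..t+1} x * ((1 / sqrt (2 * pi)) * exp (- (\<bar>t\<bar> + 1)\<^sup>2 / 2)) \<le> indicator {t..} x * std_normal_density x"
    proof (cases "x \<in> {t..t+1}")
      case True
      then have "\<bar>x\<bar> \<le> \<bar>t\<bar> + 1" by auto
      then have "x\<^sup>2 \<le> (\<bar>t\<bar> + 1)\<^sup>2" by (metis abs_ge_zero power2_abs power_mono)
      then have "exp (- (\<bar>t\<bar> + 1)\<^sup>2 / 2) \<le> exp (- x\<^sup>2 / 2)" by simp
      then have "(1 / sqrt (2 * pi)) * exp (- (\<bar>t\<bar> + 1)\<^sup>2 / 2) \<le> std_normal_density x"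
        unfolding std_normal_density_def by (rule mult_left_mono) auto
      then show ?thesis using True by simp
    qed simp
  qed
  finally show ?thesis by (subst integral_indicator_gauss) auto
qed

text \<open>Let \<open>d\<close> be \<open>card I\<close>. Row sums \<open>1\<close> give the
  average of the coordinates variance \<open>1 / d\<close> and make it uncorrelated with the
  deviations from it. So the coordinates are \<open>G / sqrt d\<close> plus deviations; the latter
  stay above some \<open>- n\<close> with positive probability, and then
  \<open>G \<ge> sqrt d * (t + n)\<close> suffices. The cost has leading term
  \<open>d * t\<^sup>2 / 2\<close>, as for independent coordinates.\<close>

lemma orthant_tail_lower:
  fixes a :: "'i \<Rightarrow> 'k \<Rightarrow> real"
  assumes K: "finite K" and I: "finite I" "I \<noteq> {}"
    and row: "\<And>i. i \<in> I \<Longrightarrow> (\<Sum>j\<in>I. \<Sum>k\<in>K. a i k * a j k) = 1"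
  obtains q D where "0 < q" "0 \<le> D"
    "\<And>t. q * exp (- (sqrt (card I) * \<bar>t\<bar> + D)\<^sup>2 / 2) \<le> (\<integral>z. (\<Prod>i\<in>I. indicator {t..} (\<Sum>k\<in>K. a i k * z k)) \<partial>gauss_vec K)"
proof -
  let ?M = "gauss_vec K"
  interpret N: prob_space gauss by (rule prob_space_gauss)
  interpret G: prob_space ?M by (rule prob_space_gauss_vec)
  interpret P: pair_prob_space gauss ?M ..
  define d where "d = real (card I)"
  have d: "d > 0" using I by (simp add: d_def card_gt_0_iff)
  define mean where "mean k = (\<Sum>i\<in>I. a i k) / d" for k
  define b where "b i k = a i k - mean k" for i k
  let ?W = "\<lambda>i z. \<Sum>k\<in>K. b i k * z k"
  have am: "(\<Sum>k\<in>K. a i k * mean k) = 1 / d" if "i \<in> I" for i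
  proof -
    have "(\<Sum>k\<in>K. a i k * mean k) = (\<Sum>k\<in>K. \<Sum>j\<in>I. a i k * a j k) / d"
      by (simp add: mean_def sum_divide_distrib sum_distrib_left)
    also have "\<dots> = (\<Sum>j\<in>I. \<Sum>k\<in>K. a i k * a j k) / d" by (subst sum.swap) simp
    finally show ?thesis using row[OF that] by simp
  qed
  have mm: "(\<Sum>k\<in>K. mean k * mean k) = 1 / d"
  proof -
    have "(\<Sum>k\<in>K. mean k * mean k) = (\<Sum>k\<in>K. \<Sum>i\<in>I. a i k * mean k) / d"
      by (simp add: mean_def[of _] sum_divide_distrib sum_distrib_right)
    also have "\<dots> = (\<Sum>i\<in>I. \<Sum>k\<in>K. a i k * mean k) / d" by (subst sum.swap) simp
    also have "\<dots> = 1 / d" using am d by (simp add: d_def)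
    finally show ?thesis .
  qed
  have cov: "(\<Sum>k\<in>K. a i k * a j k) = (1 / sqrt d) * (1 / sqrt d) + (\<Sum>k\<in>K. b i k * b j k)" if "i \<in> I" "j \<in> I" for i j
  proof -
    have "(\<Sum>k\<in>K. b i k * b j k) = (\<Sum>k\<in>K. a i k * a j k) - (\<Sum>k\<in>K. a i k * mean k) - (\<Sum>k\<in>K. a j k * mean k) + (\<Sum>k\<in>K. mean k * mean k)"
      unfolding sum.distrib[symmetric] sum_subtractf[symmetric] by (rule sum.cong) (auto simp: b_def algebra_simps)
    then show ?thesis using am that mm d by simp
  qed
  \<comment> \<open>These events exhaust the whole space, so one of them has positive probability,
    even if the deviations are degenerate.\<close>
  define A where "A n = {z \<in> space ?M. \<forall>i\<in>I. - real n \<le> ?W i z}" for n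
  have [measurable]: "A n \<in> sets ?M" for n unfolding A_def using I by measurable
  have "\<exists>n. G.prob (A n) > 0"
  proof (rule ccontr)
    assume "\<not> ?thesis"
    then have "A n \<in> null_sets ?M" for n
      by (auto simp: G.emeasure_eq_measure measure_le_0_iff not_less intro!: null_setsI)
    then have "(\<Union>n. A n) \<in> null_sets ?M" by (rule null_sets_UN)
    moreover have "(\<Union>n. A n) = space ?M"
    proof (intro equalityI subsetI)
      fix z assume z: "z \<in> space ?M"
      obtain n where n: "(\<Sum>i\<in>I. \<bar>?W i z\<bar>) \<le> real n" using real_arch_simple by blast
      have "- real n \<le> ?W i z" if "i \<in> I" for i
        using member_le_sum[OF that, of "\<lambda>i. \<bar>?W i z\<bar>"] I n by fastforce
      then show "z \<in> (\<Union>n. A n)" using z by (auto simp: A_def)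
    qed (auto simp: A_def)
    ultimately show False using G.emeasure_space_1 by auto
  qed
  then obtain n where n: "G.prob (A n) > 0" by blast
  let ?q = "1 / sqrt (2 * pi) * G.prob (A n)" and ?D = "sqrt d * real n + 1"
  show thesis
  proof (rule that)
    show "0 < ?q" using n by simp
    show "0 \<le> ?D" using d by simp
    fix t
    let ?t = "sqrt d * (t + real n)"
    have "\<bar>?t\<bar> + 1 \<le> sqrt d * \<bar>t\<bar> + ?D"
    proof -
      have "\<bar>?t\<bar> = sqrt d * \<bar>t + real n\<bar>" using d by (simp add: abs_mult)
      also have "\<dots> \<le> sqrt d * (\<bar>t\<bar> + real n)" using d by (intro mult_left_mono) auto
      finally show ?thesis by (simp add: algebra_simps)
    qed
    then have "(\<bar>?t\<bar> + 1)\<^sup>2 \<le> (sqrt d * \<bar>t\<bar> + ?D)\<^sup>2" by (intro power_mono) auto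
    then have "?q * exp (- (sqrt d * \<bar>t\<bar> + ?D)\<^sup>2 / 2) \<le> ?q * exp (- (\<bar>?t\<bar> + 1)\<^sup>2 / 2)"
      using n by (intro mult_left_mono) auto
    also have "\<dots> \<le> (\<integral>x. indicator {?t..} x \<partial>gauss) * G.prob (A n)"
      using mult_right_mono[OF gauss_Ici_ge[of ?t], of "G.prob (A n)"] by (simp add: mult_ac)
    also have "\<dots> = (\<integral>x. indicator {?t..} x \<partial>gauss) * (\<integral>z. indicator (A n) z \<partial>?M)"
      by simp
    also have "\<dots> = (\<integral>z. indicator {?t..} (fst z) * indicator (A n) (snd z) \<partial>(gauss \<Otimes>\<^sub>M ?M))"
      by (rule integral_pair_mult[OF prob_space_gauss prob_space_gauss_vec, symmetric]) (auto simp: indicator_def)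
    also have "\<dots> \<le> (\<integral>z. (\<Prod>i\<in>I. indicator {t..} ((1 / sqrt d) * fst z + ?W i (snd z))) \<partial>(gauss \<Otimes>\<^sub>M ?M))"
    proof (intro integral_mono P.integrable_const_bound[where B=1])
      fix z
      show "indicator {?t..} (fst z) * indicator (A n) (snd z) \<le> (\<Prod>i\<in>I. indicator {t..} ((1 / sqrt d) * fst z + ?W i (snd z)) :: real)"
      proof (cases "?t \<le> fst z \<and> snd z \<in> A n")
        case True
        then have "t + real n \<le> fst z / sqrt d" using d by (simp add: field_simps)
        then have "t \<le> (1 / sqrt d) * fst z + ?W i (snd z)" if "i \<in> I" for i
          using True that by (force simp: A_def)
        then have "(\<Prod>i\<in>I. indicator {t..} ((1 / sqrt d) * fst z + ?W i (snd z)) :: real) = (\<Prod>i\<in>I. 1)"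
          by (intro prod.cong) auto
        then show ?thesis by (simp add: indicator_def)
      qed (auto intro!: prod_nonneg simp: indicator_def)
    qed (auto simp: indicator_def abs_prod intro!: prod_le_1 always_eventually)
    also have "\<dots> = (\<integral>z. (\<Prod>i\<in>I. indicator {t..} (\<Sum>k\<in>K. a i k * z k)) \<partial>?M)"
      by (rule jointly_gaussian_prod[OF jointly_gaussian_linear[OF K I(1), of a]
          jointly_gaussian_common[OF jointly_gaussian_linear[OF K I(1), of b], of "\<lambda>_. 1 / sqrt d"], where f="\<lambda>_. indicator {t..}", symmetric])
        (use cov in auto)
    finally show "?q * exp (- (sqrt (card I) * \<bar>t\<bar> + ?D)\<^sup>2 / 2) \<le> (\<integral>z. (\<Prod>i\<in>I. indicator {t..} (\<Sum>k\<in>K. a i k * z k)) \<partial>?M)"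
      by (simp add: d_def)
  qed
qed

section \<open>The product lower bound\<close>

text \<open>Chebyshev's inequality for the weight \<open>f\<close>, whose normalized mean is
  \<open>M\<close> and variance \<open>v\<close>: at least half the mass lies within
  \<open>c\<close> of \<open>M\<close>, where monotonicity bounds \<open>f\<close> by
  \<open>f (M + c)\<close>. The Gaussian measure of this interval is small by
  \<open>gauss_Ioo_le\<close>, so that value must be large.\<close>

lemma mono_log_concave_lower:
  assumes f: "mono_log_concave f" and c: "0 < c"
    and p: "(\<integral>x. f x \<partial>gauss) = P" and m: "(\<integral>x. f x * x \<partial>gauss) = M * P"
    and v: "(\<integral>x. f x * x\<^sup>2 \<partial>gauss) = (M\<^sup>2 + v) * P" and P: "0 \<le> P" and vc: "2 * v \<le> c\<^sup>2"
  shows "P * exp (M\<^sup>2 / 2 - \<bar>M\<bar> * c) / (4 * c) \<le> f (M + c)"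
proof -
  have [measurable]: "f \<in> borel_measurable borel" and f0: "\<And>x. 0 \<le> f x" and f1: "\<And>x. f x \<le> 1" and mono: "mono f"
    using f by (auto simp: mono_log_concave_def)
  have i: "integrable gauss (\<lambda>x. f x * x)" "integrable gauss (\<lambda>x. f x * x\<^sup>2)" "integrable gauss f"
    using integrable_bounded_mult[of f gauss, OF _ f0 f1 integrable_gauss_moments(1)]
      integrable_bounded_mult[of f gauss, OF _ f0 f1 integrable_gauss_moments(2)]
      integrable_bounded_mult[of f gauss, OF _ f0 f1 integrable_gauss_moments(3)[of 1]] by auto
  define e where "e = exp (M\<^sup>2 / 2 - \<bar>M\<bar> * c)"
  \<comment> \<open>The function \<open>1 - (x - M)\<^sup>2 / c\<^sup>2\<close> is at most the
    indicator of the interval and has an explicit integral against \<open>f\<close>.\<close>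
  have "P * (1 - v / c\<^sup>2) = (\<integral>x. (1 - M\<^sup>2 / c\<^sup>2) * f x + (2 * M / c\<^sup>2) * (f x * x) - (1 / c\<^sup>2) * (f x * x\<^sup>2) \<partial>gauss)"
  proof -
    have "(\<integral>x. (1 - M\<^sup>2 / c\<^sup>2) * f x + (2 * M / c\<^sup>2) * (f x * x) - (1 / c\<^sup>2) * (f x * x\<^sup>2) \<partial>gauss)
      = (1 - M\<^sup>2 / c\<^sup>2) * P + (2 * M / c\<^sup>2) * (M * P) - (1 / c\<^sup>2) * ((M\<^sup>2 + v) * P)"
      by (simp only: Bochner_Integration.integral_add Bochner_Integration.integral_diff
          Bochner_Integration.integrable_add integrable_mult_right i integral_mult_right_zero p m v)
    also have "\<dots> = P * (1 - v / c\<^sup>2)" using c by (simp add: field_simps power2_eq_square)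
    finally show ?thesis by simp
  qed
  also have "\<dots> = (\<integral>x. f x * (1 - (x - M)\<^sup>2 / c\<^sup>2) \<partial>gauss)"
    using c by (intro Bochner_Integration.integral_cong) (auto simp: field_simps power2_eq_square)
  also have "\<dots> \<le> (\<integral>x. f (M + c) * indicator {M - c<..<M + c} x \<partial>gauss)"
  proof (rule integral_mono)
    have "integrable gauss (\<lambda>x. (1 - M\<^sup>2 / c\<^sup>2) * f x + (2 * M / c\<^sup>2) * (f x * x) - (1 / c\<^sup>2) * (f x * x\<^sup>2))"
      using i by simp
    also have "(\<lambda>x. (1 - M\<^sup>2 / c\<^sup>2) * f x + (2 * M / c\<^sup>2) * (f x * x) - (1 / c\<^sup>2) * (f x * x\<^sup>2)) = (\<lambda>x. f x * (1 - (x - M)\<^sup>2 / c\<^sup>2))"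
      using c by (auto simp: field_simps power2_eq_square)
    finally show "integrable gauss (\<lambda>x. f x * (1 - (x - M)\<^sup>2 / c\<^sup>2))" .
    show "integrable gauss (\<lambda>x. f (M + c) * indicator {M - c<..<M + c} x)"
      by (rule finite_measure.integrable_const_bound[OF prob_space.finite_measure[OF prob_space_gauss], where B=1])
        (use f0 f1 in \<open>auto simp: indicator_def\<close>)
    fix x
    show "f x * (1 - (x - M)\<^sup>2 / c\<^sup>2) \<le> f (M + c) * indicator {M - c<..<M + c} x"
    proof (cases "x \<in> {M - c<..<M + c}")
      case True
      have "f x * (1 - (x - M)\<^sup>2 / c\<^sup>2) \<le> f x * 1" using f0 by (intro mult_left_mono) auto
      also have "\<dots> \<le> f (M + c)" using True by (auto intro!: monoD[OF mono])
      finally show ?thesis using True by simp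
    next
      case False
      then have "c \<le> \<bar>x - M\<bar>" by auto
      then have "c\<^sup>2 \<le> (x - M)\<^sup>2" using c by (metis less_imp_le power2_abs power_mono)
      then have "1 - (x - M)\<^sup>2 / c\<^sup>2 \<le> 0" using c by simp
      then show ?thesis using f0[of x] False by (simp add: mult_nonneg_nonpos)
    qed
  qed
  also have "\<dots> = f (M + c) * (\<integral>x. indicator {M - c<..<M + c} x \<partial>gauss)" by simp
  also have "\<dots> \<le> f (M + c) * (2 * c * exp (- M\<^sup>2 / 2 + \<bar>M\<bar> * c))"
    by (rule mult_left_mono[OF gauss_Ioo_le[OF c] f0])
  also have "exp (- M\<^sup>2 / 2 + \<bar>M\<bar> * c) = 1 / e"
    using exp_minus[of "M\<^sup>2 / 2 - \<bar>M\<bar> * c"] by (simp add: e_def inverse_eq_divide)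
  finally have A: "P * (1 - v / c\<^sup>2) \<le> f (M + c) * (2 * c * (1 / e))" .
  have "1 / 2 \<le> 1 - v / c\<^sup>2" using vc c by (simp add: field_simps)
  then have "P * (1 / 2) \<le> P * (1 - v / c\<^sup>2)" using P by (rule mult_left_mono)
  then have "P * (1 / 2) \<le> f (M + c) * (2 * c * (1 / e))" using A by linarith
  then have "P * e \<le> f (M + c) * (4 * c)" using exp_gt_zero[of "M\<^sup>2 / 2 - \<bar>M\<bar> * c"] unfolding e_def[symmetric]
    by (simp add: field_simps)
  then show ?thesis unfolding e_def[symmetric] using c by (simp add: field_simps)
qed

text \<open>Taking roots of order \<open>2 ^ k\<close> turns the left-hand side into a quantity
  tending to \<open>1\<close>, because the exponent grows only like the square root of
  \<open>2 ^ k\<close>.\<close>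

lemma power_exp_sqrt_lower_imp_ge_1:
  assumes J: "0 \<le> J" and Q: "0 < Q" and L: "0 \<le> L"
    and le: "\<And>k::nat. Q * exp (- (L * sqrt (2 ^ k))) \<le> J ^ (2 ^ k)"
  shows "(1::real) \<le> J"
proof (rule ccontr)
  assume "\<not> 1 \<le> J"
  then have J1: "J < 1" by simp
  have "0 < Q * exp (- (L * sqrt (2 ^ 0)))" using Q by simp
  then have "J \<noteq> 0" using le[of 0] by auto
  then have J0: "0 < J" using J by simp
  define \<delta> where "\<delta> = - ln J"
  have \<delta>: "\<delta> > 0" using J0 J1 by (simp add: \<delta>_def)
  \<comment> \<open>For \<open>x\<close> above \<open>B\<close>, \<open>\<delta> * x\<close> exceeds
    \<open>L + \<bar>ln Q\<bar>\<close>, which contradicts the logarithm of the assumption.\<close>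
  define B where "B = (L + \<bar>ln Q\<bar>) / \<delta>"
  have B: "0 \<le> B" using L \<delta> by (simp add: B_def)
  obtain k where k: "B\<^sup>2 < 2 ^ k" using real_arch_pow[of 2 "B\<^sup>2"] by auto
  define x where "x = sqrt (2 ^ k)"
  have x1: "1 \<le> x" by (simp add: x_def)
  have xx: "x * x = 2 ^ k" by (simp add: x_def)
  have "B < x" using k B by (simp add: x_def real_less_rsqrt)
  then have Bx: "L + \<bar>ln Q\<bar> < \<delta> * x" using \<delta> by (simp add: B_def field_simps)
  have "ln (Q * exp (- (L * x))) \<le> ln (J ^ (2 ^ k))"
    using le[of k] Q J0 by (simp add: x_def)
  then have "ln Q - L * x \<le> (x * x) * ln J"
    using Q J0 by (simp add: ln_mult ln_realpow xx)
  then have "\<delta> * x * x \<le> L * x - ln Q" by (simp add: \<delta>_def mult_ac)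
  also have "\<dots> \<le> L * x + \<bar>ln Q\<bar> * x"
    using mult_left_mono[OF x1, of "\<bar>ln Q\<bar>"] by linarith
  also have "\<dots> = (L + \<bar>ln Q\<bar>) * x" by (simp add: algebra_simps)
  also have "\<dots> < \<delta> * x * x" using Bx x1 by (intro mult_strict_right_mono) auto
  finally show False by simp
qed

text \<open>After \<open>k\<close> doublings the expectation is bounded below on the event that all
  coordinates are at least \<open>M + c\<close>. There the factors \<open>F k\<close> contribute
  \<open>exp (d * M\<^sup>2 / 2)\<close> and the event costs
  \<open>exp (- d * M\<^sup>2 / 2)\<close>, up to terms linear in \<open>M\<close>; these two
  cancel, and taking roots removes the rest.\<close>

lemma gaussian_product_lower_bound:
  fixes a :: "'i \<Rightarrow> 'k \<Rightarrow> real"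
  assumes K: "finite K" and I: "finite I"
    and unit: "\<And>i. i \<in> I \<Longrightarrow> (\<Sum>k\<in>K. a i k * a i k) = 1"
    and row: "\<And>i. i \<in> I \<Longrightarrow> (\<Sum>j\<in>I. \<Sum>k\<in>K. a i k * a j k) = 1"
    and f: "mono_log_concave f" and pos: "0 < (\<integral>x. f x \<partial>gauss)"
  shows "(\<integral>x. f x \<partial>gauss) ^ card I \<le> (\<integral>z. (\<Prod>i\<in>I. f (\<Sum>k\<in>K. a i k * z k)) \<partial>gauss_vec K)"
proof (cases "I = {}")
  case True
  then show ?thesis by (simp add: prob_space.prob_space[OF prob_space_gauss_vec])
next
  case False
  define E where "E g = (\<integral>z. (\<Prod>i\<in>I. g (\<Sum>k\<in>K. a i k * z k)) \<partial>gauss_vec K)" for g :: "real \<Rightarrow> real"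
  define F where "F k = (gauss_double ^^ k) f" for k
  define p where "p = (\<integral>x. f x \<partial>gauss)"
  define m where "m = (\<integral>x. f x * x \<partial>gauss) / p"
  define s where "s = (\<integral>x. f x * x\<^sup>2 \<partial>gauss) / p"
  define d where "d = card I"
  interpret G: prob_space "gauss_vec K" by (rule prob_space_gauss_vec)
  have p: "0 < p" using pos by (simp add: p_def)
  note it = gauss_double_iterate[OF f p_def, of m s, folded F_def]
  have mp: "(\<integral>x. f x * x \<partial>gauss) = m * p" "(\<integral>x. f x * x\<^sup>2 \<partial>gauss) = s * p"
    using p by (auto simp: m_def s_def)
  note it = it[OF mp]
  have F: "F k \<in> borel_measurable borel" "0 \<le> F k x" "F k x \<le> 1" "mono (F k)" for k x
    using it(1)[of k] by (auto simp: mono_log_concave_def)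
  have E0: "0 \<le> E (F k)" for k
    unfolding E_def using F by (auto intro!: Bochner_Integration.integral_nonneg prod_nonneg)
  have chain: "E (F k) \<le> E f ^ (2 ^ k)" for k
  proof (induction k)
    case 0
    show ?case by (simp add: F_def)
  next
    case (Suc k)
    have "E (F (Suc k)) \<le> (E (F k))\<^sup>2"
      using gauss_double_correlation[OF it(1)[of k] K I unit] by (simp add: E_def F_def)
    also have "\<dots> \<le> (E f ^ (2 ^ k))\<^sup>2" using Suc E0 by (intro power_mono) auto
    finally show ?case by (simp add: power_mult[symmetric] mult.commute)
  qed
  obtain q D where q: "0 < q" and D: "0 \<le> D" and tail:
    "\<And>t. q * exp (- (sqrt d * \<bar>t\<bar> + D)\<^sup>2 / 2) \<le> (\<integral>z. (\<Prod>i\<in>I. indicator {t..} (\<Sum>k\<in>K. a i k * z k)) \<partial>gauss_vec K)"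
    using orthant_tail_lower[OF K I False row] by (auto simp: d_def)
  \<comment> \<open>\<open>c\<close> does not depend on \<open>k\<close>, since the variance
    \<open>s - m\<^sup>2\<close> does not change under doubling; being at least \<open>1\<close>
    makes \<open>c \<le> c\<^sup>2\<close>.\<close>
  define c where "c = 1 + \<bar>2 * (s - m\<^sup>2)\<bar>"
  have c: "1 \<le> c" by (simp add: c_def)
  have vc: "2 * (s - m\<^sup>2) \<le> c\<^sup>2"
  proof -
    have "2 * (s - m\<^sup>2) \<le> c" by (simp add: c_def)
    also have "c \<le> c\<^sup>2" using c by (simp add: self_le_power)
    finally show ?thesis .
  qed
  define D' where "D' = D + sqrt d * c"
  \<comment> \<open>\<open>L\<close> collects the terms linear in \<open>M\<close>, which is
    \<open>sqrt (2 ^ k) * m\<close> below; \<open>Q\<close> collects those independent of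
    \<open>k\<close>.\<close>
  define L where "L = (real d * c + sqrt d * D') * \<bar>m\<bar>"
  define Q where "Q = q / (4 * c) ^ d * exp (- D'\<^sup>2 / 2)"
  have L: "0 \<le> L" using D c by (simp add: L_def D'_def)
  have Q: "0 < Q" using q c by (simp add: Q_def)
  have "1 \<le> E f / p ^ d"
  proof (rule power_exp_sqrt_lower_imp_ge_1[OF _ Q L])
    show "0 \<le> E f / p ^ d" using E0[of 0] p by (simp add: F_def)
    fix k :: nat
    define x where "x = sqrt (2 ^ k)"
    define M where "M = x * m"
    have x: "1 \<le> x" "x\<^sup>2 = 2 ^ k" by (simp_all add: x_def)
    have aM: "\<bar>M\<bar> = x * \<bar>m\<bar>" using x by (simp add: M_def abs_mult)
    have mono_low: "p ^ (2 ^ k) * exp (M\<^sup>2 / 2 - \<bar>M\<bar> * c) / (4 * c) \<le> F k (M + c)"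
    proof (rule mono_log_concave_lower[OF it(1) _ it(2), where v="s - m\<^sup>2"])
      show "(\<integral>y. F k y * y \<partial>gauss) = M * p ^ (2 ^ k)" using it(3)[of k] by (simp add: M_def x_def)
      have "M\<^sup>2 = 2 ^ k * m\<^sup>2" using x by (simp add: M_def power_mult_distrib)
      then show "(\<integral>y. F k y * y\<^sup>2 \<partial>gauss) = (M\<^sup>2 + (s - m\<^sup>2)) * p ^ (2 ^ k)"
        using it(4)[of k] by (simp add: algebra_simps)
    qed (use c p vc in auto)
    \<comment> \<open>The terms \<open>d * M\<^sup>2 / 2\<close> from the density bound and from the
      tail cancel here.\<close>
    have e: "- L * x + - D'\<^sup>2 / 2 \<le> real d * (M\<^sup>2 / 2 - \<bar>M\<bar> * c) + - (sqrt d * \<bar>M + c\<bar> + D)\<^sup>2 / 2"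
    proof -
      have "sqrt d * \<bar>M + c\<bar> \<le> sqrt d * (\<bar>M\<bar> + c)" using c by (intro mult_left_mono) auto
      then have "sqrt d * \<bar>M + c\<bar> + D \<le> sqrt d * \<bar>M\<bar> + D'" by (simp add: D'_def algebra_simps)
      then have "(sqrt d * \<bar>M + c\<bar> + D)\<^sup>2 \<le> (sqrt d * \<bar>M\<bar> + D')\<^sup>2"
        using D by (intro power_mono) auto
      also have "\<dots> = real d * M\<^sup>2 + 2 * (sqrt d * \<bar>M\<bar> * D') + D'\<^sup>2"
        by (simp add: power2_sum power_mult_distrib)
      finally show ?thesis unfolding L_def aM
        by (simp add: algebra_simps)
    qed
    have "Q * exp (- (L * x)) = q / (4 * c) ^ d * exp (- L * x + - D'\<^sup>2 / 2)"
      unfolding exp_add by (simp add: Q_def mult_ac)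
    also have "\<dots> \<le> q / (4 * c) ^ d * exp (real d * (M\<^sup>2 / 2 - \<bar>M\<bar> * c) + - (sqrt d * \<bar>M + c\<bar> + D)\<^sup>2 / 2)"
      using e q c by (intro mult_left_mono) auto
    also have "\<dots> = (exp (M\<^sup>2 / 2 - \<bar>M\<bar> * c) / (4 * c)) ^ d * (q * exp (- (sqrt d * \<bar>M + c\<bar> + D)\<^sup>2 / 2))"
      unfolding exp_add exp_of_nat_mult by (simp add: power_divide)
    finally have 1: "Q * exp (- (L * x)) \<le> \<dots>" .
    have "(p ^ (2 ^ k)) ^ d * (Q * exp (- (L * x)))
      \<le> (p ^ (2 ^ k)) ^ d * ((exp (M\<^sup>2 / 2 - \<bar>M\<bar> * c) / (4 * c)) ^ d * (q * exp (- (sqrt d * \<bar>M + c\<bar> + D)\<^sup>2 / 2)))"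
      using p by (intro mult_left_mono 1) auto
    also have "\<dots> = (p ^ (2 ^ k) * exp (M\<^sup>2 / 2 - \<bar>M\<bar> * c) / (4 * c)) ^ d * (q * exp (- (sqrt d * \<bar>M + c\<bar> + D)\<^sup>2 / 2))"
      by (simp add: power_mult_distrib power_divide)
    also have "\<dots> \<le> F k (M + c) ^ d * (\<integral>z. (\<Prod>i\<in>I. indicator {M + c..} (\<Sum>k\<in>K. a i k * z k)) \<partial>gauss_vec K)"
      using mono_low p c q F(2) by (intro mult_mono power_mono tail zero_le_power) auto
    also have "\<dots> = (\<integral>z. (\<Prod>i\<in>I. F k (M + c) * indicator {M + c..} (\<Sum>k\<in>K. a i k * z k)) \<partial>gauss_vec K)"
      by (simp add: prod.distrib d_def)
    also have "\<dots> \<le> E (F k)"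
      unfolding E_def
    proof (intro integral_mono G.integrable_const_bound[where B=1] prod_mono)
      fix z i
      show "0 \<le> F k (M + c) * indicator {M + c..} (\<Sum>k\<in>K. a i k * z k) \<and>
        F k (M + c) * indicator {M + c..} (\<Sum>k\<in>K. a i k * z k) \<le> F k (\<Sum>k\<in>K. a i k * z k)"
        using F by (auto simp: indicator_def intro: monoD)
    qed (use F in \<open>auto simp: abs_prod indicator_def abs_mult intro!: prod_le_1 always_eventually\<close>)
    also have "\<dots> \<le> E f ^ (2 ^ k)" by (rule chain)
    finally have "(p ^ d) ^ (2 ^ k) * (Q * exp (- (L * x))) \<le> E f ^ (2 ^ k)"
      by (simp add: power_mult[symmetric] mult.commute)
    then show "Q * exp (- (L * sqrt (2 ^ k))) \<le> (E f / p ^ d) ^ (2 ^ k)"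
      using p by (simp add: power_divide x_def field_simps)
  qed
  then show ?thesis using p by (simp add: E_def p_def[symmetric] d_def)
qed

section \<open>Comparison with the equicorrelated orthant\<close>

lemma mono_log_concave_indicator: "mono_log_concave (indicator {s<..})"
proof -
  have "log_concave (indicator {s<..})"
    unfolding log_concave_def
  proof (intro allI impI)
    fix x y u :: real assume u: "0 < u" "u < 1"
    show "indicator {s<..} x powr (1 - u) * indicator {s<..} y powr u \<le> (indicator {s<..} ((1 - u) * x + u * y) :: real)"
    proof (cases "s < x \<and> s < y")
      case True
      then have "(1 - u) * s < (1 - u) * x" "u * s < u * y" using u by auto
      then have "s < (1 - u) * x + u * y" by (simp add: algebra_simps)
      then show ?thesis by (simp add: indicator_def)
    qed (auto simp: indicator_def)
  qed
  moreover have "mono (indicator {s<..} :: real \<Rightarrow> real)" by (auto simp: mono_def indicator_def)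
  ultimately show ?thesis by (auto simp: mono_log_concave_def indicator_def)
qed

lemma gauss_Ioi_pos: "0 < (\<integral>x. (indicator {s<..} x :: real) \<partial>gauss)"
proof -
  interpret N: prob_space gauss by (rule prob_space_gauss)
  have "0 < (1 / sqrt (2 * pi)) * exp (- (\<bar>s + 1\<bar> + 1)\<^sup>2 / 2)" by simp
  also have "\<dots> \<le> (\<integral>x. indicator {s + 1..} x \<partial>gauss)" by (rule gauss_Ici_ge)
  also have "\<dots> \<le> (\<integral>x. indicator {s<..} x \<partial>gauss)"
    by (intro integral_mono N.integrable_const_bound[where B=1]) (auto simp: indicator_def)
  finally show ?thesis .
qed

text \<open>Expanding a sum of squares shows that no entry exceeds \<open>1\<close>, so a row sum of
  \<open>card I\<close> forces equality. This serves the case \<open>r = 1\<close> below, in which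
  one cannot divide by \<open>1 - r\<close>.\<close>

lemma gram_eq_one_if_row_sums_card:
  fixes a :: "'i \<Rightarrow> 'k \<Rightarrow> real"
  assumes I: "finite I" and unit: "\<And>i. i \<in> I \<Longrightarrow> (\<Sum>k\<in>K. a i k * a i k) = 1"
    and row: "\<And>i. i \<in> I \<Longrightarrow> (\<Sum>j\<in>I. \<Sum>k\<in>K. a i k * a j k) = card I"
    and ij: "i \<in> I" "j \<in> I"
  shows "(\<Sum>k\<in>K. a i k * a j k) = 1"
proof -
  have le: "(\<Sum>k\<in>K. a i k * a j k) \<le> 1" if "j \<in> I" for j
  proof -
    have "0 \<le> (\<Sum>k\<in>K. (a i k - a j k)\<^sup>2)" by (intro sum_nonneg) auto
    also have "\<dots> = (\<Sum>k\<in>K. a i k * a i k) + (\<Sum>k\<in>K. a j k * a j k) - 2 * (\<Sum>k\<in>K. a i k * a j k)"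
      unfolding sum_distrib_left sum.distrib[symmetric] sum_subtractf[symmetric]
      by (rule sum.cong) (auto simp: power2_eq_square algebra_simps)
    finally show ?thesis using unit[OF ij(1)] unit[OF that] by simp
  qed
  have "(\<Sum>j\<in>I. 1 - (\<Sum>k\<in>K. a i k * a j k)) = 0"
    using row[OF ij(1)] by (simp add: sum_subtractf)
  then have "\<forall>j\<in>I. 1 - (\<Sum>k\<in>K. a i k * a j k) = 0"
    by (subst (asm) sum_nonneg_eq_0_iff[OF I]) (use le in auto)
  then show ?thesis using ij by auto
qed

text \<open>Both vectors share a common Gaussian part of variance \<open>r\<close>. Conditionally on
  it, the equicorrelated coordinates are independent and the integral is an exact power, while the
  others have residuals with row sums \<open>1\<close>, to which
  \<open>gaussian_product_lower_bound\<close> applies.\<close>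

lemma orthant_equicorrelated_le:
  fixes a :: "'i \<Rightarrow> 'k \<Rightarrow> real"
  assumes K: "finite K" and I: "finite I" "I \<noteq> {}"
    and unit: "\<And>i. i \<in> I \<Longrightarrow> (\<Sum>k\<in>K. a i k * a i k) = 1"
    and row: "\<And>i. i \<in> I \<Longrightarrow> (\<Sum>j\<in>I. \<Sum>k\<in>K. a i k * a j k) = 1 + (real (card I) - 1) * r"
    and r: "0 \<le> r" "r \<le> 1"
    and X: "jointly_gaussian M I X (\<lambda>i j. if i = j then 1 else r)"
  shows "(\<integral>x. (\<Prod>i\<in>I. indicator {0<..} (X i x)) \<partial>M)
    \<le> (\<integral>z. (\<Prod>i\<in>I. indicator {0<..} (\<Sum>k\<in>K. a i k * z k) :: real) \<partial>gauss_vec K)"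
proof (cases "r = 1")
  case True
  have C: "(\<Sum>k\<in>K. a i k * a j k) = 1" if "i \<in> I" "j \<in> I" for i j
    by (rule gram_eq_one_if_row_sums_card[OF I(1) unit _ that]) (use row True in auto)
  have "(\<integral>x. (\<Prod>i\<in>I. indicator {0<..} (X i x)) \<partial>M)
    = (\<integral>z. (\<Prod>i\<in>I. indicator {0<..} (\<Sum>k\<in>K. a i k * z k) :: real) \<partial>gauss_vec K)"
    by (rule jointly_gaussian_prod[OF X jointly_gaussian_linear[OF K I(1)], where f="\<lambda>_. indicator {0<..}"])
      (use C True in auto)
  then show ?thesis by simp
next
  case False
  then have r1: "r < 1" using r by simp
  define d where "d = real (card I)"
  have d: "d > 0" using I by (simp add: d_def card_gt_0_iff)
  \<comment> \<open>\<open>e\<close> is the variance of the average of the coordinates, equal to its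
    covariance with each of them.\<close>
  define e where "e = (1 + (d - 1) * r) / d"
  define mean where "mean k = (\<Sum>i\<in>I. a i k) / d" for k
  define L where "L = insert None (Some ` K)"
  \<comment> \<open>An explicit realization of the residual. Rescaled deviations from the average
    have row sums \<open>0\<close>; the additional independent coordinate \<open>None\<close> with
    coefficient \<open>1 / sqrt d\<close> raises them to \<open>1\<close>.\<close>
  define b where "b i l = (case l of None \<Rightarrow> 1 / sqrt d | Some k \<Rightarrow> (a i k - mean k) / sqrt (1 - r))" for i l
  define t where "t = sqrt (1 - r)"
  have t: "0 < t" "t * t = 1 - r" using r1 by (auto simp: t_def)
  have fL: "finite L" using K by (simp add: L_def)
  have row': "(\<Sum>j\<in>I. \<Sum>k\<in>K. a i k * a j k) = d * e" if "i \<in> I" for i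
    using row[OF that] d by (simp add: e_def d_def)
  have am: "(\<Sum>k\<in>K. a i k * mean k) = e" if "i \<in> I" for i
  proof -
    have "(\<Sum>k\<in>K. a i k * mean k) = (\<Sum>k\<in>K. \<Sum>j\<in>I. a i k * a j k) / d"
      by (simp add: mean_def sum_divide_distrib sum_distrib_left)
    also have "\<dots> = (\<Sum>j\<in>I. \<Sum>k\<in>K. a i k * a j k) / d" by (subst sum.swap) simp
    finally show ?thesis using row'[OF that] d by simp
  qed
  have mm: "(\<Sum>k\<in>K. mean k * mean k) = e"
  proof -
    have "(\<Sum>k\<in>K. mean k * mean k) = (\<Sum>k\<in>K. \<Sum>i\<in>I. a i k * mean k) / d"
      by (simp add: mean_def[of _] sum_divide_distrib sum_distrib_right)
    also have "\<dots> = (\<Sum>i\<in>I. \<Sum>k\<in>K. a i k * mean k) / d" by (subst sum.swap) simp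
    also have "\<dots> = e" using am d by (simp add: d_def)
    finally show ?thesis .
  qed
  have B: "(\<Sum>l\<in>L. b i l * b j l) = ((\<Sum>k\<in>K. a i k * a j k) - r) / (1 - r)" if "i \<in> I" "j \<in> I" for i j
  proof -
    have "(\<Sum>l\<in>L. b i l * b j l) = (1 / sqrt d) * (1 / sqrt d) + (\<Sum>k\<in>K. b i (Some k) * b j (Some k))"
      unfolding L_def using K by (subst sum.insert) (auto simp: sum.reindex b_def)
    also have "(\<Sum>k\<in>K. b i (Some k) * b j (Some k)) = (\<Sum>k\<in>K. (a i k - mean k) * (a j k - mean k)) / (1 - r)"
      unfolding sum_divide_distrib using t by (intro sum.cong) (auto simp: b_def t_def[symmetric])
    also have "(\<Sum>k\<in>K. (a i k - mean k) * (a j k - mean k))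
      = (\<Sum>k\<in>K. a i k * a j k) - (\<Sum>k\<in>K. a i k * mean k) - (\<Sum>k\<in>K. a j k * mean k) + (\<Sum>k\<in>K. mean k * mean k)"
      unfolding sum.distrib[symmetric] sum_subtractf[symmetric] by (rule sum.cong) (auto simp: algebra_simps)
    finally have "(\<Sum>l\<in>L. b i l * b j l) = 1 / d + ((\<Sum>k\<in>K. a i k * a j k) - e) / (1 - r)"
      using am that mm d by simp
    moreover have "1 / d - e / (1 - r) = - r / (1 - r)" using d r1 by (simp add: e_def field_simps)
    ultimately show ?thesis by (simp add: diff_divide_distrib)
  qed
  have unitb: "(\<Sum>l\<in>L. b i l * b i l) = 1" if "i \<in> I" for i
    using B[OF that that] unit[OF that] r1 by simp
  have rowb: "(\<Sum>j\<in>I. \<Sum>l\<in>L. b i l * b j l) = 1" if "i \<in> I" for i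
  proof -
    have "(\<Sum>j\<in>I. \<Sum>l\<in>L. b i l * b j l) = (\<Sum>j\<in>I. ((\<Sum>k\<in>K. a i k * a j k) - r) / (1 - r))"
      using B that by (intro sum.cong) auto
    also have "\<dots> = ((\<Sum>j\<in>I. \<Sum>k\<in>K. a i k * a j k) - d * r) / (1 - r)"
      by (simp add: sum_divide_distrib[symmetric] sum_subtractf d_def)
    also have "\<dots> = 1" using row[OF that] r1 by (simp add: d_def field_simps)
    finally show ?thesis .
  qed
  \<comment> \<open>Given the common part \<open>g\<close>, positivity of a coordinate is a
    half-line condition on its residual.\<close>
  let ?h = "\<lambda>g. indicator {- (sqrt r * g) / t<..} :: real \<Rightarrow> real"
  have ind: "indicator {0<..} (sqrt r * g + t * x) = ?h g x" for g x
  proof -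
    have "- (sqrt r * g) / t < x \<longleftrightarrow> - (sqrt r * g) < x * t" by (rule pos_divide_less_eq[OF t(1)])
    then have "0 < sqrt r * g + t * x \<longleftrightarrow> - (sqrt r * g) / t < x" by (auto simp: mult.commute)
    then show ?thesis by (simp add: indicator_def)
  qed
  have mix: "(\<integral>z. (\<Prod>i\<in>I. indicator {0<..} (sqrt r * fst z + (\<Sum>k\<in>J. (t * c i k) * snd z k))) \<partial>(gauss \<Otimes>\<^sub>M gauss_vec J))
    = (\<integral>g. (\<integral>z. (\<Prod>i\<in>I. ?h g (\<Sum>k\<in>J. c i k * z k)) \<partial>gauss_vec J) \<partial>gauss)" (is "?lhs = _")
    and int: "integrable gauss (\<lambda>g. \<integral>z. (\<Prod>i\<in>I. ?h g (\<Sum>k\<in>J. c i k * z k)) \<partial>gauss_vec J)"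
    if "finite J" for J :: "'l set" and c
  proof -
    interpret N: prob_space gauss by (rule prob_space_gauss)
    interpret G: prob_space "gauss_vec J" by (rule prob_space_gauss_vec)
    interpret P: pair_prob_space gauss "gauss_vec J" ..
    let ?F = "\<lambda>z. (\<Prod>i\<in>I. indicator {0<..} (sqrt r * fst z + (\<Sum>k\<in>J. (t * c i k) * snd z k))) :: real"
    have i: "integrable (gauss \<Otimes>\<^sub>M gauss_vec J) ?F"
      by (rule P.integrable_const_bound[where B=1]) (auto simp: abs_prod intro!: prod_le_1)
    have eq: "?F (g, z) = (\<Prod>i\<in>I. ?h g (\<Sum>k\<in>J. c i k * z k))" for g z
      unfolding ind[symmetric] by (simp add: sum_distrib_left mult_ac)
    show "?lhs = (\<integral>g. (\<integral>z. (\<Prod>i\<in>I. ?h g (\<Sum>k\<in>J. c i k * z k)) \<partial>gauss_vec J) \<partial>gauss)"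
      using P.integral_fst'[OF i] unfolding eq by simp
    show "integrable gauss (\<lambda>g. \<integral>z. (\<Prod>i\<in>I. ?h g (\<Sum>k\<in>J. c i k * z k)) \<partial>gauss_vec J)"
      using P.integrable_fst'[OF i] unfolding eq .
  qed
  define \<delta> :: "'i \<Rightarrow> 'i \<Rightarrow> real" where "\<delta> i k = (if k = i then 1 else 0)" for i k
  have \<delta>: "(\<Sum>k\<in>I. \<delta> i k * z k) = z i" if "i \<in> I" for i and z :: "'i \<Rightarrow> real"
  proof -
    have "(\<Sum>k\<in>I. \<delta> i k * z k) = (\<Sum>k\<in>I. if k = i then z k else 0)" by (rule sum.cong) (auto simp: \<delta>_def)
    then show ?thesis using I that by simp
  qed
  have "(\<integral>x. (\<Prod>i\<in>I. indicator {0<..} (X i x)) \<partial>M)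
    = (\<integral>z. (\<Prod>i\<in>I. indicator {0<..} (sqrt r * fst z + (\<Sum>k\<in>I. (t * \<delta> i k) * snd z k)) :: real) \<partial>(gauss \<Otimes>\<^sub>M gauss_vec I))"
  proof (rule jointly_gaussian_prod[OF X jointly_gaussian_common[OF jointly_gaussian_linear[OF I(1) I(1), of "\<lambda>i k. t * \<delta> i k"], of "\<lambda>_. sqrt r"], where f="\<lambda>_. indicator {0<..}"])
    fix i j assume ij: "i \<in> I" "j \<in> I"
    have "(\<Sum>k\<in>I. (t * \<delta> i k) * (t * \<delta> j k)) = (t * t) * (\<Sum>k\<in>I. \<delta> i k * \<delta> j k)"
      by (simp add: sum_distrib_left mult_ac)
    then show "(if i = j then 1 else r) = sqrt r * sqrt r + (\<Sum>k\<in>I. (t * \<delta> i k) * (t * \<delta> j k))"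
      unfolding \<delta>[OF ij(1)] using t r by (simp add: \<delta>_def)
  qed simp
  also have "\<dots> = (\<integral>g. (\<integral>z. (\<Prod>i\<in>I. ?h g (\<Sum>k\<in>I. \<delta> i k * z k)) \<partial>gauss_vec I) \<partial>gauss)"
    by (rule mix[OF I(1)])
  also have "\<dots> \<le> (\<integral>g. (\<integral>z. (\<Prod>i\<in>I. ?h g (\<Sum>l\<in>L. b i l * z l)) \<partial>gauss_vec L) \<partial>gauss)"
  proof (rule integral_mono[OF int[OF I(1)] int[OF fL]])
    fix g
    interpret N: prob_space gauss by (rule prob_space_gauss)
    interpret product_prob_space "\<lambda>_::'i. gauss" I by unfold_locales
    have "(\<integral>z. (\<Prod>i\<in>I. ?h g (\<Sum>k\<in>I. \<delta> i k * z k)) \<partial>gauss_vec I) = (\<integral>z. (\<Prod>i\<in>I. ?h g (z i)) \<partial>gauss_vec I)"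
      using \<delta> by (intro Bochner_Integration.integral_cong prod.cong) auto
    also have "\<dots> = (\<Prod>i\<in>I. \<integral>x. ?h g x \<partial>gauss)"
      by (rule product_integral_prod[OF I(1)]) (auto intro!: N.integrable_const_bound[where B=1])
    also have "\<dots> = (\<integral>x. ?h g x \<partial>gauss) ^ card I" by simp
    also have "\<dots> \<le> (\<integral>z. (\<Prod>i\<in>I. ?h g (\<Sum>l\<in>L. b i l * z l)) \<partial>gauss_vec L)"
      by (rule gaussian_product_lower_bound[OF fL I(1) unitb rowb mono_log_concave_indicator gauss_Ioi_pos])
    finally show "(\<integral>z. (\<Prod>i\<in>I. ?h g (\<Sum>k\<in>I. \<delta> i k * z k)) \<partial>gauss_vec I) \<le> (\<integral>z. (\<Prod>i\<in>I. ?h g (\<Sum>l\<in>L. b i l * z l)) \<partial>gauss_vec L)" .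
  qed
  also have "\<dots> = (\<integral>z. (\<Prod>i\<in>I. indicator {0<..} (sqrt r * fst z + (\<Sum>l\<in>L. (t * b i l) * snd z l))) \<partial>(gauss \<Otimes>\<^sub>M gauss_vec L))"
    by (rule mix[OF fL, symmetric])
  also have "\<dots> = (\<integral>z. (\<Prod>i\<in>I. indicator {0<..} (\<Sum>k\<in>K. a i k * z k)) \<partial>gauss_vec K)"
  proof (rule jointly_gaussian_prod[OF jointly_gaussian_common[OF jointly_gaussian_linear[OF fL I(1), of "\<lambda>i k. t * b i k"], of "\<lambda>_. sqrt r"] jointly_gaussian_linear[OF K I(1)], where f="\<lambda>_. indicator {0<..}"])
    fix i j assume ij: "i \<in> I" "j \<in> I"
    have "(\<Sum>l\<in>L. (t * b i l) * (t * b j l)) = (t * t) * (\<Sum>l\<in>L. b i l * b j l)"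
      by (simp add: sum_distrib_left mult_ac)
    then show "sqrt r * sqrt r + (\<Sum>l\<in>L. (t * b i l) * (t * b j l)) = (\<Sum>k\<in>K. a i k * a j k)"
      unfolding B[OF ij] using t r r1 by simp
  qed simp
  finally show ?thesis .
qed

text \<open>Passes from the measure on the product space to an integral of indicators. The matrix
  selected by \<open>SOME\<close> is a genuine root by \<open>matrix_root_Omega\<close>, which is
  where the bounds on \<open>l\<close> enter.\<close>

lemma orthant_probability_eq:
  assumes d: "d \<ge> 3" and l: "- real d \<le> l" "l \<le> real d"
  obtains X where "jointly_gaussian (gauss_vec {..<d}) {..<d} X (\<lambda>i j. if i = j then 1 else rho d l)"
    and "orthant_probability d l = (\<integral>z. (\<Prod>i<d. indicator {0<..} (X i z)) \<partial>gauss_vec {..<d})"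
proof -
  define A where "A = (SOME A. matrix_root d (Omega d l) A)"
  have A: "matrix_root d (Omega d l) A" unfolding A_def by (rule someI_ex[OF matrix_root_Omega[OF assms]])
  let ?X = "\<lambda>i z. \<Sum>k<d. A i k * z k"
  interpret G: prob_space "gauss_vec {..<d}" by (rule prob_space_gauss_vec)
  show thesis
  proof (rule that)
    have "jointly_gaussian (gauss_vec {..<d}) {..<d} ?X (\<lambda>i j. \<Sum>k<d. A i k * A j k)"
      by (rule jointly_gaussian_linear) auto
    then show "jointly_gaussian (gauss_vec {..<d}) {..<d} ?X (\<lambda>i j. if i = j then 1 else rho d l)"
      by (rule jointly_gaussian_cong) (use A in \<open>auto simp: matrix_root_def Omega_def\<close>)
    have [measurable]: "{x \<in> space (\<Pi>\<^sub>M i\<in>{..<d}. borel :: real measure). \<forall>i<d. 0 < x i} \<in> sets (\<Pi>\<^sub>M i\<in>{..<d}. borel)"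
      by measurable
    have "orthant_probability d l = G.prob (linear_image d A -` {x \<in> space (\<Pi>\<^sub>M i\<in>{..<d}. borel). \<forall>i<d. 0 < x i} \<inter> space (gauss_vec {..<d}))"
      unfolding orthant_probability_def gaussian_law_def A_def[symmetric] using measurable_linear_image[of d A]
      by (simp add: measure_distr std_gaussian_def)
    also have "\<dots> = (\<integral>z. indicator (linear_image d A -` {x \<in> space (\<Pi>\<^sub>M i\<in>{..<d}. borel). \<forall>i<d. 0 < x i} \<inter> space (gauss_vec {..<d})) z \<partial>gauss_vec {..<d})"
      by simp
    also have "\<dots> = (\<integral>z. (\<Prod>i<d. indicator {0<..} (?X i z)) \<partial>gauss_vec {..<d})"
    proof (rule Bochner_Integration.integral_cong[OF refl])
      fix z assume z: "z \<in> space (gauss_vec {..<d})"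
      have sp: "linear_image d A z \<in> space (\<Pi>\<^sub>M i\<in>{..<d}. borel)" by (simp add: linear_image_def space_PiM)
      have li: "linear_image d A z i = ?X i z" if "i < d" for i using that by (simp add: linear_image_def)
      show "indicator (linear_image d A -` {x \<in> space (\<Pi>\<^sub>M i\<in>{..<d}. borel). \<forall>i<d. 0 < x i} \<inter> space (gauss_vec {..<d})) z = (\<Prod>i<d. indicator {0<..} (?X i z) :: real)"
      proof (cases "\<forall>i<d. 0 < ?X i z")
        case True
        then show ?thesis using z sp li by (simp add: indicator_def)
      next
        case False
        then obtain i where "i < d" "\<not> 0 < ?X i z" by blast
        then have "(\<Prod>i<d. indicator {0<..} (?X i z) :: real) = 0" by (intro prod_zero) (auto simp: indicator_def)
        then show ?thesis using False li by (auto simp: indicator_def)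
      qed
    qed
    finally show "orthant_probability d l = (\<integral>z. (\<Prod>i<d. indicator {0<..} (?X i z)) \<partial>gauss_vec {..<d})" .
  qed
qed

section \<open>Adjacency eigenvalues\<close>

lemma adjacency_commute: "adjacency E u v = adjacency E v u"
  by (simp add: adjacency_def insert_commute)

text \<open>Symmetry of the adjacency matrix: evaluating the same double sum with the equation for
  \<open>x\<close> and with that for \<open>y\<close> gives the factors \<open>l\<close> and
  \<open>m\<close>.\<close>

lemma eigenvectors_orthogonal:
  assumes V: "finite V" and x: "\<And>v. v \<in> V \<Longrightarrow> (\<Sum>u\<in>V. adjacency E v u * x u) = l * x v"
    and y: "\<And>v. v \<in> V \<Longrightarrow> (\<Sum>u\<in>V. adjacency E v u * y u) = m * y v" and lm: "l \<noteq> m"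
  shows "(\<Sum>v\<in>V. x v * y v) = 0"
proof -
  have "l * (\<Sum>v\<in>V. x v * y v) = (\<Sum>v\<in>V. \<Sum>u\<in>V. adjacency E v u * x u * y v)"
    unfolding sum_distrib_left sum_distrib_right[symmetric] using x by (intro sum.cong) (auto simp: mult.assoc)
  also have "\<dots> = (\<Sum>u\<in>V. \<Sum>v\<in>V. adjacency E v u * x u * y v)" by (rule sum.swap)
  also have "\<dots> = (\<Sum>u\<in>V. x u * (\<Sum>v\<in>V. adjacency E u v * y v))"
    unfolding sum_distrib_left by (intro sum.cong refl) (simp add: adjacency_commute[of E] mult_ac)
  also have "\<dots> = (\<Sum>u\<in>V. m * (x u * y u))" using y by (intro sum.cong) auto
  also have "\<dots> = m * (\<Sum>v\<in>V. x v * y v)" by (simp add: sum_distrib_left)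
  finally show ?thesis using lm by simp
qed

text \<open>By Bessel's inequality for the coordinate vectors, there are at most \<open>card V\<close> orthonormal vectors.\<close>

lemma finite_adjacency_eigenvalues:
  assumes V: "finite V"
  shows "finite {l. adjacency_eigenvalue V E l}"
proof -
  define P where "P l x \<longleftrightarrow> (\<Sum>v\<in>V. x v * x v) = 1 \<and> (\<forall>v\<in>V. (\<Sum>u\<in>V. adjacency E v u * x u) = l * x v)"
    for l and x :: "'a \<Rightarrow> real"
  have "\<exists>x. P l x" if ev: "adjacency_eigenvalue V E l" for l
  proof -
    obtain x v0 where x: "v0 \<in> V" "x v0 \<noteq> 0" "\<forall>v\<in>V. (\<Sum>u\<in>V. adjacency E v u * x u) = l * x v"
      using ev by (auto simp: adjacency_eigenvalue_def)
    define n where "n = (\<Sum>v\<in>V. x v * x v)"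
    have n: "n > 0" unfolding n_def using V x by (intro sum_pos2[of V v0]) (auto simp: zero_less_mult_iff linorder_neq_iff)
    have "(\<Sum>v\<in>V. (x v / sqrt n) * (x v / sqrt n)) = (\<Sum>v\<in>V. x v * x v) / n"
      unfolding sum_divide_distrib using n by (intro sum.cong) auto
    then have "P l (\<lambda>v. x v / sqrt n)"
      using x n by (simp add: P_def n_def[symmetric] sum_divide_distrib[symmetric])
    then show ?thesis by blast
  qed
  then obtain X where X: "\<And>l. adjacency_eigenvalue V E l \<Longrightarrow> P l (X l)" by metis
  have "card G \<le> card V" if G: "G \<subseteq> {l. adjacency_eigenvalue V E l}" "finite G" for G
  proof -
    have orth: "(\<Sum>v\<in>V. X l v * X m v) = (if l = m then 1 else 0)" if "l \<in> G" "m \<in> G" for l m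
      using eigenvectors_orthogonal[OF V, of E "X l" l "X m" m] X[of l] X[of m] that G by (auto simp: P_def)
    have bessel: "(\<Sum>l\<in>G. X l w * X l w) \<le> 1" if w: "w \<in> V" for w
    proof -
      \<comment> \<open>The residual of the coordinate vector at \<open>w\<close> after projection
        onto the eigenvectors in \<open>G\<close>; its squared norm is \<open>1\<close> minus the
        sum in question.\<close>
      define r where "r v = (if v = w then 1 else 0) - (\<Sum>l\<in>G. X l w * X l v)" for v
      have "0 \<le> (\<Sum>v\<in>V. r v * r v)" by (intro sum_nonneg) auto
      also have "\<dots> = (\<Sum>v\<in>V. (if v = w then 1 - 2 * (\<Sum>l\<in>G. X l w * X l v) else 0) + (\<Sum>l\<in>G. \<Sum>m\<in>G. (X l w * X m w) * (X l v * X m v)))"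
        by (rule sum.cong) (auto simp: r_def algebra_simps sum_product sum_distrib_left)
      also have "\<dots> = 1 - 2 * (\<Sum>l\<in>G. X l w * X l w) + (\<Sum>v\<in>V. \<Sum>l\<in>G. \<Sum>m\<in>G. (X l w * X m w) * (X l v * X m v))"
        using V w by (simp add: sum.distrib)
      also have "(\<Sum>v\<in>V. \<Sum>l\<in>G. \<Sum>m\<in>G. (X l w * X m w) * (X l v * X m v))
         = (\<Sum>l\<in>G. \<Sum>m\<in>G. \<Sum>v\<in>V. (X l w * X m w) * (X l v * X m v))"
        by (subst sum.swap, rule sum.cong[OF refl], rule sum.swap)
      also have "\<dots> = (\<Sum>l\<in>G. \<Sum>m\<in>G. if l = m then X l w * X l w else 0)"
        unfolding sum_distrib_left[symmetric] using orth by (intro sum.cong refl) auto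
      also have "\<dots> = (\<Sum>l\<in>G. X l w * X l w)" using G by simp
      finally show ?thesis by simp
    qed
    have "real (card G) = (\<Sum>l\<in>G. \<Sum>v\<in>V. X l v * X l v)" using orth by simp
    also have "\<dots> = (\<Sum>v\<in>V. \<Sum>l\<in>G. X l v * X l v)" by (rule sum.swap)
    also have "\<dots> \<le> (\<Sum>v\<in>V. 1)" by (intro sum_mono bessel)
    finally show ?thesis by simp
  qed
  then show ?thesis using finite_if_finite_subsets_card_bdd by blast
qed

text \<open>A continuous form attains its minimum on the compact unit sphere, and homogeneity
  extends the inequality to all \<open>y\<close>.\<close>

lemma exists_rayleigh_minimizer:
  fixes B :: "'a \<Rightarrow> 'a \<Rightarrow> real"
  assumes V: "finite V" "V \<noteq> {}"
  obtains x where "(\<Sum>v\<in>V. x v * x v) = 1"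
    and "\<And>y. (\<Sum>u\<in>V. \<Sum>v\<in>V. B u v * x u * x v) * (\<Sum>v\<in>V. y v * y v) \<le> (\<Sum>u\<in>V. \<Sum>v\<in>V. B u v * y u * y v)"
proof -
  let ?Q = "\<lambda>x :: 'a \<Rightarrow> real. \<Sum>u\<in>V. \<Sum>v\<in>V. B u v * x u * x v"
  let ?n = "\<lambda>x :: 'a \<Rightarrow> real. \<Sum>v\<in>V. x v * x v"
  \<comment> \<open>Pinning the values outside \<open>V\<close> to \<open>0\<close> makes this box
    compact in the product topology on all functions.\<close>
  let ?P = "PiE UNIV (\<lambda>v. if v \<in> V then {-1..1::real} else {0})"
  define S where "S = ?P \<inter> {x. ?n x = 1}"
  have "compactin (product_topology (\<lambda>_. euclidean) UNIV) ?P"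
    by (subst compactin_PiE) auto
  then have P: "compact ?P" by (simp add: euclidean_product_topology)
  have n: "continuous_on UNIV ?n" by (intro continuous_intros continuous_on_product_coordinates)
  have "closed {x. ?n x = 1}" by (rule closed_Collect_eq[OF n continuous_on_const])
  then have S: "compact S" unfolding S_def by (rule compact_Int_closed[OF P])
  obtain v0 where v0: "v0 \<in> V" using V by blast
  define e where "e v = (if v = v0 then 1 else 0 :: real)" for v
  have "?n e = (\<Sum>v\<in>V. if v = v0 then 1 else 0)" by (rule sum.cong) (auto simp: e_def)
  then have "?n e = 1" using V v0 by simp
  moreover have "e \<in> ?P" using v0 by (auto simp: e_def)
  ultimately have "e \<in> S" by (simp add: S_def)
  then have "S \<noteq> {}" by blast
  moreover have "continuous_on S ?Q"
    by (intro continuous_intros continuous_on_subset[OF continuous_on_product_coordinates]) auto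
  ultimately obtain x where x: "x \<in> S" "\<And>y. y \<in> S \<Longrightarrow> ?Q x \<le> ?Q y"
    using continuous_attains_inf[OF S] by blast
  show thesis
  proof (rule that)
    show "?n x = 1" using x(1) by (simp add: S_def)
    fix y
    show "?Q x * ?n y \<le> ?Q y"
    proof (cases "?n y = 0")
      case True
      then have "\<forall>v\<in>V. y v = 0" using V by (simp add: sum_nonneg_eq_0_iff)
      then have "?Q y = 0" by simp
      then show ?thesis using True by simp
    next
      case False
      then have n: "?n y > 0" by (simp add: less_le sum_nonneg)
      define z where "z v = (if v \<in> V then y v / sqrt (?n y) else 0)" for v
      have nz: "?n z = 1"
      proof -
        have "?n z = ?n y / ?n y" unfolding sum_divide_distrib using n by (intro sum.cong) (auto simp: z_def)
        then show ?thesis using n by simp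
      qed
      have "z v \<in> {-1..1}" if "v \<in> V" for v
      proof -
        have "z v * z v \<le> ?n z" using member_le_sum[OF that, of "\<lambda>v. z v * z v"] V by auto
        then have "(z v)\<^sup>2 \<le> 1" using nz by (simp add: power2_eq_square)
        then have "\<bar>z v\<bar> \<le> 1" by (simp add: abs_square_le_1)
        then show ?thesis by auto
      qed
      then have "z \<in> S" using nz by (auto simp: S_def z_def)
      then have "?Q x \<le> ?Q z" by (rule x(2))
      also have "?Q z = ?Q y / ?n y" unfolding sum_divide_distrib using n by (intro sum.cong) (auto simp: z_def)
      finally show ?thesis using n by (simp add: field_simps)
    qed
  qed
qed

text \<open>For small \<open>t\<close> of sign opposite to \<open>b\<close> the linear term
  dominates.\<close>

lemma nonneg_quadratic_imp_linear_zero: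
  fixes b c :: real
  assumes "\<And>t. 0 \<le> 2 * t * b + t * t * c"
  shows "b = 0"
proof (rule ccontr)
  assume b: "b \<noteq> 0"
  \<comment> \<open>With this scale \<open>s * c \<le> 1 < 2\<close>, so \<open>t = - s * b\<close>
    makes the quadratic negative.\<close>
  define s where "s = 1 / (1 + \<bar>c\<bar>)"
  have s: "s > 0" "s * \<bar>c\<bar> \<le> 1" by (auto simp: s_def field_simps)
  have "0 \<le> 2 * (- s * b) * b + (- s * b) * (- s * b) * c" by (rule assms)
  also have "\<dots> = (s * (b * b)) * (s * c - 2)" by (simp add: algebra_simps)
  finally have *: "0 \<le> (s * (b * b)) * (s * c - 2)" .
  have "0 < s * (b * b)" using s b by (auto simp: zero_less_mult_iff linorder_neq_iff)
  then have "0 \<le> s * c - 2" using * mult_pos_neg[of "s * (b * b)" "s * c - 2"] by linarith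
  moreover have "s * c \<le> s * \<bar>c\<bar>" using s by (intro mult_left_mono) auto
  ultimately show False using s by linarith
qed

text \<open>The first variation of the Rayleigh quotient at a minimizer vanishes in each coordinate
  direction, which is the eigenvalue equation with the minimum as eigenvalue.\<close>

lemma exists_eigenvalue_le_rayleigh:
  assumes V: "finite V" "V \<noteq> {}"
  obtains m where "adjacency_eigenvalue V E m"
    and "\<And>y. m * (\<Sum>v\<in>V. y v * y v) \<le> (\<Sum>u\<in>V. \<Sum>v\<in>V. adjacency E u v * y u * y v)"
proof -
  let ?Q = "\<lambda>x. \<Sum>u\<in>V. \<Sum>v\<in>V. adjacency E u v * x u * x v"
  obtain x where x: "(\<Sum>v\<in>V. x v * x v) = 1"
    and min: "\<And>y. ?Q x * (\<Sum>v\<in>V. y v * y v) \<le> ?Q y"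
    using exists_rayleigh_minimizer[OF V, of "adjacency E"] by blast
  define m where "m = ?Q x"
  have "(\<Sum>u\<in>V. adjacency E w u * x u) = m * x w" if w: "w \<in> V" for w
  proof -
    define e where "e v = (if v = w then 1 else 0 :: real)" for v
    define g where "g = (\<Sum>u\<in>V. adjacency E w u * x u)"
    have e1: "(\<Sum>v\<in>V. h v * e v) = h w" for h
    proof -
      have "(\<Sum>v\<in>V. h v * e v) = (\<Sum>v\<in>V. if v = w then h v else 0)" by (rule sum.cong) (auto simp: e_def)
      then show ?thesis using V w by simp
    qed
    have Qt: "?Q (\<lambda>v. x v + t * e v) = m + 2 * t * g + t * t * adjacency E w w" for t
    proof -
      have "?Q (\<lambda>v. x v + t * e v) = (\<Sum>u\<in>V. \<Sum>v\<in>V. adjacency E u v * x u * x v + t * (adjacency E u v * x u * e v)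
          + t * (adjacency E u v * x v * e u) + t * t * (adjacency E u v * e v * e u))"
        by (intro sum.cong refl) (simp add: algebra_simps)
      also have "\<dots> = m + t * (\<Sum>u\<in>V. \<Sum>v\<in>V. (adjacency E u v * x u) * e v) + t * (\<Sum>u\<in>V. \<Sum>v\<in>V. adjacency E u v * x v * e u)
         + t * t * (\<Sum>u\<in>V. \<Sum>v\<in>V. adjacency E u v * e v * e u)"
        by (simp add: sum.distrib sum_distrib_left m_def)
      also have "(\<Sum>u\<in>V. \<Sum>v\<in>V. (adjacency E u v * x u) * e v) = g"
        unfolding e1 g_def by (intro sum.cong refl) (simp add: adjacency_commute)
      also have "(\<Sum>u\<in>V. \<Sum>v\<in>V. adjacency E u v * x v * e u) = (\<Sum>u\<in>V. (\<Sum>v\<in>V. adjacency E u v * x v) * e u)"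
        by (simp only: sum_distrib_right)
      also have "\<dots> = g" unfolding e1 g_def ..
      also have "(\<Sum>u\<in>V. \<Sum>v\<in>V. adjacency E u v * e v * e u) = (\<Sum>u\<in>V. adjacency E u w * e u)"
        unfolding sum_distrib_right[symmetric] e1 ..
      also have "\<dots> = adjacency E w w" by (rule e1)
      finally show ?thesis by (simp add: algebra_simps)
    qed
    have nt: "(\<Sum>v\<in>V. (x v + t * e v) * (x v + t * e v)) = 1 + 2 * t * x w + t * t" for t
    proof -
      have "(\<Sum>v\<in>V. (x v + t * e v) * (x v + t * e v)) = (\<Sum>v\<in>V. x v * x v + 2 * t * (x v * e v) + t * t * (e v * e v))"
        by (intro sum.cong refl) (simp add: algebra_simps)
      also have "\<dots> = 1 + 2 * t * x w + t * t"
        unfolding sum.distrib sum_distrib_left[symmetric] e1 x by (simp add: e_def)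
      finally show ?thesis .
    qed
    have "g - m * x w = 0"
    proof (rule nonneg_quadratic_imp_linear_zero)
      fix t
      show "0 \<le> 2 * t * (g - m * x w) + t * t * (adjacency E w w - m)"
        using min[of "\<lambda>v. x v + t * e v"] unfolding Qt nt m_def[symmetric] by (simp add: algebra_simps)
    qed
    then show ?thesis by (simp add: g_def)
  qed
  moreover have "\<exists>v\<in>V. x v \<noteq> 0"
  proof (rule ccontr)
    assume "\<not> (\<exists>v\<in>V. x v \<noteq> 0)"
    then have "(\<Sum>v\<in>V. x v * x v) = 0" by simp
    then show False using x by simp
  qed
  ultimately have "adjacency_eigenvalue V E m" by (auto simp: adjacency_eigenvalue_def)
  then show thesis using that min by (auto simp: m_def)
qed

section \<open>The Gaussian wave on an arc-transitive graph\<close>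

locale arc_transitive_graph =
  fixes V :: "'a set" and E :: "'a set set" and d :: nat
  assumes simple: "simple_graph V E" and nonempty: "V \<noteq> {}" and d3: "d \<ge> 3"
    and regular: "regular_graph V E d" and arc: "arc_transitive V E"
begin

section \<open>Neighbourhoods and bounds for the least eigenvalue\<close>

definition nbrs :: "'a \<Rightarrow> 'a set" where "nbrs v = {u \<in> V. {v, u} \<in> E}"

abbreviation ev :: real where "ev \<equiv> least_eigenvalue V E"

lemma finite_V [simp]: "finite V" and edge_neq: "{u, v} \<in> E \<Longrightarrow> u \<noteq> v"
  using simple unfolding simple_graph_def by (auto dest!: subsetD)

lemma finite_nbrs [simp]: "finite (nbrs v)" and nbrs_V: "u \<in> nbrs v \<Longrightarrow> u \<in> V"
  by (auto simp: nbrs_def)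

lemma card_nbrs: "v \<in> V \<Longrightarrow> card (nbrs v) = d"
  using regular by (auto simp: regular_graph_def nbrs_def)

lemma sum_adjacency: "(\<Sum>u\<in>V. adjacency E v u * x u) = (\<Sum>u\<in>nbrs v. x u)"
proof -
  have "(\<Sum>u\<in>V. adjacency E v u * x u) = (\<Sum>u\<in>V. if {v, u} \<in> E then x u else 0)"
    by (rule sum.cong) (auto simp: adjacency_def)
  then show ?thesis by (simp add: nbrs_def sum.inter_filter)
qed

lemma exists_nbr: "v \<in> V \<Longrightarrow> \<exists>u. u \<in> nbrs v"
  using card_nbrs[of v] d3 by (metis card.empty equals0I not_numeral_le_zero)

text \<open>The constant vector is an eigenvector; this makes the set of eigenvalues nonempty, so
  that its \<open>Min\<close> is one of them.\<close>

lemma eigenvalue_d: "adjacency_eigenvalue V E (real d)"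
  unfolding adjacency_eigenvalue_def sum_adjacency
  using nonempty card_nbrs by (intro exI[of _ "\<lambda>_. 1"]) auto

lemma eigenvalue_ev: "adjacency_eigenvalue V E ev"
  using Min_in[OF finite_adjacency_eigenvalues[OF finite_V, of E]] eigenvalue_d
  by (auto simp: least_eigenvalue_def)

lemma ev_le: "adjacency_eigenvalue V E m \<Longrightarrow> ev \<le> m"
  unfolding least_eigenvalue_def
  by (rule Min_le[OF finite_adjacency_eigenvalues[OF finite_V]]) simp

text \<open>The vector with values \<open>1\<close> and \<open>-1\<close> at the ends of an edge has
  Rayleigh quotient \<open>-1\<close>. The bound is used for \<open>0 \<le> rho d ev\<close> and for
  the positive variance of differences along edges.\<close>

lemma ev_le_minus_1: "ev \<le> -1"
proof -
  obtain m where m: "adjacency_eigenvalue V E m"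
    and le: "\<And>y. m * (\<Sum>v\<in>V. y v * y v) \<le> (\<Sum>u\<in>V. \<Sum>v\<in>V. adjacency E u v * y u * y v)"
    using exists_eigenvalue_le_rayleigh[OF finite_V nonempty] by blast
  obtain u where u: "u \<in> V" using nonempty by blast
  obtain v where v: "v \<in> nbrs u" using exists_nbr[OF u] by blast
  then have v': "v \<in> V" "{u, v} \<in> E" "u \<noteq> v" using edge_neq by (auto simp: nbrs_def)
  define y :: "'a \<Rightarrow> real" where "y w = (if w = u then 1 else 0) - (if w = v then 1 else 0)" for w
  have s: "(\<Sum>w\<in>V. h w * y w) = h u - h v" for h
  proof -
    have "(\<Sum>w\<in>V. h w * y w) = (\<Sum>w\<in>V. (if w = u then h w else 0) - (if w = v then h w else 0))"
      by (rule sum.cong) (auto simp: y_def)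
    then show ?thesis using u v' by (simp add: sum_subtractf)
  qed
  have "(\<Sum>w\<in>V. y w * y w) = 2" unfolding s using v' by (simp add: y_def)
  moreover have "(\<Sum>a\<in>V. \<Sum>b\<in>V. adjacency E a b * y a * y b) = (\<Sum>a\<in>V. (adjacency E a u - adjacency E a v) * y a)"
  proof (intro sum.cong refl)
    fix a
    show "(\<Sum>b\<in>V. adjacency E a b * y a * y b) = (adjacency E a u - adjacency E a v) * y a"
      unfolding s by (simp add: algebra_simps)
  qed
  moreover have "\<dots> = -2"
    unfolding s using v' edge_neq[of u u] edge_neq[of v v] by (auto simp: adjacency_def insert_commute)
  ultimately have "m \<le> -1" using le[of y] by simp
  then show ?thesis using ev_le[OF m] by simp
qed

text \<open>The eigenvalue equation is read at a vertex where the eigenvector has the largest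
  absolute value. The bound amounts to \<open>rho d ev \<le> 1\<close>.\<close>

lemma ev_ge: "- real d \<le> ev"
proof -
  obtain x where x0: "\<exists>v\<in>V. x v \<noteq> 0" and x: "\<And>v. v \<in> V \<Longrightarrow> (\<Sum>u\<in>nbrs v. x u) = ev * x v"
    using eigenvalue_ev unfolding adjacency_eigenvalue_def sum_adjacency by blast
  obtain v where v: "v \<in> V" "\<And>u. u \<in> V \<Longrightarrow> \<bar>x u\<bar> \<le> \<bar>x v\<bar>"
  proof -
    have "Max ((\<lambda>u. \<bar>x u\<bar>) ` V) \<in> (\<lambda>u. \<bar>x u\<bar>) ` V" using nonempty by (intro Max_in) auto
    then obtain v where v: "v \<in> V" "Max ((\<lambda>u. \<bar>x u\<bar>) ` V) = \<bar>x v\<bar>" by auto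
    have "\<bar>x u\<bar> \<le> \<bar>x v\<bar>" if "u \<in> V" for u unfolding v(2)[symmetric] using that by (intro Max_ge) auto
    then show thesis using that v by blast
  qed
  have xv: "\<bar>x v\<bar> > 0" using x0 v by force
  have "\<bar>ev\<bar> * \<bar>x v\<bar> = \<bar>\<Sum>u\<in>nbrs v. x u\<bar>" unfolding x[OF v(1)] by (simp add: abs_mult)
  also have "\<dots> \<le> (\<Sum>u\<in>nbrs v. \<bar>x u\<bar>)" by (rule sum_abs)
  also have "\<dots> \<le> (\<Sum>u\<in>nbrs v. \<bar>x v\<bar>)" using v nbrs_V by (intro sum_mono) auto
  also have "\<dots> = real d * \<bar>x v\<bar>" using card_nbrs[OF v(1)] by simp
  finally have "\<bar>ev\<bar> \<le> real d" using xv by simp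
  then show ?thesis by simp
qed

section \<open>Automorphisms and the invariant covariance\<close>

definition Aut :: "('a \<Rightarrow> 'a) set" where "Aut = {f \<in> V \<rightarrow>\<^sub>E V. graph_automorphism V E f}"

text \<open>Taking automorphisms as extensional functions on \<open>V\<close> identifies those that
  agree on \<open>V\<close>, which makes the set finite although the type \<open>'a\<close> may be
  infinite.\<close>

lemma finite_Aut [simp]: "finite Aut"
  unfolding Aut_def by (rule finite_subset[of _ "V \<rightarrow>\<^sub>E V"]) (auto intro: finite_PiE)

lemma Aut_in_V: "f \<in> Aut \<Longrightarrow> v \<in> V \<Longrightarrow> f v \<in> V"
  by (auto simp: Aut_def)

lemma Aut_comp:
  assumes f: "f \<in> Aut" and g: "graph_automorphism V E g"
  shows "restrict (f \<circ> g) V \<in> Aut"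
proof -
  have b: "bij_betw f V V" "bij_betw g V V" using f g by (auto simp: Aut_def graph_automorphism_def)
  have gV: "g v \<in> V" if "v \<in> V" for v using b(2) that by (auto simp: bij_betw_def)
  have "bij_betw (restrict (f \<circ> g) V) V V"
    using bij_betw_trans[OF b(2,1)] by (simp cong: bij_betw_cong)
  then show ?thesis using f g gV Aut_in_V[OF f] by (auto simp: Aut_def graph_automorphism_def)
qed

text \<open>Injective because \<open>g\<close> is onto \<open>V\<close>, hence bijective by
  finiteness. This reindexing is what makes \<open>cov\<close> invariant.\<close>

lemma bij_betw_Aut_comp:
  assumes g: "graph_automorphism V E g"
  shows "bij_betw (\<lambda>f. restrict (f \<circ> g) V) Aut Aut"
proof -
  have gV: "g ` V = V" using g by (auto simp: graph_automorphism_def bij_betw_def)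
  have "inj_on (\<lambda>f. restrict (f \<circ> g) V) Aut"
  proof (rule inj_onI)
    fix f f' assume ff: "f \<in> Aut" "f' \<in> Aut" "restrict (f \<circ> g) V = restrict (f' \<circ> g) V"
    have "f (g v) = f' (g v)" if "v \<in> V" for v
      using fun_cong[OF ff(3), of v] that by simp
    then have "f w = f' w" if "w \<in> V" for w using gV that by (metis image_iff)
    then show "f = f'" using ff by (auto simp: Aut_def intro: PiE_ext)
  qed
  moreover have "(\<lambda>f. restrict (f \<circ> g) V) ` Aut \<subseteq> Aut" using Aut_comp[OF _ g] by blast
  ultimately show ?thesis by (simp add: bij_betw_def endo_inj_surj)
qed

definition eigvec :: "'a \<Rightarrow> real" where
  "eigvec = (SOME x. (\<exists>v\<in>V. x v \<noteq> 0) \<and> (\<forall>v\<in>V. (\<Sum>u\<in>nbrs v. x u) = ev * x v))"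

lemma eigvec_nonzero: "\<exists>v\<in>V. eigvec v \<noteq> 0" and eigvec_eigen: "v \<in> V \<Longrightarrow> (\<Sum>u\<in>nbrs v. eigvec u) = ev * eigvec v"
proof -
  have "\<exists>x. (\<exists>v\<in>V. x v \<noteq> 0) \<and> (\<forall>v\<in>V. (\<Sum>u\<in>nbrs v. x u) = ev * x v)"
    using eigenvalue_ev unfolding adjacency_eigenvalue_def sum_adjacency by blast
  from someI_ex[OF this] show "\<exists>v\<in>V. eigvec v \<noteq> 0" "v \<in> V \<Longrightarrow> (\<Sum>u\<in>nbrs v. eigvec u) = ev * eigvec v"
    unfolding eigvec_def by blast+
qed

text \<open>The covariance of the Gaussian eigenvector \<open>\<Sum>f\<in>Aut. z f * eigvec (f v)\<close>. Summing over the
  automorphisms makes it invariant without a spectral decomposition.\<close>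

definition cov :: "'a \<Rightarrow> 'a \<Rightarrow> real" where "cov u v = (\<Sum>f\<in>Aut. eigvec (f u) * eigvec (f v))"

lemma cov_commute: "cov u v = cov v u"
  by (simp add: cov_def mult.commute)

lemma cov_invariant:
  assumes g: "graph_automorphism V E g" and "u \<in> V" "v \<in> V"
  shows "cov (g u) (g v) = cov u v"
proof -
  have "cov u v = (\<Sum>f\<in>Aut. eigvec (restrict (f \<circ> g) V u) * eigvec (restrict (f \<circ> g) V v))"
    unfolding cov_def by (rule sum.reindex_bij_betw[OF bij_betw_Aut_comp[OF g], symmetric])
  then show ?thesis using assms by (simp add: cov_def)
qed

lemma nbrs_image:
  assumes f: "f \<in> Aut" and v: "v \<in> V"
  shows "bij_betw f (nbrs v) (nbrs (f v))"
proof -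
  have ga: "bij_betw f V V" "\<And>u. u \<in> V \<Longrightarrow> {f v, f u} \<in> E \<longleftrightarrow> {v, u} \<in> E"
    using f v by (auto simp: Aut_def graph_automorphism_def)
  have "f ` nbrs v = nbrs (f v)"
  proof (intro equalityI subsetI)
    fix x assume x: "x \<in> nbrs (f v)"
    then obtain u where "u \<in> V" "x = f u" using ga(1) by (auto simp: nbrs_def bij_betw_def)
    then show "x \<in> f ` nbrs v" using x ga(2) by (auto simp: nbrs_def)
  qed (use ga f Aut_in_V in \<open>auto simp: nbrs_def\<close>)
  moreover have "inj_on f (nbrs v)" using ga(1) by (auto simp: bij_betw_def nbrs_def intro: inj_on_subset)
  ultimately show ?thesis by (simp add: bij_betw_def)
qed

text \<open>Automorphisms map neighbourhoods to neighbourhoods, so \<open>eigvec\<close> composed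
  with any \<open>f \<in> Aut\<close> again satisfies the eigenvalue equation for \<open>ev\<close>,
  and so does every row of \<open>cov\<close> as a combination of these functions.\<close>

lemma sum_cov_nbrs:
  assumes v: "v \<in> V"
  shows "(\<Sum>u\<in>nbrs v. cov w u) = ev * cov w v"
proof -
  have "(\<Sum>u\<in>nbrs v. cov w u) = (\<Sum>f\<in>Aut. eigvec (f w) * (\<Sum>u\<in>nbrs v. eigvec (f u)))"
    unfolding cov_def sum_distrib_left by (rule sum.swap)
  also have "\<dots> = (\<Sum>f\<in>Aut. eigvec (f w) * (ev * eigvec (f v)))"
  proof (intro sum.cong refl)
    fix f assume f: "f \<in> Aut"
    have "(\<Sum>u\<in>nbrs v. eigvec (f u)) = (\<Sum>u\<in>nbrs (f v). eigvec u)"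
      by (rule sum.reindex_bij_betw[OF nbrs_image[OF f v]])
    also have "\<dots> = ev * eigvec (f v)" by (rule eigvec_eigen[OF Aut_in_V[OF f v]])
    finally show "eigvec (f w) * (\<Sum>u\<in>nbrs v. eigvec (f u)) = eigvec (f w) * (ev * eigvec (f v))" by simp
  qed
  finally show ?thesis by (simp add: cov_def sum_distrib_left mult_ac)
qed

text \<open>An automorphism carries one arc to the other, and \<open>cov\<close> is invariant. As
  every vertex starts an arc, this also covers the variances at all vertices.\<close>

lemma cov_edge_eq:
  assumes "u \<in> V" "v \<in> nbrs u" "u' \<in> V" "v' \<in> nbrs u'"
  shows "cov u v = cov u' v'" "cov u u = cov u' u'"
proof -
  obtain f where f: "graph_automorphism V E f" "f u = u'" "f v = v'"
    using arc assms unfolding arc_transitive_def nbrs_def by (metis (mono_tags, lifting) mem_Collect_eq)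
  show "cov u v = cov u' v'" "cov u u = cov u' u'"
    using cov_invariant[OF f(1), of u v] cov_invariant[OF f(1), of u u] f assms nbrs_V by auto
qed

text \<open>The identity contributes a positive term at a vertex where \<open>eigvec\<close> does
  not vanish; equality of the variances carries this to every vertex.\<close>

lemma cov_self_pos:
  assumes u: "u \<in> V" shows "0 < cov u u"
proof -
  obtain w where w: "w \<in> V" "eigvec w \<noteq> 0" using eigvec_nonzero by blast
  have "graph_automorphism V E (restrict id V)"
    by (auto simp: graph_automorphism_def bij_betw_def inj_on_def)
  then have "restrict id V \<in> Aut" by (simp add: Aut_def)
  then have "eigvec (restrict id V w) * eigvec (restrict id V w) \<le> cov w w"
    unfolding cov_def by (rule member_le_sum[where f="\<lambda>f. eigvec (f w) * eigvec (f w)"]) auto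
  then have "0 < cov w w" using w by (auto simp: zero_less_mult_iff linorder_neq_iff intro: less_le_trans[rotated])
  moreover have "cov w w = cov u u" using exists_nbr[OF u] exists_nbr[OF w(1)] cov_edge_eq(2) u w by metis
  ultimately show ?thesis by simp
qed

lemma cov_nbr:
  assumes "u \<in> V" "v \<in> nbrs u" shows "real d * cov u v = ev * cov u u"
proof -
  have "(\<Sum>w\<in>nbrs u. cov u w) = (\<Sum>w\<in>nbrs u. cov u v)"
    using cov_edge_eq(1)[OF assms(1) _ assms] by (intro sum.cong) auto
  then show ?thesis using sum_cov_nbrs[OF assms(1), of u] card_nbrs[OF assms(1)] by simp
qed

section \<open>Local maxima of the wave\<close>

abbreviation wave :: "'a \<Rightarrow> (('a \<Rightarrow> 'a) \<Rightarrow> real) \<Rightarrow> real" where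
  "wave v z \<equiv> \<Sum>f\<in>Aut. eigvec (f v) * z f"

text \<open>Divided by \<open>sqrt D\<close>, the differences along the edges at \<open>v\<close>
  have unit variances, and the eigenvalue equation makes their row sums
  \<open>(real d - ev) / 2\<close>, the row sum of \<open>Omega d ev\<close>. This is what
  \<open>orthant_equicorrelated_le\<close> requires.\<close>

lemma orthant_le_local_maximum:
  assumes v: "v \<in> V"
  shows "orthant_probability d ev \<le> (\<integral>z. (\<Prod>u\<in>nbrs v. indicator {0<..} (wave v z - wave u z)) \<partial>gauss_vec Aut)"
proof -
  define c0 where "c0 = cov v v"
  \<comment> \<open>The variance of \<open>wave v - wave u\<close> for every neighbour
    \<open>u\<close> of \<open>v\<close>.\<close>
  define D where "D = 2 * c0 * (1 - ev / d)"
  have c0: "c0 > 0" using cov_self_pos[OF v] by (simp add: c0_def)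
  have d: "real d > 0" using d3 by simp
  have "ev / d < 1" using ev_le_minus_1 d by (simp add: divide_less_eq)
  then have D: "D > 0" using c0 by (simp add: D_def)
  have same: "cov u u = c0" "cov v u = ev / d * c0" if "u \<in> nbrs v" for u
  proof -
    have u: "u \<in> V" using nbrs_V that by blast
    show "cov u u = c0"
      using exists_nbr[OF u] cov_edge_eq(2)[OF u _ v that] by (auto simp: c0_def)
    show "cov v u = ev / d * c0" using cov_nbr[OF v that] d by (simp add: c0_def field_simps)
  qed
  obtain h where h: "bij_betw h {..<d} (nbrs v)"
    using ex_bij_betw_nat_finite[of "nbrs v"] card_nbrs[OF v] by (auto simp: atLeast0LessThan)
  have hN: "h i \<in> nbrs v" if "i < d" for i using h that by (auto simp: bij_betw_def)
  define a where "a i f = (eigvec (f v) - eigvec (f (h i))) / sqrt D" for i f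
  have aa: "(\<Sum>f\<in>Aut. a i f * a j f) = (c0 - 2 * (ev / d * c0) + cov (h i) (h j)) / D" if "i < d" "j < d" for i j
  proof -
    have "(\<Sum>f\<in>Aut. a i f * a j f) = (\<Sum>f\<in>Aut. eigvec (f v) * eigvec (f v) - eigvec (f v) * eigvec (f (h j)) - eigvec (f v) * eigvec (f (h i)) + eigvec (f (h i)) * eigvec (f (h j))) / D"
      unfolding sum_divide_distrib using D by (intro sum.cong) (auto simp: a_def algebra_simps)
    also have "\<dots> = (cov v v - cov v (h j) - cov v (h i) + cov (h i) (h j)) / D"
      by (simp add: sum.distrib sum_subtractf cov_def)
    finally show ?thesis using same[OF hN] that by (simp add: c0_def[symmetric])
  qed
  obtain X where X: "jointly_gaussian (gauss_vec {..<d}) {..<d} X (\<lambda>i j. if i = j then 1 else rho d ev)"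
    and q: "orthant_probability d ev = (\<integral>z. (\<Prod>i<d. indicator {0<..} (X i z)) \<partial>gauss_vec {..<d})"
    by (rule orthant_probability_eq[OF d3 ev_ge]) (use ev_le_minus_1 in auto)
  have rd: "(real d - 1) * rho d ev = (real d - 2 - ev) / 2"
    using d3 by (simp add: rho_def field_simps)
  have "orthant_probability d ev \<le> (\<integral>z. (\<Prod>i<d. indicator {0<..} (\<Sum>f\<in>Aut. a i f * z f) :: real) \<partial>gauss_vec Aut)"
    unfolding q
  proof (rule orthant_equicorrelated_le[OF finite_Aut _ _ _ _ _ _ X])
    show "{..<d} \<noteq> {}" using d3 by (auto simp: lessThan_empty_iff)
    show "(\<Sum>f\<in>Aut. a i f * a i f) = 1" if "i \<in> {..<d}" for i
    proof -
      have "(\<Sum>f\<in>Aut. a i f * a i f) = D / D"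
        using aa[of i i] that same(1)[OF hN[of i]] by (simp add: D_def algebra_simps)
      then show ?thesis using D by simp
    qed
    show "0 \<le> rho d ev" using ev_le_minus_1 d3 by (simp add: rho_def)
    show "rho d ev \<le> 1" using ev_ge d3 by (simp add: rho_def field_simps)
    fix i assume i: "i \<in> {..<d}"
    have "(\<Sum>j<d. \<Sum>f\<in>Aut. a i f * a j f) = (\<Sum>j<d. (c0 - 2 * (ev / d * c0) + cov (h i) (h j)) / D)"
      using aa i by (intro sum.cong) auto
    also have "\<dots> = (real d * (c0 - 2 * (ev / d * c0)) + (\<Sum>j<d. cov (h i) (h j))) / D"
      by (simp add: sum_divide_distrib[symmetric] sum.distrib)
    also have "(\<Sum>j<d. cov (h i) (h j)) = (\<Sum>u\<in>nbrs v. cov (h i) u)"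
      by (rule sum.reindex_bij_betw[OF h])
    also have "\<dots> = ev * (ev / d * c0)"
      using sum_cov_nbrs[OF v, of "h i"] same(2)[OF hN[of i]] i by (simp add: cov_commute)
    also have "(real d * (c0 - 2 * (ev / d * c0)) + ev * (ev / d * c0)) / D = (real d - ev) / 2"
    proof -
      have "real d * (c0 - 2 * (ev / d * c0)) + ev * (ev / d * c0) = (real d - ev) / 2 * D"
        using d by (simp add: D_def field_simps)
      then show ?thesis using D by simp
    qed
    also have "\<dots> = 1 + (real (card {..<d}) - 1) * rho d ev" using rd by simp
    finally show "(\<Sum>j<d. \<Sum>f\<in>Aut. a i f * a j f) = 1 + (real (card {..<d}) - 1) * rho d ev" .
  qed simp
  also have "\<dots> = (\<integral>z. (\<Prod>u\<in>nbrs v. indicator {0<..} (wave v z - wave u z)) \<partial>gauss_vec Aut)"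
  proof (rule Bochner_Integration.integral_cong[OF refl])
    fix z
    have "(\<Sum>f\<in>Aut. a i f * z f) = (wave v z - wave (h i) z) / sqrt D" for i
      by (simp add: a_def sum_divide_distrib sum_subtractf[symmetric] algebra_simps diff_divide_distrib)
    then have "(\<Prod>i<d. indicator {0<..} (\<Sum>f\<in>Aut. a i f * z f) :: real) = (\<Prod>i<d. indicator {0<..} (wave v z - wave (h i) z))"
      using D by (intro prod.cong) (auto simp: indicator_def zero_less_divide_iff)
    also have "\<dots> = (\<Prod>u\<in>nbrs v. indicator {0<..} (wave v z - wave u z))"
      by (rule prod.reindex_bij_betw[OF h])
    finally show "(\<Prod>i<d. indicator {0<..} (\<Sum>f\<in>Aut. a i f * z f) :: real) = (\<Prod>u\<in>nbrs v. indicator {0<..} (wave v z - wave u z))" .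
  qed
  finally show ?thesis .
qed

text \<open>For every sample the strict local maxima of the wave form an independent set. Their
  expected number is a sum of local probabilities, each at least the orthant probability.\<close>

lemma independence_bound: "orthant_probability d ev \<le> real (independence_number V E) / real (card V)"
proof -
  interpret G: prob_space "gauss_vec Aut" by (rule prob_space_gauss_vec)
  let ?F = "\<lambda>v z. (\<Prod>u\<in>nbrs v. indicator {0<..} (wave v z - wave u z)) :: real"
  have i: "integrable (gauss_vec Aut) (?F v)" for v
    by (rule G.integrable_const_bound[where B=1]) (auto simp: abs_prod intro!: prod_le_1)
  have le: "(\<Sum>v\<in>V. ?F v z) \<le> real (independence_number V E)" for z
  proof -
    \<comment> \<open>The inequality is strict, so two adjacent vertices cannot both belong to
      \<open>S\<close>.\<close>
    define S where "S = {v \<in> V. \<forall>u\<in>nbrs v. wave u z < wave v z}"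
    have "?F v z = (if v \<in> S then 1 else 0)" if vV: "v \<in> V" for v
    proof (cases "v \<in> S")
      case False
      then obtain u where "u \<in> nbrs v" "\<not> wave u z < wave v z" using vV by (auto simp: S_def)
      then have "?F v z = 0" by (intro prod_zero) (auto simp: indicator_def)
      then show ?thesis using False by simp
    qed (auto simp: S_def)
    then have "(\<Sum>v\<in>V. ?F v z) = (\<Sum>v\<in>V. if v \<in> S then 1 else 0)" by (intro sum.cong) auto
    also have "\<dots> = real (card S)" by (simp add: S_def sum.inter_filter[symmetric])
    also have "card S \<le> independence_number V E"
      unfolding independence_number_def
    proof (rule Max_ge)
      have "{S. independent_set V E S} \<subseteq> Pow V" by (auto simp: independent_set_def)
      then show "finite (card ` {S. independent_set V E S})" by (intro finite_imageI) (auto intro: finite_subset)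
      have "{u, v} \<notin> E" if uv: "u \<in> S" "v \<in> S" for u v
      proof
        assume "{u, v} \<in> E"
        then have "v \<in> nbrs u" "u \<in> nbrs v" using uv by (auto simp: S_def nbrs_def insert_commute)
        then have "wave v z < wave u z" "wave u z < wave v z" using uv unfolding S_def by blast+
        then show False by simp
      qed
      then have "independent_set V E S" by (auto simp: independent_set_def S_def)
      then show "card S \<in> card ` {S. independent_set V E S}" by blast
    qed
    finally show ?thesis by simp
  qed
  have "real (card V) * orthant_probability d ev = (\<Sum>v\<in>V. orthant_probability d ev)" by simp
  also have "\<dots> \<le> (\<Sum>v\<in>V. \<integral>z. ?F v z \<partial>gauss_vec Aut)" by (intro sum_mono orthant_le_local_maximum)
  also have "\<dots> = (\<integral>z. (\<Sum>v\<in>V. ?F v z) \<partial>gauss_vec Aut)" using i by simp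
  also have "\<dots> \<le> (\<integral>z. real (independence_number V E) \<partial>gauss_vec Aut)"
    using i le by (intro integral_mono) auto
  also have "\<dots> = real (independence_number V E)" by (simp add: G.prob_space)
  finally show ?thesis using nonempty by (simp add: field_simps card_gt_0_iff)
qed

end

theorem corollary6p3:
  fixes V :: "'a set" and E :: "'a set set" and d :: nat
  assumes "simple_graph V E"
    and "V \<noteq> {}"
    and "d \<ge> 3"
    and "regular_graph V E d"
    and "arc_transitive V E"
  shows "real (independence_number V E) / real (card V) \<ge> orthant_probability d (least_eigenvalue V E)"
proof -
  interpret arc_transitive_graph V E d by unfold_locales (fact assms)+
  show ?thesis by (rule independence_bound)
qed

end
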